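(* Assume: (1) $\partial G\in C^4$; (2) $a=\sigma\sigma^\top$ is uniformly elliptic in $\bar G$, and $a,b\in C^2(\bar G)$; (3) $g\in C^2(\bar G)$, $\psi\in C^3(\partial G)$; (4) $c\in C^2(\bar G)$ with $c(x)<0$ for all $x\in\bar G$, and $\gamma\in C^3(\partial G)$ with $\gamma(z)\le0$ for all $z\in\partial G$. Let $u$ be the solution of the elliptic Robin problem $$\mathscr Au+c(x)u+g(x)=0,\ x\in G,\qquad \frac{\partial u}{\partial\nu}+\gamma(z)u=\psi(z),\ z\in\partial G,$$ and let $Z_N$ be computed by the algorithm described in the context with step $h$, $T=Nh$, $X_0=x\in\bar G$, $Y_0=1$, $Z_0=0$. Then there are positive constants $C$ and $\lambda$, independent of $T$ and $h$, such that for all sufficiently small $h>0$ $$|\mathbb E(Z_N)-u(x)|\le C\big(h+e^{-\lambda T}\big).$$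
   Context: $C^p(\bar G)$, $C^p(\partial G)$ abbreviate the Hölder spaces $C^{p+\epsilon}$ for an $\epsilon\in(0,1)$; similarly for $\partial G\in C^4$. $G\subset\mathbb R^d$ is a bounded domain with boundary $\partial G$; $\nu(z)$ is the inward unit normal at $z\in\partial G$; $b:\bar G\to\mathbb R^d$, $\sigma:\bar G\to\mathbb R^{d\times d}$, $a=\sigma\sigma^\top$; $\sigma\in C^2(\bar G)$. $\mathscr A=\frac12\sum_{i,j}a^{ij}(x)\frac{\partial^2}{\partial x^i\partial x^j}+\sum_ib^i(x)\frac{\partial}{\partial x^i}$. Uniform ellipticity: there is $a_0>0$ with $(a(x)y\cdot y)\ge a_0|y|^2$ for all $x\in\bar G$, $y\in\mathbb R^d$. Under (1)-(4) the Robin problem has a unique solution $u\in C^4(\bar G)$. Algorithm: $\xi_k=(\xi_k^1,\dots,\xi_k^d)^\top$ with all $\xi_k^i$ mutually independent and equal to $\pm1$ with probability $1/2$. Given $(X_k,Y_k,Z_k)$ put $X'_{k+1}=X_k+hb(X_k)+h^{1/2}\sigma(X_k)\xi_{k+1}$. If $X'_{k+1}\in\bar G$: $X_{k+1}=X'_{k+1}$, $Y_{k+1}=Y_k+hc(X_k)Y_k$, $Z_{k+1}=Z_k+hg(X_k)Y_k$. If $X'_{k+1}\notin\bar G$, let $X^\pi_{k+1}$ be the projection of $X'_{k+1}$ on $\partial G$ (unique for small $h$), $r_{k+1}=|X'_{k+1}-X^\pi_{k+1}|$, and $$X_{k+1}=X'_{k+1}+2r_{k+1}\nu(X^\pi_{k+1}),\quad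 Y_{k+1}=Y_k+hc(X_k)Y_k+2r_{k+1}\gamma(X^\pi_{k+1})Y_k+2r_{k+1}^2\gamma^2(X^\pi_{k+1})Y_k,$$ $$Z_{k+1}=Z_k+hg(X_k)Y_k-2r_{k+1}\psi(X^\pi_{k+1})Y_k-2r_{k+1}^2\psi(X^\pi_{k+1})\gamma(X^\pi_{k+1})Y_k.$$ *)

theory Defs
  imports "HOL-Probability.Probability"
begin

section \<open>Hoelder spaces\<close>

definition holder_continuous_on ::
    "real \<Rightarrow> 'a::metric_space set \<Rightarrow> ('a \<Rightarrow> 'b::metric_space) \<Rightarrow> bool" where
  "holder_continuous_on \<alpha> S f \<longleftrightarrow> (\<exists>L. \<forall>x\<in>S. \<forall>y\<in>S. dist (f x) (f y) \<le> L * dist x y powr \<alpha>)"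

definition partial_deriv ::
    "'d::finite \<Rightarrow> (real^'d \<Rightarrow> 'b::real_normed_vector) \<Rightarrow> real^'d \<Rightarrow> 'b" where
  "partial_deriv i f x = frechet_derivative f (at x) (axis i 1)"

text \<open>\<open>holder_space p \<alpha> U f\<close>, for open \<open>U\<close>, says that \<open>f\<close> belongs to \<open>C^(p+\<alpha>)\<close> on the closure of
  \<open>U\<close>: the partial derivatives of order at most \<open>p\<close> exist in \<open>U\<close> and extend continuously to the
  closure, and the extensions of those of order \<open>p\<close> are \<open>\<alpha>\<close>-Hoelder continuous there. The
  existentially quantified \<open>g\<close> is the extension of a first-order derivative.\<close>

primrec holder_space ::
    "nat \<Rightarrow> real \<Rightarrow> (real^'d::finite) set \<Rightarrow> (real^'d \<Rightarrow> 'b::real_normed_vector) \<Rightarrow> bool" where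
  "holder_space 0 \<alpha> U f \<longleftrightarrow> holder_continuous_on \<alpha> (closure U) f"
| "holder_space (Suc p) \<alpha> U f \<longleftrightarrow>
     continuous_on (closure U) f \<and> (\<forall>x\<in>U. f differentiable (at x)) \<and>
     (\<forall>i. \<exists>g. holder_space p \<alpha> U g \<and> (\<forall>x\<in>U. g x = partial_deriv i f x))"


section \<open>Boundary regularity\<close>

text \<open>\<open>\<Psi>\<close> straightens the boundary of \<open>G\<close> in the ball of radius \<open>r\<close> around \<open>z\<close>, taking \<open>G\<close> to the
  half-space where the \<open>i\<close>-th coordinate is positive; \<open>\<Phi>\<close> is its inverse. Both are of class
  \<open>C^(p+\<alpha>)\<close> up to the boundary of their domains, which is no restriction compared with interior
  regularity since \<open>r\<close> may be decreased.\<close>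

definition boundary_chart ::
    "nat \<Rightarrow> real \<Rightarrow> (real^'d::finite) set \<Rightarrow> real^'d \<Rightarrow> real \<Rightarrow> 'd \<Rightarrow>
     (real^'d \<Rightarrow> real^'d) \<Rightarrow> (real^'d \<Rightarrow> real^'d) \<Rightarrow> bool" where
  "boundary_chart p \<alpha> G z r i \<Psi> \<Phi> \<longleftrightarrow>
     r > 0 \<and> open (\<Psi> ` ball z r) \<and> (\<forall>x\<in>ball z r. \<Phi> (\<Psi> x) = x) \<and>
     holder_space p \<alpha> (ball z r) \<Psi> \<and> holder_space p \<alpha> (\<Psi> ` ball z r) \<Phi> \<and>
     (\<forall>x\<in>ball z r. (x \<in> G \<longleftrightarrow> \<Psi> x $ i > 0) \<and> (x \<in> frontier G \<longleftrightarrow> \<Psi> x $ i = 0))"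

definition holder_boundary :: "nat \<Rightarrow> real \<Rightarrow> (real^'d::finite) set \<Rightarrow> bool" where
  "holder_boundary p \<alpha> G \<longleftrightarrow>
     (\<forall>z\<in>frontier G. \<exists>r i \<Psi> \<Phi>. boundary_chart p \<alpha> G z r i \<Psi> \<Phi>)"

definition flatten :: "'d::finite \<Rightarrow> real^'d \<Rightarrow> real^'d" where
  "flatten i y = (\<chi> j. if j = i then 0 else y $ j)"

text \<open>\<open>C^(p+\<alpha>)\<close> functions on the boundary: in local charts, \<open>\<phi> \<circ> \<Phi>\<close> is of class \<open>C^(p+\<alpha>)\<close> on a
  piece of the hyperplane where the \<open>i\<close>-th coordinate vanishes. A function on that hyperplane is
  represented by its extension to the whole space that does not depend on the \<open>i\<close>-th coordinate.\<close>

definition holder_space_boundary ::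
    "nat \<Rightarrow> real \<Rightarrow> (real^'d::finite) set \<Rightarrow> (real^'d \<Rightarrow> real) \<Rightarrow> bool" where
  "holder_space_boundary p \<alpha> G \<phi> \<longleftrightarrow>
     (\<forall>z\<in>frontier G. \<exists>r i \<Psi> \<Phi>. boundary_chart p \<alpha> G z r i \<Psi> \<Phi> \<and>
        holder_space p \<alpha> {y. flatten i y \<in> \<Psi> ` ball z r} (\<lambda>y. \<phi> (\<Phi> (flatten i y))))"

text \<open>Tangent vectors at \<open>z\<close> are the velocities at \<open>z\<close> of curves in the boundary.\<close>

definition inward_unit_normal :: "'a::real_inner set \<Rightarrow> 'a \<Rightarrow> 'a \<Rightarrow> bool" where
  "inward_unit_normal G z n \<longleftrightarrow>
     norm n = 1 \<and>
     (\<forall>w v. w 0 = z \<and> (\<forall>t::real. w t \<in> frontier G) \<and> (w has_vector_derivative v) (at 0)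
        \<longrightarrow> n \<bullet> v = 0) \<and>
     (\<forall>\<^sub>F t in at_right 0. z + t *\<^sub>R n \<in> G)"


section \<open>The Robin problem\<close>

definition diffusion_matrix :: "(real^'d::finite \<Rightarrow> real^'d^'d) \<Rightarrow> real^'d \<Rightarrow> real^'d^'d" where
  "diffusion_matrix \<sigma> x = \<sigma> x ** transpose (\<sigma> x)"

definition uniformly_elliptic_on ::
    "(real^'d::finite) set \<Rightarrow> (real^'d \<Rightarrow> real^'d^'d) \<Rightarrow> bool" where
  "uniformly_elliptic_on S a \<longleftrightarrow>
     (\<exists>a0>0. \<forall>x\<in>S. \<forall>y. (a x *v y) \<bullet> y \<ge> a0 * (norm y)\<^sup>2)"

definition generator ::
    "(real^'d::finite \<Rightarrow> real^'d^'d) \<Rightarrow> (real^'d \<Rightarrow> real^'d) \<Rightarrow> (real^'d \<Rightarrow> real) \<Rightarrow> real^'d \<Rightarrow> real"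
  where
  "generator a b u x =
     (1/2) * (\<Sum>i\<in>UNIV. \<Sum>j\<in>UNIV. a x $ i $ j * partial_deriv i (partial_deriv j u) x) +
     (\<Sum>i\<in>UNIV. b x $ i * partial_deriv i u x)"

text \<open>On the boundary, the normal derivative of \<open>u\<close> is the one-sided derivative along \<open>\<nu> z\<close>; it
  only involves values of \<open>u\<close> on the closure of \<open>G\<close>.\<close>

definition robin_solution ::
    "real \<Rightarrow> (real^'d::finite) set \<Rightarrow> (real^'d \<Rightarrow> real^'d) \<Rightarrow>
     (real^'d \<Rightarrow> real^'d^'d) \<Rightarrow> (real^'d \<Rightarrow> real^'d) \<Rightarrow> (real^'d \<Rightarrow> real) \<Rightarrow> (real^'d \<Rightarrow> real) \<Rightarrow>
     (real^'d \<Rightarrow> real) \<Rightarrow> (real^'d \<Rightarrow> real) \<Rightarrow> (real^'d \<Rightarrow> real) \<Rightarrow> bool" where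
  "robin_solution \<alpha> G \<nu> a b c g \<gamma> \<psi> u \<longleftrightarrow>
     holder_space 4 \<alpha> G u \<and>
     (\<forall>x\<in>G. generator a b u x + c x * u x + g x = 0) \<and>
     (\<forall>z\<in>frontier G. \<exists>D. ((\<lambda>t. u (z + t *\<^sub>R \<nu> z)) has_real_derivative D) (at_right 0) \<and>
        D + \<gamma> z * u z = \<psi> z)"


section \<open>The random walk\<close>

text \<open>\<open>e\<close> is the value of the increment \<open>\<xi>\<close> used in the step. When the nearest boundary point is not
  unique, an arbitrary one is chosen.\<close>

definition robin_step ::
    "(real^'d::finite) set \<Rightarrow> (real^'d \<Rightarrow> real^'d) \<Rightarrow>
     (real^'d \<Rightarrow> real^'d^'d) \<Rightarrow> (real^'d \<Rightarrow> real^'d) \<Rightarrow> (real^'d \<Rightarrow> real) \<Rightarrow> (real^'d \<Rightarrow> real) \<Rightarrow>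
     (real^'d \<Rightarrow> real) \<Rightarrow> (real^'d \<Rightarrow> real) \<Rightarrow> real \<Rightarrow> real^'d \<Rightarrow>
     (real^'d) \<times> real \<times> real \<Rightarrow> (real^'d) \<times> real \<times> real" where
  "robin_step G \<nu> \<sigma> b c g \<gamma> \<psi> h e = (\<lambda>(X, Y, Z).
     let X' = X + h *\<^sub>R b X + sqrt h *\<^sub>R (\<sigma> X *v e) in
     if X' \<in> closure G then (X', Y + h * c X * Y, Z + h * g X * Y)
     else
       let P = closest_point (frontier G) X'; r = dist X' P in
       (X' + (2 * r) *\<^sub>R \<nu> P,
        Y + h * c X * Y + 2 * r * \<gamma> P * Y + 2 * r\<^sup>2 * (\<gamma> P)\<^sup>2 * Y,
        Z + h * g X * Y - 2 * r * \<psi> P * Y - 2 * r\<^sup>2 * \<psi> P * \<gamma> P * Y))"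

primrec robin_walk ::
    "(real^'d::finite) set \<Rightarrow> (real^'d \<Rightarrow> real^'d) \<Rightarrow>
     (real^'d \<Rightarrow> real^'d^'d) \<Rightarrow> (real^'d \<Rightarrow> real^'d) \<Rightarrow> (real^'d \<Rightarrow> real) \<Rightarrow> (real^'d \<Rightarrow> real) \<Rightarrow>
     (real^'d \<Rightarrow> real) \<Rightarrow> (real^'d \<Rightarrow> real) \<Rightarrow> real \<Rightarrow> (nat \<Rightarrow> real^'d) \<Rightarrow> real^'d \<Rightarrow>
     nat \<Rightarrow> (real^'d) \<times> real \<times> real" where
  "robin_walk G \<nu> \<sigma> b c g \<gamma> \<psi> h e x 0 = (x, 1, 0)"
| "robin_walk G \<nu> \<sigma> b c g \<gamma> \<psi> h e x (Suc k) =
     robin_step G \<nu> \<sigma> b c g \<gamma> \<psi> h (e (Suc k)) (robin_walk G \<nu> \<sigma> b c g \<gamma> \<psi> h e x k)"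

definition walk_Z :: "(real^'d::finite) \<times> real \<times> real \<Rightarrow> real" where
  "walk_Z s = snd (snd s)"

text \<open>The increments with index \<open>k \<ge> 1\<close>. Their values are \<open>1\<close> or \<open>-1\<close> everywhere on the sample
  space, not just almost surely: the coefficients are arbitrary off the closure of \<open>G\<close>, so on a
  null set of other values the walk could fail to be measurable.\<close>

definition (in prob_space) rademacher_increments :: "(nat \<Rightarrow> 'a \<Rightarrow> real^'d::finite) \<Rightarrow> bool" where
  "rademacher_increments \<xi> \<longleftrightarrow>
     indep_vars (\<lambda>_. borel) (\<lambda>(k, i) \<omega>. \<xi> k \<omega> $ i) ({1..} \<times> UNIV) \<and>
     (\<forall>k\<ge>1. \<forall>i.
        (\<forall>\<omega>\<in>space M. \<xi> k \<omega> $ i \<in> {1, -1}) \<and>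
        prob {\<omega>\<in>space M. \<xi> k \<omega> $ i = 1} = 1/2 \<and>
        prob {\<omega>\<in>space M. \<xi> k \<omega> $ i = -1} = 1/2)"

end

theory Submission
  imports Defs
begin

text \<open>Let \<open>V = u(X) Y + Z\<close>. By the equation, the boundary condition and the moments of the increments,
  one step started at \<open>(X, Y, Z)\<close> changes the mean of \<open>V\<close> by at most a constant times
  \<open>Y (h\<^sup>2 + h E r)\<close>, where \<open>r\<close> is the overshoot beyond the boundary. The sum of these errors is
  controlled by the barrier \<open>w = const + infdist _ F\<^sup>2\<close>, where \<open>F\<close> consists of the points at distance at
  least \<open>\<delta>\<close> from the complement of \<open>G\<close>: squared distances are semiconcave, so a step inside \<open>G\<close>
  raises \<open>w\<close> by \<open>O(h)\<close> only, which the discount \<open>1 + h c\<close> absorbs, whereas a reflection lowers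
  \<open>w\<close> by \<open>4 \<delta> r\<close>. Hence \<open>\<plusminus>V + C h Y w(X)\<close> are supermartingales, and \<open>E V\<^sub>N = u(x) + O(h)\<close>; finally
  \<open>Y\<^sub>N \<le> (1 - c\<^sub>0 h)\<^sup>N\<close> because \<open>\<gamma> \<le> 0\<close> and \<open>c \<le> - c\<^sub>0 < 0\<close>. No extension of \<open>u\<close> across the boundary is
  used: two nearby points of the closure are joined by a path in \<open>G\<close> of comparable length, so \<open>u\<close> has a
  Taylor expansion on the closure, and the Taylor polynomial can be evaluated outside.\<close>

section \<open>Partial derivatives\<close>

text \<open>Estimating \<open>h E r\<close> by \<open>r = O(sqrt h)\<close> at every step would only
  give a total error of order \<open>sqrt h\<close>; the barrier shows instead that the discounted
  overshoots have a bounded mean sum. The step error is of order \<open>h\<^sup>2 + h r\<close> for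
  two reasons. Inside, the displacement has size \<open>sqrt h\<close>, so a fourth-order remainder
  is \<open>O(h\<^sup>2)\<close>, while odd moments of the increment vanish and its second moments
  reproduce the generator. At a reflection the trial point and the new position are
  \<open>P - r n\<close> and \<open>P + r n\<close>, so the values of a Taylor polynomial there
  differ by odd powers of \<open>r\<close> only, and \<open>r ^ 3 = O(h r)\<close>. The quadratic
  terms in the updates of \<open>Y\<close> and \<open>Z\<close> account for \<open>u\<close> being
  evaluated at \<open>P + r n\<close> instead of \<open>P\<close>: once \<open>\<psi>\<close> is
  eliminated by the boundary condition, the terms of order \<open>r\<close> and
  \<open>r\<^sup>2\<close> cancel up to \<open>O(h r)\<close>. The rate \<lambda> is minus the
  maximum of \<open>c\<close> on the closure.\<close>

definition has_partials_on ::
    "(real^'d::finite \<Rightarrow> 'b::real_normed_vector) \<Rightarrow> ('d \<Rightarrow> real^'d \<Rightarrow> 'b) \<Rightarrow> (real^'d) set \<Rightarrow> bool"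
    (infix "has'_partials'_on" 50 ) where
  "(f has_partials_on f') U \<longleftrightarrow>
     (\<forall>x\<in>U. (f has_derivative (\<lambda>v. \<Sum>i\<in>UNIV. v $ i *\<^sub>R f' i x)) (at x))"

lemma has_partials_onD:
  "(f has_partials_on f') U \<Longrightarrow> x \<in> U \<Longrightarrow>
   (f has_derivative (\<lambda>v. \<Sum>i\<in>UNIV. v $ i *\<^sub>R f' i x)) (at x)"
  by (simp add: has_partials_on_def)

lemma has_partials_on_subset:
  "(f has_partials_on f') U \<Longrightarrow> V \<subseteq> U \<Longrightarrow> (f has_partials_on f') V"
  by (auto simp: has_partials_on_def)

lemma has_partials_on_continuous_on:
  "(f has_partials_on f') U \<Longrightarrow> continuous_on U f"
  by (meson continuous_at_imp_continuous_on has_derivative_continuous has_partials_onD)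

lemma differentiable_has_partials:
  fixes f :: "real^'d::finite \<Rightarrow> 'b::real_normed_vector"
  assumes "f differentiable (at x)"
  shows "(f has_derivative (\<lambda>v. \<Sum>i\<in>UNIV. v $ i *\<^sub>R partial_deriv i f x)) (at x)"
proof -
  let ?D = "frechet_derivative f (at x)"
  have D: "(f has_derivative ?D) (at x)"
    using assms frechet_derivative_works by blast
  then interpret bounded_linear ?D by (rule has_derivative_bounded_linear)
  have "?D v = (\<Sum>i\<in>UNIV. v $ i *\<^sub>R partial_deriv i f x)" for v
    by (subst basis_expansion[symmetric, of v])
      (simp add: sum scale partial_deriv_def scalar_mult_eq_scaleR)
  then have "?D = (\<lambda>v. \<Sum>i\<in>UNIV. v $ i *\<^sub>R partial_deriv i f x)" by blast
  with D show ?thesis by simp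
qed

lemma has_partials_on_partial_deriv:
  assumes "(f has_partials_on f') U" "x \<in> U"
  shows "partial_deriv i f x = f' i x"
proof -
  have "frechet_derivative f (at x) = (\<lambda>v. \<Sum>i\<in>UNIV. v $ i *\<^sub>R f' i x)"
    using has_partials_onD[OF assms] frechet_derivative_at by fastforce
  then show ?thesis
    by (simp add: partial_deriv_def axis_def if_distrib[of "\<lambda>t. t *\<^sub>R _"] sum.delta cong: if_cong)
qed

text \<open>The derivatives are taken from the witnesses in \<open>holder_space\<close> and not from
  \<open>partial_deriv\<close>, because the witnesses carry the continuous values on the
  closure.\<close>

lemma holder_space_partials:
  assumes "holder_space (Suc p) \<alpha> U f"
  obtains f' where "\<And>i. holder_space p \<alpha> U (f' i)" "(f has_partials_on f') U"
proof -
  from assms obtain f' where f': "\<And>i. holder_space p \<alpha> U (f' i)"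
      "\<And>i x. x \<in> U \<Longrightarrow> f' i x = partial_deriv i f x"
    by (auto simp: choice_iff)
  have "(f has_partials_on f') U"
    using differentiable_has_partials assms by (auto simp: has_partials_on_def f'(2))
  with f'(1) show thesis by (rule that)
qed

lemma holder_space_continuous_on:
  assumes "holder_space p \<alpha> U f" "0 < \<alpha>"
  shows "continuous_on (closure U) f"
proof (cases p)
  case 0
  with assms(1) obtain L where
    L: "\<And>x y. x \<in> closure U \<Longrightarrow> y \<in> closure U \<Longrightarrow> dist (f x) (f y) \<le> L * dist x y powr \<alpha>"
    by (auto simp: holder_continuous_on_def)
  show ?thesis
    unfolding continuous_on_def
  proof
    fix x assume x: "x \<in> closure U"
    have "((\<lambda>y. L * dist y x powr \<alpha>) \<longlongrightarrow> L * dist x x powr \<alpha>) (at x within closure U)"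
      using \<open>0 < \<alpha>\<close> by (intro tendsto_mult tendsto_const tendsto_powr' tendsto_dist tendsto_ident_at) auto
    then have "((\<lambda>y. L * dist y x powr \<alpha>) \<longlongrightarrow> 0) (at x within closure U)" by simp
    then have "((\<lambda>y. dist (f y) (f x)) \<longlongrightarrow> 0) (at x within closure U)"
      by (rule tendsto_sandwich[OF _ _ tendsto_const, rotated 2])
        (use L x in \<open>auto simp: eventually_at_filter intro!: always_eventually\<close>)
    then show "(f \<longlongrightarrow> f x) (at x within closure U)"
      by (subst tendsto_dist_iff)
  qed
qed (use assms in auto)

lemma has_partials_on_line:
  assumes "(f has_partials_on f') U" "x + t *\<^sub>R v \<in> U"
  shows "((\<lambda>t. f (x + t *\<^sub>R v)) has_derivative (\<lambda>s. s *\<^sub>R (\<Sum>i\<in>UNIV. v $ i *\<^sub>R f' i (x + t *\<^sub>R v)))) (at t)"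
proof -
  have "((\<lambda>t. x + t *\<^sub>R v) has_derivative (\<lambda>s. s *\<^sub>R v)) (at t)"
    by (auto intro!: derivative_eq_intros)
  from diff_chain_at[OF this has_partials_onD[OF assms]]
  show ?thesis by (simp add: o_def scaleR_sum_right)
qed

lemma has_partials_on_line_real:
  fixes f :: "real^'d::finite \<Rightarrow> real"
  assumes "(f has_partials_on f') U" "x + t *\<^sub>R v \<in> U"
  shows "((\<lambda>t. f (x + t *\<^sub>R v)) has_real_derivative (\<Sum>i\<in>UNIV. v $ i * f' i (x + t *\<^sub>R v))) (at t)"
  using has_partials_on_line[OF assms]
  by (simp add: has_field_derivative_def mult_commute_abs)

lemma has_partials_on_axis:
  fixes f :: "real^'d::finite \<Rightarrow> real"
  assumes "(f has_partials_on f') U" "x + t *\<^sub>R axis k 1 \<in> U"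
  shows "((\<lambda>t. f (x + t *\<^sub>R axis k 1)) has_real_derivative f' k (x + t *\<^sub>R axis k 1)) (at t)"
  using has_partials_on_line_real[OF assms]
  by (simp add: axis_def if_distrib[of "\<lambda>t. t * _"] cong: if_cong)

text \<open>The mean value theorem in direction \<open>i\<close>, applied to the increment in
  direction \<open>j\<close>, and then once more in direction \<open>j\<close>.\<close>

lemma second_difference_mvt:
  fixes f :: "real^'d::finite \<Rightarrow> real"
  assumes f: "(f has_partials_on f') (ball x r)"
    and f': "\<And>i. (f' i has_partials_on f'' i) (ball x r)"
    and s: "0 < s" "2 * s < r"
  shows "\<exists>p\<in>ball x r. dist p x < 2 * s \<and>
    f (x + s *\<^sub>R axis i 1 + s *\<^sub>R axis j 1) - f (x + s *\<^sub>R axis i 1) - f (x + s *\<^sub>R axis j 1) + f x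
      = s * s * f'' i j p"
proof -
  let ?p = "\<lambda>\<sigma> \<tau>. x + \<sigma> *\<^sub>R axis i (1::real) + \<tau> *\<^sub>R axis j 1"
  have near: "dist (?p \<sigma> \<tau>) x \<le> \<sigma> + \<tau>" if "0 \<le> \<sigma>" "0 \<le> \<tau>" for \<sigma> \<tau>
    using norm_triangle_ineq[of "\<sigma> *\<^sub>R axis i (1::real)" "\<tau> *\<^sub>R axis j 1"] that
    by (simp add: dist_norm add.assoc)
  have inball: "?p \<sigma> \<tau> \<in> ball x r" if "0 \<le> \<sigma>" "\<sigma> \<le> s" "0 \<le> \<tau>" "\<tau> \<le> s" for \<sigma> \<tau>
    using near[of \<sigma> \<tau>] that s by (simp add: dist_commute)
  define \<phi> where "\<phi> \<sigma> = f (?p \<sigma> s) - f (?p \<sigma> 0)" for \<sigma>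
  have d\<phi>: "(\<phi> has_real_derivative f' i (?p \<sigma> s) - f' i (?p \<sigma> 0)) (at \<sigma>)" if "0 \<le> \<sigma>" "\<sigma> \<le> s" for \<sigma>
  proof -
    have "((\<lambda>\<sigma>. f (?p \<sigma> \<tau>)) has_real_derivative f' i (?p \<sigma> \<tau>)) (at \<sigma>)" if "0 \<le> \<tau>" "\<tau> \<le> s" for \<tau>
      using has_partials_on_axis[OF f, of "x + \<tau> *\<^sub>R axis j 1" \<sigma> i]
        inball[of \<sigma> \<tau>] that \<open>0 \<le> \<sigma>\<close> \<open>\<sigma> \<le> s\<close>
      by (simp add: add_ac)
    from DERIV_diff[OF this[of s] this[of 0]] s show ?thesis by (simp add: \<phi>_def[abs_def])
  qed
  from MVT2[OF s(1) d\<phi>] obtain \<sigma> where \<sigma>: "0 < \<sigma>" "\<sigma> < s"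
      "\<phi> s - \<phi> 0 = s * (f' i (?p \<sigma> s) - f' i (?p \<sigma> 0))"
    by auto
  have "((\<lambda>\<tau>. f' i (?p \<sigma> \<tau>)) has_real_derivative f'' i j (?p \<sigma> \<tau>)) (at \<tau>)"
    if "0 \<le> \<tau>" "\<tau> \<le> s" for \<tau>
    using has_partials_on_axis[OF f'[of i], of "x + \<sigma> *\<^sub>R axis i 1" \<tau> j]
      inball[of \<sigma> \<tau>] that \<sigma> by simp
  from MVT2[OF s(1) this] obtain \<tau> where \<tau>: "0 < \<tau>" "\<tau> < s"
      "f' i (?p \<sigma> s) - f' i (?p \<sigma> 0) = s * f'' i j (?p \<sigma> \<tau>)"
    by auto
  show ?thesis
    using inball[of \<sigma> \<tau>] near[of \<sigma> \<tau>] \<sigma> \<tau>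
    by (intro bexI[of _ "?p \<sigma> \<tau>"]) (auto simp: \<phi>_def)
qed

text \<open>The second difference is symmetric in \<open>i\<close> and \<open>j\<close>, so both
  mixed derivatives take the same value at points arbitrarily close to \<open>x\<close>.\<close>

lemma mixed_partials_commute:
  fixes f :: "real^'d::finite \<Rightarrow> real"
  assumes f: "(f has_partials_on f') U" and f': "\<And>i. (f' i has_partials_on f'' i) U"
    and U: "open U" and cont: "\<And>i j. continuous_on U (f'' i j)" and x: "x \<in> U"
  shows "f'' i j x = f'' j i x"
proof -
  have "\<bar>f'' i j x - f'' j i x\<bar> \<le> e" if "0 < e" for e
  proof -
    obtain r where r: "0 < r" "ball x r \<subseteq> U"
      using U x open_contains_ball by blast
    have "\<exists>d>0. \<forall>p\<in>U. dist p x < d \<longrightarrow> dist (f'' i j p) (f'' i j x) < e / 2" for i j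
      using cont[of i j] x half_gt_zero[OF \<open>0 < e\<close>] unfolding continuous_on_iff by blast
    then obtain d d' where d: "0 < d" "\<And>p. p \<in> U \<Longrightarrow> dist p x < d \<Longrightarrow> dist (f'' i j p) (f'' i j x) < e / 2"
      and d': "0 < d'" "\<And>p. p \<in> U \<Longrightarrow> dist p x < d' \<Longrightarrow> dist (f'' j i p) (f'' j i x) < e / 2"
      by meson
    \<comment> \<open>The intermediate points lie within \<open>2 * s\<close> of \<open>x\<close>;
      dividing by 3 puts this strictly below all three radii.\<close>
    define s where "s = min r (min d d') / 3"
    have s: "0 < s" "2 * s < r" "2 * s < d" "2 * s < d'"
      using r(1) d(1) d'(1) by (auto simp: s_def)
    note sub = has_partials_on_subset[OF f r(2)] has_partials_on_subset[OF f' r(2)]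
    obtain p where p: "p \<in> U" "dist p x < 2 * s"
      "f (x + s *\<^sub>R axis i 1 + s *\<^sub>R axis j 1) - f (x + s *\<^sub>R axis i 1) - f (x + s *\<^sub>R axis j 1) + f x
        = s * s * f'' i j p"
      using second_difference_mvt[OF sub s(1,2), of i j] r(2) by blast
    obtain q where q: "q \<in> U" "dist q x < 2 * s"
      "f (x + s *\<^sub>R axis j 1 + s *\<^sub>R axis i 1) - f (x + s *\<^sub>R axis j 1) - f (x + s *\<^sub>R axis i 1) + f x
        = s * s * f'' j i q"
      using second_difference_mvt[OF sub s(1,2), of j i] r(2) by blast
    have "s * s * f'' i j p = s * s * f'' j i q"
      using p(3) q(3) by (simp add: algebra_simps)
    then have "f'' i j p = f'' j i q" using s(1) by simp
    moreover have "dist (f'' i j p) (f'' i j x) < e / 2" "dist (f'' j i q) (f'' j i x) < e / 2"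
      using d(2)[OF p(1)] d'(2)[OF q(1)] p(2) q(2) s by auto
    ultimately show ?thesis unfolding dist_real_def by linarith
  qed
  then have "\<bar>f'' i j x - f'' j i x\<bar> \<le> 0" by (rule field_le_epsilon) simp
  then show ?thesis by simp
qed

section \<open>Geometry of the boundary\<close>

text \<open>A finite subcover and the largest of its constants. Radii are passed through it as
  \<open>1 / K\<close>, which turns shrinking them into growth of \<open>K\<close>.\<close>

lemma compact_uniform_constant:
  fixes S :: "'a::metric_space set"
  assumes "compact S"
    and loc: "\<And>x. x \<in> S \<Longrightarrow> \<exists>r>0. \<exists>K\<ge>1. \<forall>y\<in>S \<inter> ball x r. Q K y"
    and mono: "\<And>K K' y. y \<in> S \<Longrightarrow> 1 \<le> K \<Longrightarrow> K \<le> K' \<Longrightarrow> Q K y \<Longrightarrow> Q K' y"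
  shows "\<exists>K\<ge>(1::real). \<forall>y\<in>S. Q K y"
proof -
  obtain r K where rK: "\<And>x. x \<in> S \<Longrightarrow> 0 < r x \<and> 1 \<le> K x \<and> (\<forall>y\<in>S \<inter> ball x (r x). Q (K x) y)"
    using loc by metis
  obtain T where T: "T \<subseteq> S" "finite T" "S \<subseteq> (\<Union>x\<in>T. ball x (r x))"
    using compactE_image[OF \<open>compact S\<close>, of S "\<lambda>x. ball x (r x)"] rK by force
  have le: "K x \<le> Max (insert 1 (K ` T))" if "x \<in> T" for x
    using that T(2) by simp
  have "Q (Max (insert 1 (K ` T))) y" if y: "y \<in> S" for y
  proof -
    obtain x where "x \<in> T" "y \<in> ball x (r x)" using y T(3) by blast
    then show ?thesis using y T(1) rK[of x] mono[OF y _ le] by blast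
  qed
  then show ?thesis
    using T(2) by (intro exI[of _ "Max (insert 1 (K ` T))"]) simp
qed

lemma has_real_derivative_line:
  fixes f :: "'a::real_inner \<Rightarrow> real"
  assumes "(f has_derivative (\<lambda>v. q \<bullet> v)) (at (x + t *\<^sub>R v))"
  shows "((\<lambda>t. f (x + t *\<^sub>R v)) has_real_derivative q \<bullet> v) (at t)"
proof -
  have "((\<lambda>t. x + t *\<^sub>R v) has_derivative (\<lambda>s. s *\<^sub>R v)) (at t)"
    by (auto intro!: derivative_eq_intros)
  from diff_chain_at[OF this assms] show ?thesis
    by (simp add: o_def has_field_derivative_def mult_commute_abs)
qed

lemma mvt_gradient:
  fixes f :: "'a::real_inner \<Rightarrow> real"
  assumes "\<And>w. w \<in> closed_segment x y \<Longrightarrow> (f has_derivative (\<lambda>v. q w \<bullet> v)) (at w)"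
  shows "\<exists>w\<in>closed_segment x y. f y - f x = q w \<bullet> (y - x)"
proof -
  have seg: "x + t *\<^sub>R (y - x) \<in> closed_segment x y" if "0 \<le> t" "t \<le> 1" for t
    using that by (auto simp: in_segment algebra_simps)
  have "((\<lambda>t. f (x + t *\<^sub>R (y - x))) has_real_derivative q (x + t *\<^sub>R (y - x)) \<bullet> (y - x)) (at t)"
    if "0 \<le> t" "t \<le> 1" for t
    by (rule has_real_derivative_line) (rule assms[OF seg[OF that]])
  from MVT2[of 0 1, OF _ this] obtain t where "0 < t" "t < 1"
    "f y - f x = q (x + t *\<^sub>R (y - x)) \<bullet> (y - x)"
    by auto
  with seg[of t] show ?thesis by auto
qed

lemma norm_sum_scaleR_component_le:
  fixes a :: "'d::finite \<Rightarrow> 'b::real_normed_vector"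
  assumes "\<And>i. norm (a i) \<le> B"
  shows "norm (\<Sum>i\<in>UNIV. v $ i *\<^sub>R a i) \<le> real CARD('d) * B * norm (v :: real^'d)"
proof -
  have "norm (\<Sum>i\<in>UNIV. v $ i *\<^sub>R a i) \<le> (\<Sum>i\<in>(UNIV::'d set). norm v * B)"
    by (rule sum_norm_le) (simp add: mult_mono component_le_norm_cart assms)
  then show ?thesis by (simp add: mult_ac)
qed

text \<open>The curves \<open>t \<mapsto> \<Phi> (\<Psi> P + s sin (t / s) e\<^sub>j)\<close> with \<open>j \<noteq> i\<close> stay on the boundary, so a vector
  orthogonal to all velocities of boundary curves annihilates the kernel of \<open>D\<Psi>\<^sub>i\<close>.\<close>

lemma chart_normal_parallel:
  fixes G :: "(real^'d::finite) set"
  assumes chart: "boundary_chart (Suc p) \<alpha> G z r i \<Psi> \<Phi>"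
    and P: "P \<in> ball z r" "P \<in> frontier G"
    and q: "((\<lambda>x. \<Psi> x $ i) has_derivative (\<lambda>v. q \<bullet> v)) (at P)"
    and orth: "\<And>w v. w 0 = P \<Longrightarrow> (\<forall>t::real. w t \<in> frontier G) \<Longrightarrow>
        (w has_vector_derivative v) (at 0) \<Longrightarrow> n \<bullet> v = 0"
  shows "\<exists>\<kappa>. n = \<kappa> *\<^sub>R q"
proof -
  have open_img: "open (\<Psi> ` ball z r)" and inv: "\<And>x. x \<in> ball z r \<Longrightarrow> \<Phi> (\<Psi> x) = x"
    and hol: "\<forall>x\<in>ball z r. \<Psi> differentiable (at x)" "\<forall>y\<in>\<Psi> ` ball z r. \<Phi> differentiable (at y)"
    and fr: "\<And>x. x \<in> ball z r \<Longrightarrow> x \<in> frontier G \<longleftrightarrow> \<Psi> x $ i = 0"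
    using chart by (auto simp: boundary_chart_def)
  obtain D E where D: "(\<Psi> has_derivative D) (at P)" and E: "(\<Phi> has_derivative E) (at (\<Psi> P))"
    using hol P by (meson differentiable_def imageI)
  interpret E: bounded_linear E using E by (rule has_derivative_bounded_linear)
  have ED: "E (D v) = v" for v
  proof -
    have "((\<Phi> \<circ> \<Psi>) has_derivative (E \<circ> D)) (at P)"
      using diff_chain_at[OF D E] .
    then have "((\<lambda>x. x) has_derivative (E \<circ> D)) (at P)"
      by (rule has_derivative_transform_within_open[of _ _ _ _ "ball z r"]) (use P inv in auto)
    then have "E \<circ> D = (\<lambda>x. x)"
      using has_derivative_unique has_derivative_ident by blast
    then show ?thesis by (metis o_apply)
  qed
  have "((\<lambda>x. \<Psi> x $ i) has_derivative (\<lambda>v. D v $ i)) (at P)"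
    using bounded_linear.has_derivative[OF bounded_linear_vec_nth D] .
  then have Di: "D v $ i = q \<bullet> v" for v
    using has_derivative_unique[OF q] by metis
  obtain s where s: "0 < s" "cball (\<Psi> P) s \<subseteq> \<Psi> ` ball z r"
    using open_img P(1) open_contains_cball by blast
  \<comment> \<open>The hypothesis \<open>orth\<close> concerns curves defined on the whole real
    line. The sine confines the curve to the chart for all times, and \<open>s * sin (t / s)\<close>
    still has unit speed at \<open>0\<close>.\<close>
  have tang: "n \<bullet> E (axis j 1) = 0" if "j \<noteq> i" for j
  proof (rule orth[of "\<lambda>t. \<Phi> (\<Psi> P + (s * sin (t / s)) *\<^sub>R axis j 1)"])
    show "\<Phi> (\<Psi> P + (s * sin (0 / s)) *\<^sub>R axis j 1) = P"
      using inv P(1) by simp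
    show "\<forall>t. \<Phi> (\<Psi> P + (s * sin (t / s)) *\<^sub>R axis j 1) \<in> frontier G"
    proof
      fix t
      let ?y = "\<Psi> P + (s * sin (t / s)) *\<^sub>R axis j 1"
      have "dist (\<Psi> P) ?y = s * \<bar>sin (t / s)\<bar>"
        using s(1) by (simp add: dist_norm abs_mult)
      also have "\<dots> \<le> s * 1" using s(1) by (intro mult_left_mono) auto
      finally have "?y \<in> \<Psi> ` ball z r" using s(2) by auto
      then obtain x where x: "x \<in> ball z r" "?y = \<Psi> x" by blast
      moreover have "?y $ i = 0"
        using that P fr by (simp add: axis_def)
      ultimately show "\<Phi> ?y \<in> frontier G" using fr inv by simp
    qed
    have "((\<lambda>t. \<Psi> P + (s * sin (t / s)) *\<^sub>R axis j 1) has_derivative (\<lambda>t. t *\<^sub>R axis j 1)) (at 0)"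
      using s(1) by (auto intro!: derivative_eq_intros)
    from diff_chain_at[OF this, of \<Phi> E] E
    show "((\<lambda>t. \<Phi> (\<Psi> P + (s * sin (t / s)) *\<^sub>R axis j 1)) has_vector_derivative E (axis j 1)) (at 0)"
      by (simp add: o_def has_vector_derivative_def E.scale)
  qed
  \<comment> \<open>Since \<open>E\<close> inverts \<open>D\<close>, expanding \<open>D v\<close> in
    the standard basis leaves only the coordinate \<open>i\<close>, which is
    \<open>q \<bullet> v\<close>.\<close>
  have "n \<bullet> v = (n \<bullet> E (axis i 1)) * (q \<bullet> v)" for v
  proof -
    have "n \<bullet> v = n \<bullet> E (\<Sum>j\<in>UNIV. D v $ j *\<^sub>R axis j 1)"
      using ED[of v] basis_expansion[of "D v"] by (simp add: scalar_mult_eq_scaleR)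
    also have "\<dots> = (\<Sum>j\<in>UNIV. D v $ j * (n \<bullet> E (axis j 1)))"
      by (simp add: E.sum E.scale inner_sum_right)
    also have "\<dots> = (\<Sum>j\<in>UNIV. if j = i then D v $ i * (n \<bullet> E (axis i 1)) else 0)"
      by (rule sum.cong) (auto simp: tang)
    finally show ?thesis by (simp add: Di)
  qed
  then have "n = (n \<bullet> E (axis i 1)) *\<^sub>R q"
    by (metis inner_scaleR_left vector_eq_rdot)
  then show ?thesis ..
qed

text \<open>Being parallel leaves the sign open. It is fixed because the ray from \<open>P\<close>
  along \<open>n\<close> starts inside \<open>G\<close>, where the chart coordinate is positive, so
  the derivative along \<open>n\<close> cannot be negative.\<close>

lemma chart_gradient_normal:
  fixes G :: "(real^'d::finite) set"
  assumes chart: "boundary_chart (Suc p) \<alpha> G z r i \<Psi> \<Phi>"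
    and P: "P \<in> ball z r" "P \<in> frontier G"
    and q: "((\<lambda>x. \<Psi> x $ i) has_derivative (\<lambda>v. q \<bullet> v)) (at P)"
    and n: "inward_unit_normal G P n"
  shows "q \<noteq> 0" "q = norm q *\<^sub>R n"
proof -
  have n1: "norm n = 1" and inG: "\<forall>\<^sub>F t in at_right 0. P + t *\<^sub>R n \<in> G"
    using n by (auto simp: inward_unit_normal_def)
  obtain \<kappa> where \<kappa>: "n = \<kappa> *\<^sub>R q"
    using chart_normal_parallel[OF chart P q] n unfolding inward_unit_normal_def by metis
  show "q \<noteq> 0" using \<kappa> n1 by auto
  have "0 \<le> q \<bullet> n"
  proof (rule ccontr)
    assume neg: "\<not> 0 \<le> q \<bullet> n"
    have "((\<lambda>t. \<Psi> (P + t *\<^sub>R n) $ i) has_real_derivative q \<bullet> n) (at 0)"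
      using q by (intro has_real_derivative_line) simp
    from has_real_derivative_neg_dec_right[OF this] neg obtain d where
      d: "0 < d" "\<And>h. 0 < h \<Longrightarrow> h < d \<Longrightarrow> \<Psi> (P + h *\<^sub>R n) $ i < \<Psi> P $ i"
      by auto
    have 0: "\<Psi> P $ i = 0" and pos: "\<And>x. x \<in> ball z r \<Longrightarrow> x \<in> G \<Longrightarrow> \<Psi> x $ i > 0"
      using chart P by (auto simp: boundary_chart_def)
    have "((\<lambda>t. P + t *\<^sub>R n) \<longlongrightarrow> P + 0 *\<^sub>R n) (at_right 0)"
      by (intro tendsto_intros)
    then have "\<forall>\<^sub>F t in at_right 0. P + t *\<^sub>R n \<in> ball z r"
      using P(1) by (intro topological_tendstoD) auto
    with inG eventually_at_right_less[of 0] eventually_at_right_real[OF d(1)]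
    have "\<forall>\<^sub>F t in at_right (0::real). False"
      by eventually_elim (use d(2) pos 0 in force)
    then show False by simp
  qed
  then have "0 \<le> \<kappa> * (q \<bullet> q)" using \<kappa> by simp
  moreover have "0 < q \<bullet> q" using \<open>q \<noteq> 0\<close> by simp
  ultimately have "0 \<le> \<kappa>" by (simp add: zero_le_mult_iff)
  then have "\<kappa> * norm q = 1" using \<kappa> n1 by simp
  then show "q = norm q *\<^sub>R n" by (simp add: \<kappa> mult.commute)
qed

text \<open>What is retained of a chart: \<open>f\<close> is the coordinate that vanishes on the
  frontier, \<open>q\<close> its gradient. A Lipschitz gradient is all the regularity that the
  interior balls and the connecting paths use.\<close>

locale defining_function =
  fixes G :: "(real^'d::finite) set" and z :: "real^'d" and r L :: real
    and f :: "real^'d \<Rightarrow> real" and q :: "real^'d \<Rightarrow> real^'d"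
  assumes r: "0 < r" and L: "0 < L" and z: "z \<in> frontier G"
    and der: "\<And>x. x \<in> ball z r \<Longrightarrow> (f has_derivative (\<lambda>v. q x \<bullet> v)) (at x)"
    and lip: "\<And>x y. x \<in> ball z r \<Longrightarrow> y \<in> ball z r \<Longrightarrow> norm (q x - q y) \<le> L * dist x y"
    and G: "\<And>x. x \<in> ball z r \<Longrightarrow> x \<in> G \<longleftrightarrow> f x > 0"
    and frontier: "\<And>x. x \<in> ball z r \<Longrightarrow> x \<in> frontier G \<longleftrightarrow> f x = 0"
    and nonzero: "\<And>P n. P \<in> ball z r \<Longrightarrow> P \<in> frontier G \<Longrightarrow> inward_unit_normal G P n \<Longrightarrow> q P \<noteq> 0"
    and normal: "\<And>P n. P \<in> ball z r \<Longrightarrow> P \<in> frontier G \<Longrightarrow> inward_unit_normal G P n \<Longrightarrow>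
       q P = norm (q P) *\<^sub>R n"
begin

lemma mvt:
  assumes "x \<in> ball z r" "y \<in> ball z r"
  obtains w where "w \<in> ball z r" "dist w x \<le> dist x y" "f y - f x = q w \<bullet> (y - x)"
proof -
  have seg: "closed_segment x y \<subseteq> ball z r"
    using assms convex_ball by (rule closed_segment_subset)
  then obtain w where "w \<in> closed_segment x y" "f y - f x = q w \<bullet> (y - x)"
    using mvt_gradient[of x y f q] der by blast
  with seg that show thesis using dist_in_closed_segment by blast
qed

lemma first_order:
  assumes "x \<in> ball z r" "y \<in> ball z r"
  shows "\<bar>f y - f x - q x \<bullet> (y - x)\<bar> \<le> L * (dist x y)\<^sup>2"
proof -
  obtain w where w: "w \<in> ball z r" "dist w x \<le> dist x y" "f y - f x = q w \<bullet> (y - x)"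
    using mvt[OF assms] .
  have "\<bar>(q w - q x) \<bullet> (y - x)\<bar> \<le> norm (q w - q x) * dist x y"
    using Cauchy_Schwarz_ineq2[of "q w - q x" "y - x"] by (simp add: dist_norm norm_minus_commute[of x y])
  also have "\<dots> \<le> (L * dist w x) * dist x y"
    using lip[OF w(1) assms(1)] by (simp add: mult_right_mono)
  also have "\<dots> \<le> (L * dist x y) * dist x y"
    using w(2) L by (simp add: mult_right_mono)
  finally show ?thesis
    using w(3) by (simp add: inner_diff_left power2_eq_square)
qed

lemma gradient_close:
  assumes "x \<in> ball z (min r (norm (q z) / (2 * L)))"
  shows "norm (q x - q z) \<le> norm (q z) / 2"
proof -
  have "L * dist x z \<le> norm (q z) / 2"
    using assms L by (simp add: field_simps dist_commute)
  with lip[of x z] assms r show ?thesis by auto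
qed

end

text \<open>The second derivatives of the chart extend continuously to the closed ball, hence are
  bounded, and the mean value inequality makes the gradient Lipschitz.\<close>

lemma boundary_defining_function:
  fixes G :: "(real^'d::finite) set"
  assumes "holder_boundary (Suc (Suc p)) \<alpha> G" "0 < \<alpha>" "z \<in> frontier G"
  shows "\<exists>r L f q. defining_function G z r L f q"
proof -
  obtain r i \<Psi> \<Phi> where chart: "boundary_chart (Suc (Suc p)) \<alpha> G z r i \<Psi> \<Phi>"
    using assms by (auto simp: holder_boundary_def)
  then have r: "0 < r" and "holder_space (Suc (Suc p)) \<alpha> (ball z r) \<Psi>"
    and G: "\<And>x. x \<in> ball z r \<Longrightarrow> x \<in> G \<longleftrightarrow> \<Psi> x $ i > 0"
    and fr: "\<And>x. x \<in> ball z r \<Longrightarrow> x \<in> frontier G \<longleftrightarrow> \<Psi> x $ i = 0"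
    unfolding boundary_chart_def by blast+
  then obtain \<Psi>' where \<Psi>': "\<And>j. holder_space (Suc p) \<alpha> (ball z r) (\<Psi>' j)"
      "(\<Psi> has_partials_on \<Psi>') (ball z r)"
    using holder_space_partials by blast
  have "\<exists>\<Psi>''. (\<forall>k. holder_space p \<alpha> (ball z r) (\<Psi>'' k)) \<and> (\<Psi>' j has_partials_on \<Psi>'') (ball z r)" for j
    using holder_space_partials[OF \<Psi>'(1)[of j]] by metis
  then obtain \<Psi>'' where \<Psi>'': "\<And>j k. holder_space p \<alpha> (ball z r) (\<Psi>'' j k)"
      "\<And>j. (\<Psi>' j has_partials_on \<Psi>'' j) (ball z r)"
    by metis
  have "\<exists>B. \<forall>x\<in>ball z r. norm (\<Psi>'' j k x) \<le> B" for j k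
  proof -
    have "compact (\<Psi>'' j k ` closure (ball z r))"
      using holder_space_continuous_on[OF \<Psi>''(1) assms(2)]
      by (intro compact_continuous_image) auto
    then obtain B where "\<And>x. x \<in> closure (ball z r) \<Longrightarrow> norm (\<Psi>'' j k x) \<le> B"
      by (meson bounded_iff compact_imp_bounded imageI)
    then show ?thesis using closure_subset by blast
  qed
  then obtain B where B: "\<And>j k x. x \<in> ball z r \<Longrightarrow> norm (\<Psi>'' j k x) \<le> B j k"
    by metis
  define B' where "B' = (\<Sum>j\<in>UNIV. \<Sum>k\<in>UNIV. \<bar>B j k\<bar>)"
  have B'0: "0 \<le> B'" by (simp add: B'_def sum_nonneg)
  have B'le: "norm (\<Psi>'' j k x) \<le> B'" if "x \<in> ball z r" for j k x
  proof -
    have "\<bar>B j k\<bar> \<le> (\<Sum>k\<in>UNIV. \<bar>B j k\<bar>)" by (rule member_le_sum) auto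
    also have "\<dots> \<le> B'"
      unfolding B'_def by (rule member_le_sum[of j UNIV "\<lambda>j. \<Sum>k\<in>UNIV. \<bar>B j k\<bar>"]) (auto intro: sum_nonneg)
    finally show ?thesis using B[OF that, of j k] by linarith
  qed
  let ?D = "real CARD('d)"
  have lip: "norm (\<Psi>' j x - \<Psi>' j y) \<le> ?D * B' * norm (x - y)" if "x \<in> ball z r" "y \<in> ball z r" for j x y
  proof (rule differentiable_bound[of "ball z r"])
    fix w assume w: "w \<in> ball z r"
    show "(\<Psi>' j has_derivative (\<lambda>v. \<Sum>k\<in>UNIV. v $ k *\<^sub>R \<Psi>'' j k w)) (at w within ball z r)"
      using has_partials_onD[OF \<Psi>''(2) w] by (rule has_derivative_at_withinI)
    show "onorm (\<lambda>v. \<Sum>k\<in>UNIV. v $ k *\<^sub>R \<Psi>'' j k w) \<le> ?D * B'"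
      using norm_sum_scaleR_component_le[OF B'le[OF w]] B'0 by (intro onorm_bound) auto
  qed (use that in auto)
  define q where "q x = (\<chi> j. \<Psi>' j x $ i)" for x
  have der: "((\<lambda>x. \<Psi> x $ i) has_derivative (\<lambda>v. q x \<bullet> v)) (at x)" if "x \<in> ball z r" for x
    using bounded_linear.has_derivative[OF bounded_linear_vec_nth has_partials_onD[OF \<Psi>'(2) that], of i]
    by (simp add: q_def inner_vec_def mult.commute)
  \<comment> \<open>The summand \<open>1\<close> only makes the constant positive, as the locale
    demands.\<close>
  have qlip: "norm (q x - q y) \<le> (?D * (?D * B') + 1) * dist x y" if "x \<in> ball z r" "y \<in> ball z r" for x y
  proof -
    have "norm (q x - q y) \<le> (\<Sum>j\<in>UNIV. \<bar>(q x - q y) $ j\<bar>)"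
      by (rule norm_le_l1_cart)
    also have "\<dots> \<le> (\<Sum>j\<in>(UNIV::'d set). ?D * B' * dist x y)"
    proof (rule sum_mono)
      fix j
      have "\<bar>(q x - q y) $ j\<bar> = \<bar>(\<Psi>' j x - \<Psi>' j y) $ i\<bar>" by (simp add: q_def)
      also have "\<dots> \<le> norm (\<Psi>' j x - \<Psi>' j y)" by (rule component_le_norm_cart)
      also have "\<dots> \<le> ?D * B' * dist x y" using lip[OF that] by (simp add: dist_norm)
      finally show "\<bar>(q x - q y) $ j\<bar> \<le> ?D * B' * dist x y" .
    qed
    also have "\<dots> \<le> (?D * (?D * B') + 1) * dist x y" by (simp add: algebra_simps)
    finally show ?thesis .
  qed
  have pos: "0 < ?D * (?D * B') + 1" using B'0 by (simp add: add_nonneg_pos)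
  have normal: "q P \<noteq> 0" "q P = norm (q P) *\<^sub>R n"
    if "P \<in> ball z r" "P \<in> frontier G" "inward_unit_normal G P n" for P n
    using chart_gradient_normal[OF chart that(1,2) der[OF that(1)] that(3)] by auto
  have "defining_function G z r (?D * (?D * B') + 1) (\<lambda>x. \<Psi> x $ i) q"
    by (rule defining_function.intro) (fact r pos assms(3) der qlip G fr normal(1) normal(2))+
  then show ?thesis by blast
qed

text \<open>A point \<open>P + w\<close> of the ball satisfies
  \<open>(norm w)\<^sup>2 < 2 * \<delta> * (\<nu> P \<bullet> w)\<close>. The quadratic error of
  \<open>f\<close> at \<open>P\<close> is therefore dominated by its linear part as soon as
  \<open>\<delta>\<close> is small against \<open>norm (q P) / L\<close>.\<close>

lemma uniform_interior_ball:
  fixes G :: "(real^'d::finite) set"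
  assumes bd: "holder_boundary (Suc (Suc p)) \<alpha> G" "0 < \<alpha>" and "bounded G"
    and \<nu>: "\<forall>z\<in>frontier G. inward_unit_normal G z (\<nu> z)"
  shows "\<exists>\<delta>>0. \<forall>P\<in>frontier G. ball (P + \<delta> *\<^sub>R \<nu> P) \<delta> \<subseteq> G"
proof -
  \<comment> \<open>Balls tangent at the same \<open>P\<close> are nested, so the inclusion persists
    when \<open>K\<close> grows.\<close>
  have "\<exists>K\<ge>(1::real). \<forall>P\<in>frontier G. ball (P + (1 / K) *\<^sub>R \<nu> P) (1 / K) \<subseteq> G"
  proof (rule compact_uniform_constant)
    show "compact (frontier G)" using \<open>bounded G\<close> by (rule compact_frontier_bounded)
  next
    fix K K' :: real and P
    assume P: "P \<in> frontier G" and K: "1 \<le> K" "K \<le> K'"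
      and sub: "ball (P + (1 / K) *\<^sub>R \<nu> P) (1 / K) \<subseteq> G"
    have "dist (P + (1 / K) *\<^sub>R \<nu> P) (P + (1 / K') *\<^sub>R \<nu> P) = \<bar>1 / K - 1 / K'\<bar> * norm (\<nu> P)"
      by (simp add: dist_norm flip: scaleR_diff_left)
    also have "\<dots> = 1 / K - 1 / K'"
      using P \<nu> K by (simp add: inward_unit_normal_def frac_le)
    finally have "ball (P + (1 / K') *\<^sub>R \<nu> P) (1 / K') \<subseteq> ball (P + (1 / K) *\<^sub>R \<nu> P) (1 / K)"
      by (subst ball_subset_ball_iff) (simp add: dist_commute)
    with sub show "ball (P + (1 / K') *\<^sub>R \<nu> P) (1 / K') \<subseteq> G" by blast
  next
    fix z assume z: "z \<in> frontier G"
    from boundary_defining_function[OF bd z] obtain r L f q where "defining_function G z r L f q"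
      by blast
    then interpret defining_function G z r L f q .
    define m where "m = norm (q z)"
    have m: "0 < m" using nonzero[of z] z r \<nu> by (auto simp: m_def)
    \<comment> \<open>With \<open>P\<close> within \<open>r / 2\<close> of \<open>z\<close>, the
      bound \<open>r / 4\<close> keeps the ball inside the chart. The bound
      \<open>m / (4 * L)\<close> gives \<open>2 * L * \<delta> \<le> m / 2\<close>, and
      \<open>m / 2\<close> is a lower bound for \<open>norm (q P)\<close>.\<close>
    define \<delta> where "\<delta> = min (min 1 (r / 4)) (m / (4 * L))"
    have \<delta>: "0 < \<delta>" "\<delta> \<le> 1" "4 * \<delta> \<le> r" "\<delta> * (4 * L) \<le> m"
    proof -
      have "\<delta> \<le> r / 4" "\<delta> \<le> m / (4 * L)" by (auto simp: \<delta>_def)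
      then show "4 * \<delta> \<le> r" "\<delta> * (4 * L) \<le> m" using L by (auto simp: pos_le_divide_eq)
    qed (use r L m in \<open>auto simp: \<delta>_def\<close>)
    have "ball (P + \<delta> *\<^sub>R \<nu> P) \<delta> \<subseteq> G" if P: "P \<in> frontier G" "P \<in> ball z (min (r / 2) (m / (2 * L)))" for P
    proof
      fix y assume y: "y \<in> ball (P + \<delta> *\<^sub>R \<nu> P) \<delta>"
      define w where "w = y - P"
      have n1: "norm (\<nu> P) = 1" using \<nu> P by (auto simp: inward_unit_normal_def)
      have lt: "norm (w - \<delta> *\<^sub>R \<nu> P) < \<delta>"
        using y by (simp add: w_def dist_norm norm_minus_commute[of _ y] diff_diff_eq)
      then have "(norm (w - \<delta> *\<^sub>R \<nu> P))\<^sup>2 < \<delta>\<^sup>2"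
        by (simp add: power_strict_mono)
      then have w: "(norm w)\<^sup>2 < 2 * \<delta> * (\<nu> P \<bullet> w)"
        using n1 unfolding power2_norm_eq_inner
        by (simp add: inner_diff_left inner_diff_right inner_commute norm_eq_1 power2_eq_square algebra_simps)
      then have \<nu>w: "0 < \<nu> P \<bullet> w"
        using \<delta>(1) by (smt (verit) mult_nonneg_nonpos zero_le_power2)
      have "norm w < 2 * \<delta>"
        using norm_triangle_ineq[of "w - \<delta> *\<^sub>R \<nu> P" "\<delta> *\<^sub>R \<nu> P"] lt n1 \<delta>(1) by simp
      then have "dist P y < 2 * \<delta>" by (simp add: w_def dist_norm norm_minus_commute)
      moreover have Pz: "dist z P < r / 2" "dist z P * (2 * L) < m"
        using P(2) L by (auto simp: field_simps)
      ultimately have yz: "y \<in> ball z r" and Pb: "P \<in> ball z r"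
        using \<delta>(3) r dist_triangle[of z y P] by auto
      have "norm (q P - q z) \<le> m / 2"
        using gradient_close[of P] Pz Pb L by (simp add: m_def field_simps)
      then have qP: "m / 2 \<le> norm (q P)"
        using norm_triangle_sub[of "q z" "q P"] by (simp add: m_def norm_minus_commute)
      have "f y \<ge> f P + q P \<bullet> w - L * (norm w)\<^sup>2"
        using first_order[OF Pb yz] by (simp add: w_def dist_norm norm_minus_commute abs_le_iff)
      moreover have "f P = 0" using frontier Pb P by simp
      moreover have "q P \<bullet> w = norm (q P) * (\<nu> P \<bullet> w)"
        using normal[OF Pb P(1)] \<nu> P(1) by (metis inner_scaleR_left)
      moreover have "m / 2 * (\<nu> P \<bullet> w) \<le> norm (q P) * (\<nu> P \<bullet> w)"
        using qP \<nu>w by (intro mult_right_mono) auto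
      moreover have "L * (norm w)\<^sup>2 < L * (2 * \<delta> * (\<nu> P \<bullet> w))"
        using w L by (intro mult_strict_left_mono) auto
      moreover have "L * (2 * \<delta> * (\<nu> P \<bullet> w)) \<le> m / 2 * (\<nu> P \<bullet> w)"
        using mult_right_mono[OF \<delta>(4), of "(\<nu> P \<bullet> w) / 2"] \<nu>w by (simp add: algebra_simps)
      ultimately have "f y > 0" by linarith
      then show "y \<in> G" using G yz by simp
    qed
    then show "\<exists>r>0. \<exists>K\<ge>1. \<forall>y\<in>frontier G \<inter> ball z r. ball (y + (1 / K) *\<^sub>R \<nu> y) (1 / K) \<subseteq> G"
      using r m L \<delta>(1,2)
      by (intro exI[of _ "min (r / 2) (m / (2 * L))"] conjI exI[of _ "1 / \<delta>"] ballI) auto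
  qed
  then obtain K :: real where "1 \<le> K" "\<forall>P\<in>frontier G. ball (P + (1 / K) *\<^sub>R \<nu> P) (1 / K) \<subseteq> G"
    by blast
  then show ?thesis by (intro exI[of _ "1 / K"]) auto
qed

text \<open>The segment between two frontier points may leave \<open>G\<close>, however close they
  are. Three pieces suffice: away from the boundary, across, and back. The segments are open so that
  \<open>x\<close> and \<open>y\<close> may lie on the frontier.\<close>

definition linked :: "real \<Rightarrow> 'a::real_normed_vector set \<Rightarrow> 'a \<Rightarrow> 'a \<Rightarrow> bool" where
  "linked K G x y \<longleftrightarrow> (\<exists>A\<in>closure G. \<exists>B\<in>closure G.
     open_segment x A \<subseteq> G \<and> open_segment A B \<subseteq> G \<and> open_segment B y \<subseteq> G \<and>
     dist x A \<le> K * dist x y \<and> dist A B \<le> K * dist x y \<and> dist B y \<le> K * dist x y)"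

lemma linkedI:
  assumes "x \<in> closure G" "y \<in> closure G" "open_segment x y \<subseteq> G" "1 \<le> K"
  shows "linked K G x y"
  using assms mult_right_mono[OF assms(4), of "dist x y"]
  unfolding linked_def by (intro bexI[of _ x] bexI[of _ y]) (auto simp: open_segment_idem)

lemma linked_mono: "linked K G x y \<Longrightarrow> K \<le> K' \<Longrightarrow> linked K' G x y"
  unfolding linked_def by (meson mult_right_mono order_trans zero_le_dist)

context defining_function
begin

lemma mem_closure: "x \<in> ball z r \<Longrightarrow> x \<in> closure G \<Longrightarrow> 0 \<le> f x"
  using G[of x] frontier[of x] closure_Un_frontier[of G] by auto

text \<open>Near \<open>z\<close> two points of the closure are joined by moving both of them a short way in the
  direction \<open>n\<close> of the gradient at \<open>z\<close>, where the segment between them is far from the boundary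
  compared with its length.\<close>

lemma linked_near:
  assumes qz: "q z \<noteq> 0"
  shows "\<exists>\<rho>>0. \<forall>x\<in>closure G \<inter> ball z \<rho>. \<forall>y\<in>closure G. dist x y < \<rho> \<longrightarrow> linked 5 G x y"
proof -
  define m where "m = norm (q z)"
  define n where "n = (1 / m) *\<^sub>R q z"
  have m: "0 < m" and n: "norm n = 1" and qzn: "q z \<bullet> n = m"
    using qz by (auto simp: m_def n_def dot_square_norm power2_eq_square)
  define s where "s = min r (m / (2 * L))"
  have s: "0 < s" "ball z s \<subseteq> ball z r" using r L m by (auto simp: s_def)
  have close: "norm (q x - q z) \<le> m / 2" if "x \<in> ball z s" for x
    using gradient_close that by (simp add: s_def m_def)
  have up: "m / 2 \<le> q x \<bullet> n" and bound: "norm (q x) \<le> 2 * m" if "x \<in> ball z s" for x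
  proof -
    have "\<bar>(q x - q z) \<bullet> n\<bar> \<le> m / 2"
      using Cauchy_Schwarz_ineq2[of "q x - q z" n] close[OF that] n by simp
    then show "m / 2 \<le> q x \<bullet> n" unfolding inner_diff_left qzn by linarith
    show "norm (q x) \<le> 2 * m"
      using norm_triangle_sub[of "q x" "q z"] close[OF that] m unfolding m_def by linarith
  qed
  have grow: "f x + t * (m / 2) \<le> f (x + t *\<^sub>R n)"
    if "x \<in> ball z s" "x + t *\<^sub>R n \<in> ball z s" "0 \<le> t" for x t
  proof -
    have "closed_segment x (x + t *\<^sub>R n) \<subseteq> ball z s"
      using that convex_ball closed_segment_subset by blast
    moreover from this s(2) obtain w where "w \<in> closed_segment x (x + t *\<^sub>R n)"
        "f (x + t *\<^sub>R n) - f x = q w \<bullet> (t *\<^sub>R n)"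
      using mvt_gradient[of x "x + t *\<^sub>R n" f q] der
      by (metis add_diff_cancel_left' subsetD)
    ultimately show ?thesis
      using up[of w] mult_left_mono[of "m / 2" "q w \<bullet> n" t] that(3) by (auto simp: algebra_simps)
  qed
  have decay: "f x - 2 * m * dist x y \<le> f y" if "x \<in> ball z s" "y \<in> ball z s" for x y
  proof -
    have "closed_segment x y \<subseteq> ball z s"
      using that convex_ball closed_segment_subset by blast
    moreover from this s(2) obtain w where "w \<in> closed_segment x y" "f y - f x = q w \<bullet> (y - x)"
      using mvt_gradient[of x y f q] der by blast
    ultimately have "\<bar>f y - f x\<bar> \<le> 2 * m * dist x y"
      using Cauchy_Schwarz_ineq2[of "q w" "y - x"] bound[of w]
        mult_right_mono[of "norm (q w)" "2 * m" "dist x y"]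
      by (auto simp: dist_norm norm_minus_commute[of x y])
    then show ?thesis by (simp add: abs_le_iff)
  qed
  have "linked 5 G x y"
    if x: "x \<in> closure G" "x \<in> ball z (s / 12)" and y: "y \<in> closure G" "dist x y < s / 12" for x y
  proof (cases "x = y")
    case True
    then show ?thesis using x by (intro linkedI) (auto simp: open_segment_idem)
  next
    case False
    define d where "d = dist x y"
    have d: "0 < d" "d < s / 12" using False y by (auto simp: d_def)
    \<comment> \<open>The three distances from \<open>z\<close> to \<open>x\<close>,
      \<open>w\<close> and the lifted point add up to less than
      \<open>s / 12 + s / 12 + 5 * s / 12\<close>, which is why the radius is divided by 12.\<close>
    have shifted: "w + t *\<^sub>R n \<in> ball z s" if "dist x w \<le> d" "0 \<le> t" "t \<le> 5 * d" for w t
    proof -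
      have "dist w (w + t *\<^sub>R n) = t" using that n by (simp add: dist_norm)
      then show ?thesis
        using dist_triangle[of z "w + t *\<^sub>R n" w] dist_triangle[of z w x] that x(2) d s by simp
    qed
    have mem: "w + t *\<^sub>R n \<in> G" if "w = x \<or> w = y" "0 < t" "t \<le> 5 * d" for w t
    proof -
      have "dist x w \<le> d" using that d by (auto simp: d_def)
      then have b: "w \<in> ball z s" "w + t *\<^sub>R n \<in> ball z s"
        using shifted[of w 0] shifted[of w t] that d by auto
      have "0 \<le> f w" using mem_closure[OF subsetD[OF s(2) b(1)]] x y that(1) by blast
      moreover have "0 < t * (m / 2)" using that m by simp
      ultimately have "0 < f (w + t *\<^sub>R n)" using grow[OF b] that by linarith
      then show ?thesis using G b s by blast
    qed
    have ray: "open_segment w (w + (5 * d) *\<^sub>R n) \<subseteq> G" if "w = x \<or> w = y" for w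
    proof
      fix v assume "v \<in> open_segment w (w + (5 * d) *\<^sub>R n)"
      then obtain \<theta> where "0 < \<theta>" "\<theta> < 1" "v = (1 - \<theta>) *\<^sub>R w + \<theta> *\<^sub>R (w + (5 * d) *\<^sub>R n)"
        by (auto simp: in_segment)
      moreover from this have "v = w + (\<theta> * (5 * d)) *\<^sub>R n"
        by (simp add: algebra_simps)
      ultimately show "v \<in> G"
        using mem[OF that, of "\<theta> * (5 * d)"] d mult_right_mono[of \<theta> 1 "5 * d"] by auto
    qed
    \<comment> \<open>Lifting by \<open>5 * d\<close> raises \<open>f\<close> by at least
      \<open>5 * d * (m / 2)\<close>, and a sideways move of length at most \<open>d\<close> lowers
      it by at most \<open>2 * m * d\<close>. The factor 5 is an integer large enough to leave a
      positive value.\<close>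
    have top: "open_segment (x + (5 * d) *\<^sub>R n) (y + (5 * d) *\<^sub>R n) \<subseteq> G"
    proof
      fix v assume "v \<in> open_segment (x + (5 * d) *\<^sub>R n) (y + (5 * d) *\<^sub>R n)"
      then obtain \<theta> where \<theta>: "0 < \<theta>" "\<theta> < 1"
          "v = (1 - \<theta>) *\<^sub>R (x + (5 * d) *\<^sub>R n) + \<theta> *\<^sub>R (y + (5 * d) *\<^sub>R n)"
        by (auto simp: in_segment)
      define w where "w = x + \<theta> *\<^sub>R (y - x)"
      have v: "v = w + (5 * d) *\<^sub>R n"
        using \<theta>(3) by (simp add: w_def algebra_simps)
      have dw: "dist x w \<le> d"
        using \<theta>(1,2) mult_right_mono[of \<theta> 1 d]
        by (simp add: w_def d_def dist_norm norm_minus_commute[of x y])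
      have b: "x \<in> ball z s" "x + (5 * d) *\<^sub>R n \<in> ball z s" "v \<in> ball z s"
        using shifted[of x 0] shifted[of x "5 * d"] shifted[OF dw, of "5 * d"] d v by auto
      have "f x + 5 * d * (m / 2) - 2 * m * d \<le> f v"
      proof -
        have "2 * m * dist (x + (5 * d) *\<^sub>R n) v \<le> 2 * m * d"
          using dw m by (simp add: v)
        then show ?thesis using grow[OF b(1,2)] decay[OF b(2,3)] d by linarith
      qed
      moreover have "0 \<le> f x" using mem_closure[OF subsetD[OF s(2) b(1)]] x by blast
      moreover have "0 < m * d" using m d by simp
      ultimately have "0 < f v" by (simp add: algebra_simps)
      then show "v \<in> G" using G b s by blast
    qed
    have "x + (5 * d) *\<^sub>R n \<in> closure G" "y + (5 * d) *\<^sub>R n \<in> closure G"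
      using mem[of x "5 * d"] mem[of y "5 * d"] d subsetD[OF closure_subset, of _ G] by auto
    moreover have "dist x (x + (5 * d) *\<^sub>R n) = 5 * d" "dist y (y + (5 * d) *\<^sub>R n) = 5 * d"
      using d n by (auto simp: dist_norm)
    ultimately show ?thesis
      using ray[of x] ray[of y] top d
      unfolding linked_def d_def[symmetric]
      by (intro bexI[of _ "x + (5 * d) *\<^sub>R n"] bexI[of _ "y + (5 * d) *\<^sub>R n"])
        (auto simp: open_segment_commute dist_commute d_def)
  qed
  then show ?thesis using s by (intro exI[of _ "s / 12"]) auto
qed

end

lemma closure_linked:
  fixes G :: "(real^'d::finite) set"
  assumes bd: "holder_boundary (Suc (Suc p)) \<alpha> G" "0 < \<alpha>" and "bounded G" "open G"
    and \<nu>: "\<forall>z\<in>frontier G. inward_unit_normal G z (\<nu> z)"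
  shows "\<exists>K\<ge>1. \<forall>x\<in>closure G. \<forall>y\<in>closure G. dist x y < 1 / K \<longrightarrow> linked K G x y"
proof (rule compact_uniform_constant)
  show "compact (closure G)" using \<open>bounded G\<close> by simp
next
  fix K K' :: real and x
  assume K: "1 \<le> K" "K \<le> K'" and *: "\<forall>y\<in>closure G. dist x y < 1 / K \<longrightarrow> linked K G x y"
  have "1 / K' \<le> 1 / K" using K by (simp add: frac_le)
  then show "\<forall>y\<in>closure G. dist x y < 1 / K' \<longrightarrow> linked K' G x y"
    using * K linked_mono by (meson order_less_le_trans)
next
  fix z assume z: "z \<in> closure G"
  have "\<exists>\<rho>>0. \<forall>x\<in>closure G \<inter> ball z \<rho>. \<forall>y\<in>closure G. dist x y < \<rho> \<longrightarrow> linked 5 G x y"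
  proof (cases "z \<in> G")
    case True
    then obtain r where r: "0 < r" "ball z r \<subseteq> G" using \<open>open G\<close> open_contains_ball by blast
    have "linked 5 G x y" if "x \<in> closure G" "x \<in> ball z (r / 2)" "y \<in> closure G" "dist x y < r / 2" for x y
    proof (rule linkedI)
      have "x \<in> ball z r" "y \<in> ball z r"
        using that r dist_triangle[of z y x] by auto
      then show "open_segment x y \<subseteq> G"
        using r(2) segment_open_subset_closed[of x y] closed_segment_subset[of x _ y] convex_ball by blast
    qed (use that in auto)
    then show ?thesis using r(1) by (intro exI[of _ "r / 2"]) auto
  next
    case False
    then have z: "z \<in> frontier G" using z closure_Un_frontier by blast
    then obtain r L f q where "defining_function G z r L f q"
      using boundary_defining_function[OF bd] by blast
    then interpret defining_function G z r L f q .
    have "q z \<noteq> 0" using nonzero[of z] z r \<nu> by auto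
    then show ?thesis by (rule linked_near)
  qed
  then obtain \<rho> where \<rho>: "0 < \<rho>"
      "\<And>x y. x \<in> closure G \<Longrightarrow> x \<in> ball z \<rho> \<Longrightarrow> y \<in> closure G \<Longrightarrow> dist x y < \<rho> \<Longrightarrow> linked 5 G x y"
    by blast
  \<comment> \<open>One number serves as the length factor of the paths and, through
    \<open>1 / K\<close>, as the range in which they exist.\<close>
  define K where "K = max 5 (1 / \<rho>)"
  have K: "5 \<le> K" "1 / K \<le> \<rho>" using \<rho>(1) by (auto simp: K_def max_def field_simps)
  have "linked K G x y" if "x \<in> closure G \<inter> ball z \<rho>" "y \<in> closure G" "dist x y < 1 / K" for x y
    using linked_mono[OF \<rho>(2) K(1)] that K(2) by auto
  then show "\<exists>r>0. \<exists>K\<ge>1. \<forall>x\<in>closure G \<inter> ball z r. \<forall>y\<in>closure G. dist x y < 1 / K \<longrightarrow> linked K G x y"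
    using K(1) \<rho>(1) by (intro exI[of _ \<rho>] conjI exI[of _ K] ballI impI) auto
qed

section \<open>Reflection and the barrier\<close>

locale interior_ball_domain =
  fixes G :: "'a::euclidean_space set" and \<nu> :: "'a \<Rightarrow> 'a" and \<delta> :: real
  assumes open_G: "open G" and bounded_G: "bounded G" and G_ne: "G \<noteq> {}"
    and \<delta>: "0 < \<delta>"
    and \<nu>: "\<And>P. P \<in> frontier G \<Longrightarrow> norm (\<nu> P) = 1"
    and interior_ball: "\<And>P. P \<in> frontier G \<Longrightarrow> ball (P + \<delta> *\<^sub>R \<nu> P) \<delta> \<subseteq> G"
begin

definition proj :: "'a \<Rightarrow> 'a" where
  "proj x = closest_point (frontier G) x"

definition gap :: "'a \<Rightarrow> real" where
  "gap x = dist x (proj x)"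

text \<open>The set \<open>F\<close> of the overview, written with balls so that
  \<open>interior_ball\<close> places the centres of all interior balls in it.\<close>

definition core :: "'a set" where
  "core = {y. ball y \<delta> \<subseteq> G}"

lemma frontier_ne: "frontier G \<noteq> {}"
  using G_ne bounded_G by (auto simp: frontier_eq_empty)

lemma proj_frontier: "proj x \<in> frontier G"
  unfolding proj_def by (rule closest_point_in_set[OF _ frontier_ne]) simp

lemma frontier_disjoint: "P \<in> frontier G \<Longrightarrow> P \<notin> G"
  using open_G by (simp add: frontier_def interior_open)

lemma frontier_closure: "P \<in> frontier G \<Longrightarrow> P \<in> closure G"
  by (simp add: frontier_def)

lemma gap_le: "P \<in> frontier G \<Longrightarrow> gap x \<le> dist x P"
  unfolding gap_def proj_def by (rule closest_point_le) auto

lemma gap_pos: "x \<notin> closure G \<Longrightarrow> 0 < gap x"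
  using proj_frontier[of x] frontier_closure unfolding gap_def by force

lemma gap_nonneg: "0 \<le> gap x"
  by (simp add: gap_def)

lemma segment_meets_frontier:
  assumes "x \<in> closure G" "y \<notin> closure G"
  obtains P where "P \<in> frontier G" "P \<in> closed_segment x y"
proof (cases "x \<in> G")
  case True
  have "closed_segment x y \<inter> frontier G \<noteq> {}"
    using True assms(2) closure_subset[of G]
    by (intro connected_Int_frontier) (auto intro!: connected_segment)
  then show thesis using that by blast
next
  case False
  then have "x \<in> frontier G" using assms(1) closure_Un_frontier by blast
  then show thesis using that by auto
qed

lemma gap_le_dist:
  assumes "x \<in> closure G" "y \<notin> closure G"
  shows "gap y \<le> dist x y"
proof -
  obtain P where P: "P \<in> frontier G" "P \<in> closed_segment x y"
    using segment_meets_frontier[OF assms] .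
  have "dist y P \<le> dist x y"
    using dist_in_closed_segment[OF P(2)] by (simp add: dist_commute)
  with gap_le[OF P(1), of y] show ?thesis by linarith
qed

lemma core_subset: "core \<subseteq> G"
  using \<delta> by (auto simp: core_def)

lemma closed_core: "closed core"
proof -
  have "core = (\<Inter>q\<in>- G. {y. \<delta> \<le> dist y q})"
    by (force simp: core_def)
  moreover have "closed {y. \<delta> \<le> dist y q}" for q
    by (intro closed_Collect_le continuous_intros)
  ultimately show ?thesis by auto
qed

lemma mem_core: "P \<in> frontier G \<Longrightarrow> P + \<delta> *\<^sub>R \<nu> P \<in> core"
  using interior_ball by (simp add: core_def)

lemma core_ne: "core \<noteq> {}"
  using frontier_ne mem_core by blast

text \<open>A segment from \<open>y\<close> to \<open>x\<close> crosses the frontier. The part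
  before the crossing has length at least \<open>\<delta>\<close>, and the part after it at least
  \<open>gap x\<close>.\<close>

lemma dist_core_ge:
  assumes "x \<notin> closure G" "y \<in> core"
  shows "\<delta> + gap x \<le> dist x y"
proof -
  have "y \<in> closure G" using assms(2) core_subset closure_subset by blast
  then obtain P where P: "P \<in> frontier G" "P \<in> closed_segment y x"
    using segment_meets_frontier assms(1) by blast
  then have "dist x y = dist x P + dist P y"
    by (metis between between_mem_segment closed_segment_commute)
  moreover have "\<delta> \<le> dist P y"
  proof (rule ccontr)
    assume "\<not> \<delta> \<le> dist P y"
    then have "P \<in> ball y \<delta>" by (simp add: dist_commute)
    then have "P \<in> G" using assms(2) by (auto simp: core_def)
    with frontier_disjoint[OF P(1)] show False by simp
  qed
  ultimately show ?thesis using gap_le[OF P(1), of x] by linarith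
qed

text \<open>Equality in the triangle inequality for \<open>x\<close>, its projection and the centre of the interior
  ball identifies the normal direction at the projection.\<close>

lemma outside_eq:
  assumes "x \<notin> closure G"
  shows "x = proj x - gap x *\<^sub>R \<nu> (proj x)"
proof -
  let ?P = "proj x"
  have n: "norm (\<nu> ?P) = 1" using \<nu> proj_frontier by blast
  have "\<delta> + gap x \<le> dist x (?P + \<delta> *\<^sub>R \<nu> ?P)"
    using dist_core_ge[OF assms] mem_core proj_frontier by blast
  then have "norm (x - ?P) + norm (- (\<delta> *\<^sub>R \<nu> ?P)) \<le> norm ((x - ?P) + - (\<delta> *\<^sub>R \<nu> ?P))"
    using n \<delta> by (simp add: gap_def dist_norm diff_diff_eq)
  then have "norm ((x - ?P) + - (\<delta> *\<^sub>R \<nu> ?P)) = norm (x - ?P) + norm (- (\<delta> *\<^sub>R \<nu> ?P))"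
    using norm_triangle_ineq by (rule antisym[rotated])
  then have "norm (x - ?P) *\<^sub>R - (\<delta> *\<^sub>R \<nu> ?P) = norm (- (\<delta> *\<^sub>R \<nu> ?P)) *\<^sub>R (x - ?P)"
    by (simp only: norm_triangle_eq)
  then have "\<delta> *\<^sub>R (x - ?P) = \<delta> *\<^sub>R - (gap x *\<^sub>R \<nu> ?P)"
    using n \<delta> by (simp add: gap_def dist_norm mult.commute)
  then have "x - ?P = - (gap x *\<^sub>R \<nu> ?P)"
    using \<delta> by (subst (asm) real_vector.scale_cancel_left) simp
  then show ?thesis by (simp add: algebra_simps)
qed

lemma reflected_eq:
  "x \<notin> closure G \<Longrightarrow> x + (2 * gap x) *\<^sub>R \<nu> (proj x) = proj x + gap x *\<^sub>R \<nu> (proj x)"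
  by (subst (1) outside_eq) (simp_all add: algebra_simps flip: scaleR_add_left)

lemma dist_reflected_core:
  assumes "P \<in> frontier G" "0 \<le> r" "r \<le> \<delta>"
  shows "dist (P + r *\<^sub>R \<nu> P) (P + \<delta> *\<^sub>R \<nu> P) = \<delta> - r"
  using \<nu>[OF assms(1)] assms(3) by (simp add: dist_norm flip: scaleR_diff_left)

lemma inward_mem:
  assumes "P \<in> frontier G" "0 < r" "r \<le> \<delta>"
  shows "P + r *\<^sub>R \<nu> P \<in> G"
proof -
  have "dist (P + \<delta> *\<^sub>R \<nu> P) (P + r *\<^sub>R \<nu> P) = \<delta> - r"
    using dist_reflected_core[of P r] assms by (metis dist_commute less_imp_le)
  then have "P + r *\<^sub>R \<nu> P \<in> ball (P + \<delta> *\<^sub>R \<nu> P) \<delta>"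
    unfolding mem_ball using assms(2) by linarith
  then show ?thesis using interior_ball[OF assms(1)] by blast
qed

text \<open>The square is essential: the distance itself has a convex kink at the edge of the core,
  whereas its square is an infimum of the paraboloids \<open>(dist x y)\<^sup>2\<close>.\<close>

definition depth2 :: "'a \<Rightarrow> real" where
  "depth2 x = (infdist x core)\<^sup>2"

lemma depth2_nonneg: "0 \<le> depth2 x"
  by (simp add: depth2_def)

text \<open>The distance to the core is at least \<open>\<delta> + gap x\<close> before the
  reflection and at most \<open>\<delta> - gap x\<close> after it; the squares differ by
  \<open>4 * \<delta> * gap x\<close>.\<close>

lemma depth2_reflected:
  assumes x: "x \<notin> closure G" and "gap x \<le> \<delta>"
  shows "depth2 (x + (2 * gap x) *\<^sub>R \<nu> (proj x)) \<le> depth2 x - 4 * \<delta> * gap x"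
proof -
  obtain y where y: "y \<in> core" "infdist x core = dist x y"
    using infdist_attains_inf[OF closed_core core_ne] by blast
  have "\<delta> + gap x \<le> infdist x core" using dist_core_ge[OF x y(1)] y(2) by simp
  then have "(\<delta> + gap x)\<^sup>2 \<le> depth2 x"
    using \<delta> gap_nonneg[of x] by (simp add: depth2_def power_mono)
  moreover have "infdist (proj x + gap x *\<^sub>R \<nu> (proj x)) core \<le> \<delta> - gap x"
    using infdist_le[OF mem_core[OF proj_frontier], of "proj x + gap x *\<^sub>R \<nu> (proj x)" x]
      dist_reflected_core[OF proj_frontier gap_nonneg assms(2)] by simp
  then have "depth2 (x + (2 * gap x) *\<^sub>R \<nu> (proj x)) \<le> (\<delta> - gap x)\<^sup>2"
    unfolding reflected_eq[OF x] depth2_def by (intro power_mono infdist_nonneg)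
  ultimately show ?thesis by (simp add: power2_eq_square algebra_simps)
qed

text \<open>Keep the core point \<open>y\<close> nearest to \<open>x\<close> fixed:
  \<open>(dist (x + v) y)\<^sup>2\<close> is a quadratic upper bound in \<open>v\<close> that is
  attained at \<open>v = 0\<close>, with slope \<open>2 *\<^sub>R (x - y)\<close>.\<close>

lemma depth2_semiconcave:
  assumes "x \<in> closure G"
  obtains p where "norm p \<le> 2 * diameter (closure G)"
    "\<And>v. depth2 (x + v) \<le> depth2 x + p \<bullet> v + (norm v)\<^sup>2"
proof -
  obtain y where y: "y \<in> core" "infdist x core = dist x y"
    using infdist_attains_inf[OF closed_core core_ne] by blast
  have "y \<in> closure G" using y(1) core_subset closure_subset by blast
  then have "dist x y \<le> diameter (closure G)"
    using diameter_bounded_bound[of "closure G" x y] bounded_closure[OF bounded_G] assms by simp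
  then have "norm (2 *\<^sub>R (x - y)) \<le> 2 * diameter (closure G)"
    by (simp add: dist_norm)
  moreover have "depth2 (x + v) \<le> depth2 x + (2 *\<^sub>R (x - y)) \<bullet> v + (norm v)\<^sup>2" for v
  proof -
    have "depth2 (x + v) \<le> (dist (x + v) y)\<^sup>2"
      unfolding depth2_def by (intro power_mono infdist_le y infdist_nonneg)
    also have "\<dots> = (norm ((x - y) + v))\<^sup>2" by (simp add: dist_norm algebra_simps)
    also have "\<dots> = depth2 x + (2 *\<^sub>R (x - y)) \<bullet> v + (norm v)\<^sup>2"
      by (simp add: depth2_def y(2) dist_norm power2_norm_eq_inner inner_add_left inner_add_right
          inner_commute)
    finally show ?thesis .
  qed
  ultimately show thesis by (rule that)
qed

end

section \<open>Taylor expansion in the closure of a domain\<close>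

text \<open>Multilinear forms with curried coefficient arrays. Each is \<open>lin\<close> of forms
  of lower order, so that bounds and derivatives follow by iterating those of
  \<open>lin\<close>.\<close>

definition lin :: "('d::finite \<Rightarrow> real) \<Rightarrow> real^'d \<Rightarrow> real" where
  "lin a v = (\<Sum>i\<in>UNIV. v $ i * a i)"

definition quad :: "('d::finite \<Rightarrow> 'd \<Rightarrow> real) \<Rightarrow> real^'d \<Rightarrow> real^'d \<Rightarrow> real" where
  "quad a v w = lin (\<lambda>i. lin (a i) w) v"

definition cub :: "('d::finite \<Rightarrow> 'd \<Rightarrow> 'd \<Rightarrow> real) \<Rightarrow> real^'d \<Rightarrow> real^'d \<Rightarrow> real^'d \<Rightarrow> real" where
  "cub a v w z = lin (\<lambda>i. quad (a i) w z) v"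

lemma lin_add: "lin a (v + w) = lin a v + lin a w"
  and lin_diff: "lin a (v - w) = lin a v - lin a w"
  and lin_scaleR: "lin a (t *\<^sub>R v) = t * lin a v"
  and lin_minus: "lin a (- v) = - lin a v"
  by (simp_all add: lin_def algebra_simps sum.distrib sum_subtractf sum_distrib_left sum_negf)

lemma lin_add_coeff: "lin (\<lambda>i. f i + g i) v = lin f v + lin g v"
  and lin_diff_coeff: "lin (\<lambda>i. f i - g i) v = lin f v - lin g v"
  and lin_scale_coeff: "lin (\<lambda>i. t * f i) v = t * lin f v"
  and lin_minus_coeff: "lin (\<lambda>i. - f i) v = - lin f v"
  by (simp_all add: lin_def algebra_simps sum.distrib sum_subtractf sum_distrib_left sum_negf)

lemmas lin_simps = lin_add lin_diff lin_scaleR lin_minus lin_add_coeff lin_diff_coeff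
  lin_scale_coeff lin_minus_coeff

lemma quad_simps:
  "quad a (v + v') w = quad a v w + quad a v' w" "quad a v (w + w') = quad a v w + quad a v w'"
  "quad a (v - v') w = quad a v w - quad a v' w" "quad a v (w - w') = quad a v w - quad a v w'"
  "quad a (t *\<^sub>R v) w = t * quad a v w" "quad a v (t *\<^sub>R w) = t * quad a v w"
  "quad a (- v) w = - quad a v w" "quad a v (- w) = - quad a v w"
  by (simp_all add: quad_def lin_simps)

lemma cub_simps:
  "cub a (v + v') w z = cub a v w z + cub a v' w z"
  "cub a v (w + w') z = cub a v w z + cub a v w' z"
  "cub a v w (z + z') = cub a v w z + cub a v w z'"
  "cub a (v - v') w z = cub a v w z - cub a v' w z"
  "cub a v (w - w') z = cub a v w z - cub a v w' z"
  "cub a v w (z - z') = cub a v w z - cub a v w z'"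
  "cub a (t *\<^sub>R v) w z = t * cub a v w z"
  "cub a v (t *\<^sub>R w) z = t * cub a v w z"
  "cub a v w (t *\<^sub>R z) = t * cub a v w z"
  "cub a (- v) w z = - cub a v w z" "cub a v (- w) z = - cub a v w z"
  "cub a v w (- z) = - cub a v w z"
  by (simp_all add: cub_def quad_simps lin_simps)

lemma quad_commute:
  assumes "\<And>i j. a i j = a j i"
  shows "quad a v w = quad a w v"
proof -
  have "quad a v w = (\<Sum>i\<in>UNIV. \<Sum>j\<in>UNIV. v $ i * (w $ j * a i j))"
    by (simp add: quad_def lin_def sum_distrib_left)
  also have "\<dots> = (\<Sum>j\<in>UNIV. \<Sum>i\<in>UNIV. v $ i * (w $ j * a i j))"
    by (rule sum.swap)
  also have "\<dots> = quad a w v"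
    using assms by (simp add: quad_def lin_def sum_distrib_left mult.left_commute)
  finally show ?thesis .
qed

lemma cub_commute23: "(\<And>i j k. a i j k = a i k j) \<Longrightarrow> cub a v w z = cub a v z w"
  unfolding cub_def using quad_commute by metis

lemma cub_commute12:
  assumes "\<And>i j k. a i j k = a j i k"
  shows "cub a v w z = cub a w v z"
proof -
  have "a i j = a j i" for i j using assms by blast
  then have "lin (a i j) z = lin (a j i) z" for i j by metis
  then show ?thesis
    using quad_commute[of "\<lambda>i j. lin (a i j) z" v w] by (simp add: cub_def quad_def)
qed

lemma lin_le:
  assumes "\<And>i. \<bar>a i\<bar> \<le> B"
  shows "\<bar>lin a (v :: real^'d::finite)\<bar> \<le> real CARD('d) * B * norm v"
  using norm_sum_scaleR_component_le[of a B v] assms by (simp add: lin_def)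

lemma quad_le:
  assumes "\<And>i j. \<bar>a i j\<bar> \<le> B"
  shows "\<bar>quad a (v :: real^'d::finite) w\<bar> \<le> (real CARD('d))\<^sup>2 * B * norm v * norm w"
proof -
  have "\<bar>lin (a i) w\<bar> \<le> real CARD('d) * B * norm w" for i
    by (rule lin_le) (rule assms)
  then show ?thesis
    using lin_le[of "\<lambda>i. lin (a i) w" "real CARD('d) * B * norm w" v]
    by (simp add: quad_def power2_eq_square mult_ac)
qed

lemma cub_le:
  assumes "\<And>i j k. \<bar>a i j k\<bar> \<le> B"
  shows "\<bar>cub a (v :: real^'d::finite) w z\<bar> \<le> (real CARD('d)) ^ 3 * B * norm v * norm w * norm z"
proof -
  have "\<bar>quad (a i) w z\<bar> \<le> (real CARD('d))\<^sup>2 * B * norm w * norm z" for i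
    by (rule quad_le) (rule assms)
  then show ?thesis
    using lin_le[of "\<lambda>i. quad (a i) w z" "(real CARD('d))\<^sup>2 * B * norm w * norm z" v]
    by (simp add: cub_def power2_eq_square power3_eq_cube mult_ac)
qed

lemma has_partials_on_lin_iff:
  "(f has_partials_on f') U \<longleftrightarrow> (\<forall>x\<in>U. (f has_derivative lin (\<lambda>i. f' i x)) (at x))"
  by (simp add: has_partials_on_def lin_def[abs_def])

lemma has_partials_on_diff:
  fixes f g :: "real^'d::finite \<Rightarrow> real"
  assumes "(f has_partials_on f') U" "(g has_partials_on g') U"
  shows "((\<lambda>x. f x - g x) has_partials_on (\<lambda>i x. f' i x - g' i x)) U"
  using assms unfolding has_partials_on_lin_iff lin_diff_coeff[abs_def] by (simp add: has_derivative_diff)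

lemma has_partials_on_const: "((\<lambda>x. c :: real) has_partials_on (\<lambda>i x. 0)) U"
  by (simp add: has_partials_on_def)

lemma has_derivative_vec_nth: "((\<lambda>x. x $ i) has_derivative (\<lambda>v. v $ i)) F"
  by (rule bounded_linear_imp_has_derivative[OF bounded_linear_vec_nth])

lemma has_derivative_lin: "((\<lambda>w. lin a (w - x)) has_derivative lin a) (at w)"
  unfolding lin_def by (auto intro!: derivative_eq_intros has_derivative_vec_nth)

lemma has_partials_on_lin: "((\<lambda>w. lin a (w - x)) has_partials_on (\<lambda>i w. a i)) U"
  by (simp add: has_partials_on_lin_iff has_derivative_lin)

lemma has_derivative_quad:
  assumes "\<And>i j. a i j = a j i"
  shows "((\<lambda>w. quad a (w - x) (w - x)) has_derivative (\<lambda>v. 2 * quad a v (w - x))) (at w)"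
proof -
  have "((\<lambda>w. \<Sum>i\<in>UNIV. (w - x) $ i * lin (a i) (w - x)) has_derivative
      (\<lambda>v. \<Sum>i\<in>UNIV. (w - x) $ i * lin (a i) v + v $ i * lin (a i) (w - x))) (at w)"
    by (auto intro!: derivative_eq_intros has_derivative_lin has_derivative_vec_nth)
  then have "((\<lambda>w. quad a (w - x) (w - x)) has_derivative
      (\<lambda>v. quad a (w - x) v + quad a v (w - x))) (at w)"
    by (simp add: quad_def lin_def[of "\<lambda>i. lin (a i) _"] sum.distrib)
  moreover have "quad a (w - x) v + quad a v (w - x) = 2 * quad a v (w - x)" for v
    using quad_commute[of a v "w - x"] assms by simp
  ultimately show ?thesis by simp
qed

text \<open>The partials of a Taylor polynomial are the Taylor polynomials, one order lower, of the
  partials. This and the cubic analogue make each remainder in \<open>taylor_remainder\<close> a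
  primitive of the next one.\<close>

lemma has_partials_on_quad:
  assumes "\<And>i j. a i j = a j i"
  shows "((\<lambda>w. quad a (w - x) (w - x) / 2) has_partials_on (\<lambda>i w. lin (a i) (w - x))) U"
proof -
  have "((\<lambda>w. quad a (w - x) (w - x) / 2) has_derivative lin (\<lambda>i. lin (a i) (w - x))) (at w)" for w
  proof -
    have "(\<lambda>v. 2 * quad a v (w - x) / 2) = lin (\<lambda>i. lin (a i) (w - x))"
      by (simp add: quad_def fun_eq_iff)
    with bounded_linear.has_derivative[OF bounded_linear_divide has_derivative_quad[of a x w, OF assms], of 2]
    show ?thesis by (simp only:)
  qed
  then show ?thesis by (simp add: has_partials_on_lin_iff)
qed

lemma has_partials_on_cub:
  assumes "\<And>i j k. a i j k = a i k j" "\<And>i j k. a i j k = a j i k"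
  shows "((\<lambda>w. cub a (w - x) (w - x) (w - x) / 6) has_partials_on
     (\<lambda>i w. quad (a i) (w - x) (w - x) / 2)) U"
proof -
  have "((\<lambda>w. cub a (w - x) (w - x) (w - x) / 6) has_derivative
      lin (\<lambda>i. quad (a i) (w - x) (w - x) / 2)) (at w)" for w
  proof -
    have "((\<lambda>w. \<Sum>i\<in>UNIV. (w - x) $ i * quad (a i) (w - x) (w - x)) has_derivative
        (\<lambda>v. \<Sum>i\<in>UNIV. (w - x) $ i * (2 * quad (a i) v (w - x))
           + v $ i * quad (a i) (w - x) (w - x))) (at w)"
      by (auto intro!: derivative_eq_intros has_derivative_quad has_derivative_vec_nth assms(1))
    then have "((\<lambda>w. cub a (w - x) (w - x) (w - x)) has_derivative
        (\<lambda>v. 2 * cub a (w - x) v (w - x) + cub a v (w - x) (w - x))) (at w)"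
      by (simp add: cub_def lin_def[of "\<lambda>i. quad (a i) _ _"] sum.distrib sum_distrib_left mult.left_commute)
    then have "((\<lambda>w. cub a (w - x) (w - x) (w - x)) has_derivative
        (\<lambda>v. 3 * cub a v (w - x) (w - x))) (at w)"
      using cub_commute12[of a "w - x" _ "w - x"] assms(2) by simp
    from bounded_linear.has_derivative[OF bounded_linear_divide this, of 6]
    have "((\<lambda>w. cub a (w - x) (w - x) (w - x) / 6) has_derivative
        (\<lambda>v. 3 * cub a v (w - x) (w - x) / 6)) (at w)" .
    moreover have "(\<lambda>v. 3 * cub a v (w - x) (w - x) / 6) = lin (\<lambda>i. quad (a i) (w - x) (w - x) / 2)"
      by (simp add: cub_def fun_eq_iff lin_def sum_divide_distrib sum_distrib_left)
    ultimately show ?thesis by (simp only:)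
  qed
  then show ?thesis by (simp add: has_partials_on_lin_iff)
qed

text \<open>The mean value theorem needs derivatives only at interior points of the segment, so the
  ends may lie on the frontier, where \<open>F\<close> is merely continuous.\<close>

lemma segment_increment_le:
  fixes F :: "real^'d::finite \<Rightarrow> real"
  assumes F: "(F has_partials_on F') G" "continuous_on (closure G) F"
    and seg: "open_segment a b \<subseteq> G" "a \<in> closure G" "b \<in> closure G"
    and M: "\<And>w i. w \<in> open_segment a b \<Longrightarrow> \<bar>F' i w\<bar> \<le> M" "0 \<le> M"
    and y: "y \<in> closed_segment a b"
  shows "\<bar>F y - F a\<bar> \<le> real CARD('d) * M * dist a b"
proof (cases "a = b")
  case True
  then show ?thesis using y by simp
next
  case False
  obtain t where t: "0 \<le> t" "t \<le> 1" and yt: "y = a + t *\<^sub>R (b - a)"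
    using y by (auto simp: in_segment algebra_simps)
  have closed: "a + s *\<^sub>R (b - a) \<in> closed_segment a b" if "0 \<le> s" "s \<le> 1" for s
    using that by (auto simp: in_segment algebra_simps)
  have opened: "a + s *\<^sub>R (b - a) \<in> open_segment a b" if "0 < s" "s < 1" for s
    using that False by (auto simp: in_segment algebra_simps)
  have sub: "closed_segment a b \<subseteq> closure G"
    using seg closure_subset[of G] by (auto simp: closed_segment_eq_open)
  show ?thesis
  proof (cases "t = 0")
    case True
    then show ?thesis using yt M(2) by simp
  next
    case False
    have "continuous_on {0..t} (\<lambda>s. F (a + s *\<^sub>R (b - a)))"
      using t sub closed by (intro continuous_on_compose2[OF F(2)] continuous_intros) force
    moreover have "((\<lambda>s. F (a + s *\<^sub>R (b - a))) has_derivative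
        (*) (lin (\<lambda>i. F' i (a + s *\<^sub>R (b - a))) (b - a))) (at s)" if "0 < s" "s < t" for s
      using has_partials_on_line_real[OF F(1), of a s "b - a"] opened[of s] seg(1) that t
      by (auto simp: has_field_derivative_def lin_def)
    ultimately obtain s where s: "0 < s" "s < t"
      "F (a + t *\<^sub>R (b - a)) - F (a + 0 *\<^sub>R (b - a)) =
        lin (\<lambda>i. F' i (a + s *\<^sub>R (b - a))) (b - a) * (t - 0)"
      using mvt[of 0 t "\<lambda>s. F (a + s *\<^sub>R (b - a))"
          "\<lambda>s. (*) (lin (\<lambda>i. F' i (a + s *\<^sub>R (b - a))) (b - a))"] t False by auto
    have "\<bar>lin (\<lambda>i. F' i (a + s *\<^sub>R (b - a))) (b - a)\<bar> \<le> real CARD('d) * M * dist a b"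
      using lin_le[of "\<lambda>i. F' i (a + s *\<^sub>R (b - a))" M "b - a"] M(1)[OF opened[of s]] s t by (simp add: dist_norm norm_minus_commute)
    then have "\<bar>F y - F a\<bar> \<le> (real CARD('d) * M * dist a b) * \<bar>t\<bar>"
      using s(3) by (simp add: yt abs_mult mult_right_mono)
    also have "\<dots> \<le> (real CARD('d) * M * dist a b) * 1"
      using t M(2) by (intro mult_left_mono) auto
    finally show ?thesis by simp
  qed
qed

text \<open>\<open>S\<close> is the three-segment path. It is chosen before \<open>F\<close>, so
  that one path serves all remainders, and the bound holds at every point of \<open>S\<close>
  because it becomes the bound on the partials of the next remainder.\<close>

lemma linked_path:
  fixes G :: "(real^'d::finite) set"
  assumes "linked K G x y" "x \<in> closure G" "y \<in> closure G"
  obtains S where "S \<subseteq> closure G" "y \<in> S"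
    "\<And>(F :: real^'d \<Rightarrow> real) F' M. (F has_partials_on F') G \<Longrightarrow> continuous_on (closure G) F \<Longrightarrow> F x = 0 \<Longrightarrow>
       (\<And>w i. w \<in> S \<Longrightarrow> w \<in> G \<Longrightarrow> \<bar>F' i w\<bar> \<le> M) \<Longrightarrow> 0 \<le> M \<Longrightarrow>
       (\<And>w. w \<in> S \<Longrightarrow> \<bar>F w\<bar> \<le> 3 * real CARD('d) * K * dist x y * M)"
proof -
  obtain a b where ab: "a \<in> closure G" "b \<in> closure G"
    and seg: "open_segment x a \<subseteq> G" "open_segment a b \<subseteq> G" "open_segment b y \<subseteq> G"
    and len: "dist x a \<le> K * dist x y" "dist a b \<le> K * dist x y" "dist b y \<le> K * dist x y"
    using assms(1) by (auto simp: linked_def)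
  define S where "S = closed_segment x a \<union> closed_segment a b \<union> closed_segment b y"
  have "closed_segment p q \<subseteq> closure G" if "open_segment p q \<subseteq> G" "p \<in> closure G" "q \<in> closure G" for p q
    using that closure_subset[of G] by (auto simp: closed_segment_eq_open)
  then have "S \<subseteq> closure G" using seg assms(2,3) ab by (auto simp: S_def)
  moreover have "y \<in> S" by (simp add: S_def)
  moreover have "\<bar>F w\<bar> \<le> 3 * real CARD('d) * K * dist x y * M"
    if F: "(F has_partials_on F') G" "continuous_on (closure G) F" and 0: "F x = 0"
      and M: "\<And>w i. w \<in> S \<Longrightarrow> w \<in> G \<Longrightarrow> \<bar>F' i w\<bar> \<le> M" "0 \<le> M" and w: "w \<in> S"
    for F :: "real^'d \<Rightarrow> real" and F' M w
  proof -
    define c where "c = real CARD('d) * M * (K * dist x y)"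
    have step: "\<bar>F q - F p\<bar> \<le> c"
      if "open_segment p p' \<subseteq> G" "p \<in> closure G" "p' \<in> closure G" "q \<in> closed_segment p p'"
        "closed_segment p p' \<subseteq> S" "dist p p' \<le> K * dist x y" for p p' q
    proof -
      have "\<bar>F q - F p\<bar> \<le> real CARD('d) * M * dist p p'"
        using that(1,5) segment_open_subset_closed[of p p']
        by (intro segment_increment_le[OF F that(1-3) _ M(2) that(4)] M(1)) auto
      also have "\<dots> \<le> c"
        unfolding c_def using that(6) M(2) by (intro mult_left_mono) auto
      finally show ?thesis .
    qed
    have "\<bar>F q - F x\<bar> \<le> c" if "q \<in> closed_segment x a" for q
      using step[OF seg(1) assms(2) ab(1) that] len by (auto simp: S_def)
    moreover have "\<bar>F q - F a\<bar> \<le> c" if "q \<in> closed_segment a b" for q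
      using step[OF seg(2) ab that] len by (auto simp: S_def)
    moreover have "\<bar>F q - F b\<bar> \<le> c" if "q \<in> closed_segment b y" for q
      using step[OF seg(3) ab(2) assms(3) that] len by (auto simp: S_def)
    moreover from step[OF seg(1) assms(2) ab(1), of x] len have "0 \<le> c" by (auto simp: S_def)
    ultimately have "\<bar>F w\<bar> \<le> 3 * c"
      using w 0 ends_in_segment unfolding S_def by (smt (verit) Un_iff)
    then show ?thesis by (simp add: c_def mult_ac)
  qed
  ultimately show thesis by (rule that)
qed

text \<open>\<open>u1\<close> to \<open>u4\<close> extend the partial derivatives to the closure. On
  the frontier the first three are known only as limits from inside, so identities between them are
  proved in \<open>G\<close> and transferred by \<open>eq_on_closure\<close>.\<close>

locale smooth4 =
  fixes G :: "(real^'d::finite) set" and u :: "real^'d \<Rightarrow> real"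
    and u1 u2 u3 u4 and B K :: real
  assumes open_G: "open G"
    and partials: "(u has_partials_on u1) G" "\<And>i. (u1 i has_partials_on u2 i) G"
      "\<And>i j. (u2 i j has_partials_on u3 i j) G" "\<And>i j k. (u3 i j k has_partials_on u4 i j k) G"
    and cont: "continuous_on (closure G) u" "\<And>i. continuous_on (closure G) (u1 i)"
      "\<And>i j. continuous_on (closure G) (u2 i j)" "\<And>i j k. continuous_on (closure G) (u3 i j k)"
    and bound: "\<And>x. x \<in> closure G \<Longrightarrow> \<bar>u x\<bar> \<le> B" "\<And>x i. x \<in> closure G \<Longrightarrow> \<bar>u1 i x\<bar> \<le> B"
      "\<And>x i j. x \<in> closure G \<Longrightarrow> \<bar>u2 i j x\<bar> \<le> B" "\<And>x i j k. x \<in> closure G \<Longrightarrow> \<bar>u3 i j k x\<bar> \<le> B"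
      "\<And>x i j k l. x \<in> G \<Longrightarrow> \<bar>u4 i j k l x\<bar> \<le> B"
    and B: "0 \<le> B" and K: "1 \<le> K"
    and linked: "\<And>x y. x \<in> closure G \<Longrightarrow> y \<in> closure G \<Longrightarrow> dist x y < 1 / K \<Longrightarrow> linked K G x y"
begin

abbreviation du :: "real^'d \<Rightarrow> real^'d \<Rightarrow> real" where
  "du x \<equiv> lin (\<lambda>i. u1 i x)"

abbreviation ddu :: "real^'d \<Rightarrow> real^'d \<Rightarrow> real^'d \<Rightarrow> real" where
  "ddu x \<equiv> quad (\<lambda>i j. u2 i j x)"

abbreviation dddu :: "real^'d \<Rightarrow> real^'d \<Rightarrow> real^'d \<Rightarrow> real^'d \<Rightarrow> real" where
  "dddu x \<equiv> cub (\<lambda>i j k. u3 i j k x)"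

definition taylor :: "real^'d \<Rightarrow> real^'d \<Rightarrow> real" where
  "taylor x v = u x + du x v + ddu x v v / 2 + dddu x v v v / 6"

lemma eq_on_closure:
  assumes "continuous_on (closure G) f" "continuous_on (closure G) g"
    and "\<And>x. x \<in> G \<Longrightarrow> f x = (g x :: real)" and "x \<in> closure G"
  shows "f x = g x"
  using continuous_constant_on_closure[of G "\<lambda>x. f x - g x" 0 x] assms
  by (auto intro: continuous_intros)

lemma u2_commute: "x \<in> closure G \<Longrightarrow> u2 i j x = u2 j i x"
  by (rule eq_on_closure[OF cont(3) cont(3)])
    (rule mixed_partials_commute[OF partials(1,2) open_G has_partials_on_continuous_on[OF partials(3)]])

lemma u3_commute23: "x \<in> closure G \<Longrightarrow> u3 i j k x = u3 i k j x"
  by (rule eq_on_closure[OF cont(4) cont(4)])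
    (rule mixed_partials_commute[OF partials(2,3) open_G has_partials_on_continuous_on[OF partials(4)]])

text \<open>The identity \<open>u2 i j = u2 j i\<close> holds on the open set \<open>G\<close> and
  can be differentiated there.\<close>

lemma u3_commute12: "x \<in> closure G \<Longrightarrow> u3 i j k x = u3 j i k x"
proof (rule eq_on_closure[OF cont(4) cont(4)])
  fix x assume x: "x \<in> G"
  have "(u2 i j has_partials_on u3 j i) G"
    unfolding has_partials_on_def
  proof
    fix y assume y: "y \<in> G"
    show "(u2 i j has_derivative (\<lambda>v. \<Sum>k\<in>UNIV. v $ k *\<^sub>R u3 j i k y)) (at y)"
      by (rule has_derivative_transform_within_open[OF has_partials_onD[OF partials(3) y] open_G y])
        (use u2_commute closure_subset in blast)
  qed
  with partials(3) x show "u3 i j k x = u3 j i k x"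
    using has_partials_on_partial_deriv by metis
qed

lemma dddu_commute12: "x \<in> closure G \<Longrightarrow> dddu x v w z = dddu x w v z"
  by (rule cub_commute12) (rule u3_commute12)

lemma dddu_commute23: "x \<in> closure G \<Longrightarrow> dddu x v w z = dddu x v z w"
  by (rule cub_commute23) (rule u3_commute23)

lemma ddu_commute: "x \<in> closure G \<Longrightarrow> ddu x v w = ddu x w v"
  by (rule quad_commute) (rule u2_commute)

lemma continuous_on_lin_diff: "continuous_on S (\<lambda>w. lin a (w - x))"
  unfolding lin_def by (intro continuous_intros)

lemma continuous_on_quad_diff: "continuous_on S (\<lambda>w. quad a (w - x) (w - x))"
  unfolding quad_def lin_def by (intro continuous_intros)

lemma continuous_on_cub_diff: "continuous_on S (\<lambda>w. cub a (w - x) (w - x) (w - x))"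
  unfolding cub_def quad_def lin_def by (intro continuous_intros)

text \<open>The factor that one integration along a connecting path costs: three segments of length
  at most \<open>K * d\<close>, and the dimension from \<open>lin_le\<close>.\<close>

definition scale :: "real \<Rightarrow> real" where
  "scale d = 3 * real CARD('d) * K * d"

text \<open>The remainders \<open>R0\<close>, \<open>R1\<close>, \<open>R2\<close>,
  \<open>R3\<close> vanish at \<open>x\<close>, each has the next one as its partials, and
  \<open>R3\<close> has \<open>u4\<close>. Integrating along one path from the bound on
  \<open>u4\<close> multiplies by \<open>scale\<close> each time. The last claim starts from the
  bound on \<open>u2\<close> in the same way.\<close>

lemma taylor_remainder:
  assumes x: "x \<in> closure G" and y: "y \<in> closure G" and near: "dist x y < 1 / K"
  shows "\<bar>u y - taylor x (y - x)\<bar> \<le> scale (dist x y) ^ 4 * B"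
    and "\<bar>u1 i y - (u1 i x + lin (\<lambda>j. u2 i j x) (y - x)
        + quad (\<lambda>j k. u3 i j k x) (y - x) (y - x) / 2)\<bar> \<le> scale (dist x y) ^ 3 * B"
    and "\<bar>u y - u x - du x (y - x)\<bar> \<le> scale (dist x y) ^ 2 * B"
proof -
  define c where "c = scale (dist x y)"
  have c: "0 \<le> c" using K by (simp add: c_def scale_def)
  obtain S where S: "S \<subseteq> closure G" "y \<in> S"
    and path: "\<And>(F :: real^'d \<Rightarrow> real) F' M w. (F has_partials_on F') G \<Longrightarrow> continuous_on (closure G) F \<Longrightarrow>
       F x = 0 \<Longrightarrow> (\<And>w i. w \<in> S \<Longrightarrow> w \<in> G \<Longrightarrow> \<bar>F' i w\<bar> \<le> M) \<Longrightarrow> 0 \<le> M \<Longrightarrow> w \<in> S \<Longrightarrow>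
       \<bar>F w\<bar> \<le> c * M"
    using linked_path[OF linked[OF x y near] x y] unfolding c_def scale_def by metis
  define R3 where "R3 i j k w = u3 i j k w - u3 i j k x" for i j k w
  define R2 where "R2 i j w = u2 i j w - u2 i j x - lin (\<lambda>k. u3 i j k x) (w - x)" for i j w
  define R1 where "R1 i w = u1 i w - u1 i x - lin (\<lambda>j. u2 i j x) (w - x)
    - quad (\<lambda>j k. u3 i j k x) (w - x) (w - x) / 2" for i w
  define R0 where "R0 w = u w - u x - du x (w - x) - ddu x (w - x) (w - x) / 2
    - dddu x (w - x) (w - x) (w - x) / 6" for w
  note const = has_partials_on_diff[OF _ has_partials_on_const, simplified]
  have p3: "(R3 i j k has_partials_on u4 i j k) G" for i j k
    unfolding R3_def[abs_def] by (rule const[OF partials(4)])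
  have p2: "(R2 i j has_partials_on R3 i j) G" for i j
    unfolding R2_def[abs_def] R3_def[abs_def]
    by (intro has_partials_on_diff const partials has_partials_on_lin)
  have p1: "(R1 i has_partials_on R2 i) G" for i
    unfolding R1_def[abs_def] R2_def[abs_def]
    by (intro has_partials_on_diff const partials has_partials_on_lin has_partials_on_quad
        u3_commute23 x)
  have p0: "(R0 has_partials_on R1) G"
    unfolding R0_def[abs_def] R1_def[abs_def]
    by (intro has_partials_on_diff const partials has_partials_on_lin has_partials_on_quad
        has_partials_on_cub u2_commute u3_commute23 u3_commute12 x)
  note cont_intros = cont continuous_intros continuous_on_lin_diff continuous_on_quad_diff
    continuous_on_cub_diff
  have b3: "\<bar>R3 i j k w\<bar> \<le> c * B" if "w \<in> S" for i j k w
    by (rule path[OF p3 _ _ bound(5) B that]) (auto simp: R3_def intro!: cont_intros)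
  have b2: "\<bar>R2 i j w\<bar> \<le> c * (c * B)" if "w \<in> S" for i j w
    by (rule path[OF p2 _ _ b3 _ that]) (use c B in \<open>auto simp: R2_def lin_def intro!: cont_intros\<close>)
  have b1: "\<bar>R1 i w\<bar> \<le> c * (c * (c * B))" if "w \<in> S" for i w
    by (rule path[OF p1 _ _ b2 _ that])
      (use c B in \<open>auto simp: R1_def lin_def quad_def intro!: cont_intros\<close>)
  have b0: "\<bar>R0 w\<bar> \<le> c * (c * (c * (c * B)))" if "w \<in> S" for w
    by (rule path[OF p0 _ _ b1 _ that])
      (use c B in \<open>auto simp: R0_def lin_def quad_def cub_def intro!: cont_intros\<close>)
  have q1: "((\<lambda>w. u1 i w - u1 i x) has_partials_on u2 i) G" for i
    by (rule const[OF partials(2)])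
  have q0: "((\<lambda>w. u w - u x - du x (w - x)) has_partials_on (\<lambda>i w. u1 i w - u1 i x)) G"
    by (intro has_partials_on_diff const partials has_partials_on_lin)
  have d1: "\<bar>u1 i w - u1 i x\<bar> \<le> c * B" if "w \<in> S" for i w
    by (rule path[OF q1 _ _ bound(3) B that]) (use S in \<open>auto intro!: cont_intros\<close>)
  have d0: "\<bar>u w - u x - du x (w - x)\<bar> \<le> c * (c * B)" if "w \<in> S" for w
    by (rule path[OF q0 _ _ d1 _ that]) (use c B in \<open>auto simp: lin_def intro!: cont_intros\<close>)
  show "\<bar>u y - taylor x (y - x)\<bar> \<le> scale (dist x y) ^ 4 * B"
    using b0[OF S(2)] by (simp add: R0_def taylor_def c_def[symmetric] power4_eq_xxxx algebra_simps)
  show "\<bar>u1 i y - (u1 i x + lin (\<lambda>j. u2 i j x) (y - x)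
        + quad (\<lambda>j k. u3 i j k x) (y - x) (y - x) / 2)\<bar> \<le> scale (dist x y) ^ 3 * B"
    using b1[OF S(2), of i]
    by (simp add: R1_def c_def[symmetric] power3_eq_cube mult.assoc diff_diff_eq)
  show "\<bar>u y - u x - du x (y - x)\<bar> \<le> scale (dist x y) ^ 2 * B"
    using d0[OF S(2)] by (simp add: c_def[symmetric] power2_eq_square mult.assoc)
qed

lemma du_remainder:
  assumes "x \<in> closure G" "y \<in> closure G" "dist x y < 1 / K"
  shows "\<bar>du y n - (du x n + ddu x n (y - x) + dddu x n (y - x) (y - x) / 2)\<bar>
    \<le> real CARD('d) * (scale (dist x y) ^ 3 * B) * norm n"
proof -
  have "du y n - (du x n + ddu x n (y - x) + dddu x n (y - x) (y - x) / 2) =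
    lin (\<lambda>i. u1 i y - (u1 i x + lin (\<lambda>j. u2 i j x) (y - x)
        + (1 / 2) * quad (\<lambda>j k. u3 i j k x) (y - x) (y - x))) n"
    by (simp only: lin_diff_coeff lin_add_coeff lin_scale_coeff quad_def cub_def)
  also have "\<bar>\<dots>\<bar> \<le> real CARD('d) * (scale (dist x y) ^ 3 * B) * norm n"
    using taylor_remainder(2)[OF assms] by (intro lin_le) simp
  finally show ?thesis .
qed

text \<open>Even powers of \<open>r\<close> cancel. With \<open>p = P - x\<close> the coefficient of
  \<open>2 * r\<close> is the second-order expansion at \<open>x\<close> of the derivative of
  \<open>u\<close> at \<open>P\<close> in direction \<open>n\<close>.\<close>

lemma taylor_normal_difference:
  assumes "x \<in> closure G"
  shows "taylor x (p + r *\<^sub>R n) - taylor x (p - r *\<^sub>R n) =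
    2 * r * (du x n + ddu x n p + dddu x n p p / 2) + r ^ 3 / 3 * dddu x n n n"
  using ddu_commute[OF assms, of p n] dddu_commute12[OF assms, of p n] dddu_commute23[OF assms, of p p n]
    dddu_commute23[OF assms, of p n n] dddu_commute23[OF assms, of n p n]
  by (simp add: taylor_def lin_simps quad_simps cub_simps power3_eq_cube field_simps)

lemma du_le: "x \<in> closure G \<Longrightarrow> \<bar>du x v\<bar> \<le> real CARD('d) * B * norm v"
  by (rule lin_le) (rule bound)

lemma ddu_le: "x \<in> closure G \<Longrightarrow> \<bar>ddu x v w\<bar> \<le> (real CARD('d))\<^sup>2 * B * norm v * norm w"
  by (rule quad_le) (rule bound)

lemma dddu_le: "x \<in> closure G \<Longrightarrow> \<bar>dddu x v w z\<bar> \<le> (real CARD('d)) ^ 3 * B * norm v * norm w * norm z"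
  by (rule cub_le) (rule bound)

end

section \<open>Averages over the values of an increment\<close>

definition signs :: "(real^'d::finite) set" where
  "signs = {e. \<forall>i. e $ i \<in> {1, -1}}"

definition avg :: "(real^'d::finite \<Rightarrow> real) \<Rightarrow> real" where
  "avg F = (\<Sum>e\<in>signs. F e) / real (card (signs :: (real^'d) set))"

lemma signs_eq_image: "(signs :: (real^'d::finite) set) = vec_lambda ` (UNIV \<rightarrow>\<^sub>E {1, -1})"
proof -
  have "e \<in> vec_lambda ` (UNIV \<rightarrow>\<^sub>E {1, -1})" if "e \<in> signs" for e :: "real^'d"
    using that by (intro image_eqI[of _ _ "vec_nth e"]) (auto simp: signs_def)
  then show ?thesis by (auto simp: signs_def)
qed

lemma finite_signs: "finite (signs :: (real^'d::finite) set)"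
  by (simp add: signs_eq_image finite_PiE)

lemma card_signs: "card (signs :: (real^'d::finite) set) = 2 ^ CARD('d)"
proof -
  have "inj_on vec_lambda (UNIV \<rightarrow>\<^sub>E {1, -1 :: real} :: ('d \<Rightarrow> real) set)"
    by (auto intro!: inj_onI simp: vec_lambda_inject)
  then show ?thesis
    by (simp add: signs_eq_image card_image card_PiE numeral_2_eq_2)
qed

lemma avg_const [simp]: "avg (\<lambda>e :: real^'d::finite. t) = t"
  by (simp add: avg_def card_signs)

lemma avg_add: "avg (\<lambda>e. F e + H e) = avg F + avg H"
  and avg_diff: "avg (\<lambda>e. F e - H e) = avg F - avg H"
  and avg_mult_left: "avg (\<lambda>e. t * F e) = t * avg F"
  and avg_divide: "avg (\<lambda>e. F e / t) = avg F / t"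
  by (simp_all add: avg_def sum.distrib sum_subtractf add_divide_distrib diff_divide_distrib
      sum_distrib_left sum_divide_distrib mult.commute)

lemma avg_sum: "avg (\<lambda>e. \<Sum>i\<in>I. F i e) = (\<Sum>i\<in>I. avg (F i))"
  unfolding avg_def by (subst sum.swap) (simp add: sum_divide_distrib)

lemma avg_mono: "(\<And>e. e \<in> signs \<Longrightarrow> F e \<le> H e) \<Longrightarrow> avg F \<le> avg H"
  unfolding avg_def by (intro divide_right_mono sum_mono) auto

lemma avg_abs_le: "(\<And>e. e \<in> signs \<Longrightarrow> \<bar>F e\<bar> \<le> H e) \<Longrightarrow> \<bar>avg F\<bar> \<le> avg H"
  using avg_mono[of F H] avg_mono[of "\<lambda>e. - H e" F] avg_mult_left[of "-1" H]
  by (force simp: abs_le_iff)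

lemma avg_antisymmetric:
  assumes "bij_betw \<phi> signs (signs :: (real^'d::finite) set)" "\<And>e. F (\<phi> e) = - F e"
  shows "avg F = 0"
proof -
  have "(\<Sum>e\<in>signs. F e) = (\<Sum>e\<in>signs. F (\<phi> e))"
    using sum.reindex_bij_betw[OF assms(1), of F] by simp
  then show ?thesis by (simp add: avg_def assms(2) sum_negf)
qed

lemma avg_odd: "(\<And>e. F (- e) = - F e) \<Longrightarrow> avg F = 0"
  by (rule avg_antisymmetric[of uminus])
    (auto intro!: bij_betwI[of _ _ _ uminus] simp: signs_def)

lemma avg_component_mult:
  "avg (\<lambda>e :: real^'d::finite. e $ k * e $ l) = (if k = l then 1 else 0)"
proof (cases "k = l")
  case True
  have "(e :: real^'d) $ k * e $ k = 1" if "e \<in> signs" for e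
    using that by (auto simp: signs_def dest: spec[of _ k])
  then have "(\<Sum>e\<in>(signs :: (real^'d) set). e $ k * e $ k) = (\<Sum>e\<in>(signs :: (real^'d) set). 1)"
    by (intro sum.cong) auto
  then show ?thesis using True by (simp add: avg_def card_signs)
next
  case False
  \<comment> \<open>Flipping the sign of coordinate \<open>k\<close> permutes \<open>signs\<close>
    and negates the product.\<close>
  let ?\<phi> = "\<lambda>e :: real^'d. \<chi> i. if i = k then - e $ i else e $ i"
  have "bij_betw ?\<phi> signs signs"
    by (rule bij_betwI[of _ _ _ ?\<phi>], auto simp: signs_def vec_eq_iff, metis+)
  then show ?thesis using False by (simp add: avg_antisymmetric)
qed

lemma quad_sum_basis:
  "quad a (A *v e) (A *v e) =
    (\<Sum>i\<in>UNIV. \<Sum>j\<in>UNIV. \<Sum>k\<in>UNIV. \<Sum>l\<in>UNIV. (A $ i $ k * A $ j $ l * a i j) * (e $ k * e $ l))"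
proof -
  have "quad a (A *v e) (A *v e) = (\<Sum>i\<in>UNIV. \<Sum>j\<in>UNIV. ((A *v e) $ i * (A *v e) $ j) * a i j)"
    by (simp add: quad_def lin_def sum_distrib_left mult.assoc)
  also have "\<dots> = (\<Sum>i\<in>UNIV. \<Sum>j\<in>UNIV. (\<Sum>k\<in>UNIV. \<Sum>l\<in>UNIV.
      (A $ i $ k * e $ k) * (A $ j $ l * e $ l)) * a i j)"
    by (simp add: matrix_vector_mult_def sum_product)
  finally show ?thesis by (simp add: sum_distrib_left sum_distrib_right mult_ac)
qed

text \<open>With \<open>A = \<sigma> x\<close> this turns the second-order part of the generator
  into an average over the increments.\<close>

lemma avg_quad:
  "avg (\<lambda>e. quad a (A *v e) (A *v e)) = (\<Sum>i\<in>UNIV. \<Sum>j\<in>UNIV. (A ** transpose A) $ i $ j * a i j)"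
proof -
  have "avg (\<lambda>e. quad a (A *v e) (A *v e)) =
    (\<Sum>i\<in>UNIV. \<Sum>j\<in>UNIV. \<Sum>k\<in>UNIV. \<Sum>l\<in>UNIV. (A $ i $ k * A $ j $ l * a i j) * (if k = l then 1 else 0))"
    unfolding quad_sum_basis by (simp only: avg_sum avg_mult_left avg_component_mult)
  also have "\<dots> = (\<Sum>i\<in>UNIV. \<Sum>j\<in>UNIV. (A ** transpose A) $ i $ j * a i j)"
    by (simp add: matrix_matrix_mult_def transpose_def sum_distrib_right if_distrib[of "\<lambda>t. _ * t"] cong: if_cong)
  finally show ?thesis .
qed

lemma matrix_vector_uminus: "(A :: real^'n::finite^'m::finite) *v (- e) = - (A *v e)"
  by (simp add: matrix_vector_mult_def vec_eq_iff sum_negf)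

context smooth4
begin

text \<open>Terms with an odd number of factors \<open>A *v e\<close> change sign under
  \<open>e \<mapsto> - e\<close> and drop out. With \<open>s\<^sup>2 = h\<close> the last bracket is
  of order \<open>h\<^sup>2\<close>.\<close>

lemma avg_taylor:
  assumes x: "x \<in> closure G"
  shows "avg (\<lambda>e. taylor x (h *\<^sub>R b + s *\<^sub>R (A *v e))) =
    u x + h * du x b + s\<^sup>2 * avg (\<lambda>e. ddu x (A *v e) (A *v e)) / 2
      + (h\<^sup>2 * ddu x b b / 2 + h ^ 3 * dddu x b b b / 6
          + h * s\<^sup>2 * avg (\<lambda>e. dddu x b (A *v e) (A *v e)) / 2)"
proof -
  have "taylor x (h *\<^sub>R b + s *\<^sub>R w) =
      (u x + h * du x b + h\<^sup>2 * ddu x b b / 2 + h ^ 3 * dddu x b b b / 6)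
    + (s\<^sup>2 / 2) * ddu x w w + (h * s\<^sup>2 / 2) * dddu x b w w
    + (s * du x w + h * s * ddu x b w + h\<^sup>2 * s / 2 * dddu x b b w + s ^ 3 / 6 * dddu x w w w)" for w
    using ddu_commute[OF x, of w b] dddu_commute12[OF x, of w b w] dddu_commute12[OF x, of w b b]
      dddu_commute23[OF x, of w w b] dddu_commute23[OF x, of b w b]
    by (simp add: taylor_def lin_simps quad_simps cub_simps power2_eq_square power3_eq_cube field_simps)
  moreover have "avg (\<lambda>e. s * du x (A *v e) + h * s * ddu x b (A *v e)
      + h\<^sup>2 * s / 2 * dddu x b b (A *v e) + s ^ 3 / 6 * dddu x (A *v e) (A *v e) (A *v e)) = 0"
    by (rule avg_odd) (simp add: matrix_vector_uminus lin_simps quad_simps cub_simps)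
  ultimately show ?thesis
    by (simp add: avg_add avg_mult_left avg_divide)
qed

end

section \<open>One step of the scheme\<close>

text \<open>The equation is required on the whole closure because the walk may stand on the
  frontier. Its second-order part is written as an average over the increments, the form in which a
  step produces it.\<close>

locale robin_scheme =
  interior_ball_domain G \<nu> \<delta> + smooth4 G u u1 u2 u3 u4 B K
  for G :: "(real^'d::finite) set" and \<nu> :: "real^'d \<Rightarrow> real^'d" and \<delta> :: real
    and u :: "real^'d \<Rightarrow> real" and u1 u2 u3 u4 and B K :: real +
  fixes \<sigma> :: "real^'d \<Rightarrow> real^'d^'d" and b :: "real^'d \<Rightarrow> real^'d"
    and c g \<gamma> \<psi> :: "real^'d \<Rightarrow> real" and A c0 :: real
  assumes A: "1 \<le> A" and c0: "0 < c0"
    and b_le: "\<And>x. x \<in> closure G \<Longrightarrow> norm (b x) \<le> A"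
    and \<sigma>_le: "\<And>x e. x \<in> closure G \<Longrightarrow> e \<in> signs \<Longrightarrow> norm (\<sigma> x *v e) \<le> A"
    and c_le: "\<And>x. x \<in> closure G \<Longrightarrow> \<bar>c x\<bar> \<le> A"
    and c_neg: "\<And>x. x \<in> closure G \<Longrightarrow> c x \<le> - c0"
    and g_le: "\<And>x. x \<in> closure G \<Longrightarrow> \<bar>g x\<bar> \<le> A"
    and \<gamma>_le: "\<And>z. z \<in> frontier G \<Longrightarrow> \<bar>\<gamma> z\<bar> \<le> A"
    and \<gamma>_nonpos: "\<And>z. z \<in> frontier G \<Longrightarrow> \<gamma> z \<le> 0"
    and equation: "\<And>x. x \<in> closure G \<Longrightarrow>
      du x (b x) + avg (\<lambda>e. ddu x (\<sigma> x *v e) (\<sigma> x *v e)) / 2 + c x * u x + g x = 0"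
    and boundary_condition: "\<And>z. z \<in> frontier G \<Longrightarrow> du z (\<nu> z) + \<gamma> z * u z = \<psi> z"
begin

definition trial :: "real \<Rightarrow> real^'d \<Rightarrow> real^'d \<Rightarrow> real^'d" where
  "trial h x e = x + h *\<^sub>R b x + sqrt h *\<^sub>R (\<sigma> x *v e)"

text \<open>The overshoot is \<open>0\<close> inside, which makes the formulas for the reflected step cover both cases.\<close>

definition over :: "real \<Rightarrow> real^'d \<Rightarrow> real^'d \<Rightarrow> real" where
  "over h x e = (if trial h x e \<in> closure G then 0 else gap (trial h x e))"

definition next_pos :: "real \<Rightarrow> real^'d \<Rightarrow> real^'d \<Rightarrow> real^'d" where
  "next_pos h x e = trial h x e + (2 * over h x e) *\<^sub>R \<nu> (proj (trial h x e))"

definition yfac :: "real \<Rightarrow> real^'d \<Rightarrow> real^'d \<Rightarrow> real" where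
  "yfac h x e = 1 + h * c x + 2 * over h x e * \<gamma> (proj (trial h x e))
     + 2 * (over h x e)\<^sup>2 * (\<gamma> (proj (trial h x e)))\<^sup>2"

definition zfac :: "real \<Rightarrow> real^'d \<Rightarrow> real^'d \<Rightarrow> real" where
  "zfac h x e = h * g x - 2 * over h x e * \<psi> (proj (trial h x e))
     - 2 * (over h x e)\<^sup>2 * \<psi> (proj (trial h x e)) * \<gamma> (proj (trial h x e))"

lemma robin_step_eq:
  "robin_step G \<nu> \<sigma> b c g \<gamma> \<psi> h e (x, y, z) =
    (next_pos h x e, y * yfac h x e, z + y * zfac h x e)"
  unfolding robin_step_def prod.case trial_def[symmetric] next_pos_def yfac_def zfac_def over_def
    gap_def proj_def
  by (simp add: Let_def algebra_simps)

text \<open>A trial step has length at most \<open>2 * A * sqrt h\<close>; the projection adds at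
  most as much again, and so does the reflection, whence the factor 6 in the condition for the
  Taylor expansion. The bound by \<open>\<delta>\<close> keeps the overshoot within the interior
  ball, and the conditions with \<open>1 / 2\<close> and \<open>1 / 4\<close> control
  \<open>h * c\<close> and \<open>r * \<gamma>\<close>, which keeps \<open>Y\<close>
  nonnegative.\<close>

definition small :: "real \<Rightarrow> bool" where
  "small h \<longleftrightarrow> 0 < h \<and> h \<le> 1 \<and> h * A \<le> 1 / 2 \<and> 6 * A * sqrt h < 1 / K \<and> 2 * A * sqrt h \<le> \<delta> \<and>
     2 * A * sqrt h * A \<le> 1 / 4"

lemma eventually_small: "\<forall>\<^sub>F h in at_right 0. small h"
proof -
  have lim: "((\<lambda>h. r * sqrt h) \<longlongrightarrow> 0) (at_right 0)" for r
    by (rule tendsto_eq_intros tendsto_real_sqrt refl | simp)+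
  have "((\<lambda>h. h * A) \<longlongrightarrow> 0) (at_right 0)"
    by (rule tendsto_eq_intros refl | simp)+
  then have "\<forall>\<^sub>F h in at_right 0. h * A < 1 / 2" by (rule order_tendstoD) simp
  moreover have "\<forall>\<^sub>F h in at_right 0. 6 * A * sqrt h < 1 / K"
    using K by (intro order_tendstoD(2)[OF lim]) simp
  moreover have "\<forall>\<^sub>F h in at_right 0. 2 * A * sqrt h < \<delta>"
    using \<delta> by (intro order_tendstoD(2)[OF lim])
  moreover have "\<forall>\<^sub>F h in at_right 0. (2 * A * A) * sqrt h < 1 / 4"
    by (intro order_tendstoD(2)[OF lim]) simp
  moreover have "\<forall>\<^sub>F h in at_right (0::real). h < 1"
    using eventually_at_right_real[OF zero_less_one] by eventually_elim simp
  ultimately show ?thesis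
    using eventually_at_right_less
    by eventually_elim (simp add: small_def mult_ac)
qed

text \<open>Chosen so that \<open>scale (6 * A * sqrt h) = rate * sqrt h\<close>.\<close>

definition rate :: real where
  "rate = 18 * real CARD('d) * K * A"

lemma rate_nonneg: "0 \<le> rate"
  using K A by (simp add: rate_def)

text \<open>The summands are the constants \<open>C1\<close> to \<open>C5\<close> of
  \<open>value_error\<close>: the remainder of \<open>u\<close>; the remainder of the normal
  derivative together with the cubic term; the product of \<open>h * c\<close> with the normal
  derivative; the expansion of \<open>u\<close> from \<open>P\<close> to the new position; the term
  with \<open>\<gamma>\<^sup>2\<close>.\<close>

definition step_const :: real where
  "step_const = rate ^ 4 * B
    + (2 * real CARD('d) * rate ^ 3 * B + 4 * A\<^sup>2 * real CARD('d) ^ 3 * B)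
    + 2 * A * (real CARD('d) * B)
    + 2 * A * ((3 * real CARD('d) * K)\<^sup>2 * B * (4 * A\<^sup>2))
    + 2 * (4 * A\<^sup>2) * A\<^sup>2 * (real CARD('d) * B)"

context
  fixes h x
  assumes h: "small h" and x: "x \<in> closure G"
begin

lemma h_bounds: "0 < h" "h \<le> 1" "h * A \<le> 1 / 2" "6 * A * sqrt h < 1 / K" "2 * A * sqrt h \<le> \<delta>"
    "2 * A * sqrt h * A \<le> 1 / 4" "h \<le> sqrt h" "sqrt h * sqrt h = h" "0 < sqrt h" "sqrt h \<le> 1"
proof -
  show "h \<le> sqrt h" using h by (intro real_le_rsqrt) (auto simp: small_def power2_eq_square mult_le_one mult_left_le)
qed (use h in \<open>auto simp: small_def\<close>)

context
  fixes e :: "real^'d"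
  assumes e: "e \<in> signs"
begin

lemma trial_dist: "dist x (trial h x e) \<le> 2 * A * sqrt h"
proof -
  have "norm (h *\<^sub>R b x) \<le> sqrt h * A"
    using h_bounds b_le[OF x] by (auto intro!: mult_mono)
  moreover have "norm (sqrt h *\<^sub>R (\<sigma> x *v e)) \<le> sqrt h * A"
    using h_bounds \<sigma>_le[OF x e] by (auto intro!: mult_left_mono)
  moreover have "dist x (trial h x e) = norm (h *\<^sub>R b x + sqrt h *\<^sub>R (\<sigma> x *v e))"
    unfolding dist_commute[of x] by (simp add: trial_def dist_norm add.assoc)
  ultimately have "dist x (trial h x e) \<le> sqrt h * A + sqrt h * A"
    using norm_triangle_ineq[of "h *\<^sub>R b x" "sqrt h *\<^sub>R (\<sigma> x *v e)"] by linarith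
  then show ?thesis by (simp add: mult_ac)
qed

lemma over_bounds: "0 \<le> over h x e" "over h x e \<le> 2 * A * sqrt h" "over h x e \<le> \<delta>"
    "over h x e * A \<le> 1 / 4"
proof -
  show "0 \<le> over h x e" by (simp add: over_def gap_nonneg)
  show *: "over h x e \<le> 2 * A * sqrt h"
    using gap_le_dist[OF x, of "trial h x e"] trial_dist A h_bounds by (auto simp: over_def)
  then show "over h x e \<le> \<delta>" using h_bounds by linarith
  show "over h x e * A \<le> 1 / 4"
    using mult_right_mono[OF *, of A] h_bounds A by linarith
qed

lemma outside:
  assumes "trial h x e \<notin> closure G"
  defines "P \<equiv> proj (trial h x e)" and "r \<equiv> over h x e"
  shows "trial h x e = P - r *\<^sub>R \<nu> P" "next_pos h x e = P + r *\<^sub>R \<nu> P" "0 < r"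
    "P \<in> frontier G" "P \<in> closure G" "next_pos h x e \<in> G"
proof -
  have r: "r = gap (trial h x e)" using assms by (simp add: over_def)
  show "trial h x e = P - r *\<^sub>R \<nu> P"
    using outside_eq[OF assms(1)] by (simp add: P_def r)
  show *: "next_pos h x e = P + r *\<^sub>R \<nu> P"
    using reflected_eq[OF assms(1)] r by (simp add: next_pos_def P_def r_def)
  show 0: "0 < r" using gap_pos[OF assms(1)] r by simp
  show P: "P \<in> frontier G" by (simp add: P_def proj_frontier)
  then show "P \<in> closure G" by (rule frontier_closure)
  show "next_pos h x e \<in> G"
    unfolding * using over_bounds(3) by (intro inward_mem P 0) (simp add: r_def)
qed

lemma next_pos_closure: "next_pos h x e \<in> closure G"
proof (cases "trial h x e \<in> closure G")
  case True
  then show ?thesis by (simp add: next_pos_def over_def)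
next
  case False
  then show ?thesis using outside(6) closure_subset by blast
qed

lemma yfac_eq: "yfac h x e = 1 + h * c x
    + 2 * (over h x e * \<gamma> (proj (trial h x e))) * (1 + over h x e * \<gamma> (proj (trial h x e)))"
  by (simp add: yfac_def power2_eq_square algebra_simps)

lemma over_\<gamma>: "- (1 / 4) \<le> over h x e * \<gamma> (proj (trial h x e))"
    "over h x e * \<gamma> (proj (trial h x e)) \<le> 0"
proof -
  let ?\<gamma> = "\<gamma> (proj (trial h x e))"
  have "\<bar>over h x e * ?\<gamma>\<bar> \<le> over h x e * A"
    using over_bounds(1) \<gamma>_le[OF proj_frontier] by (simp add: abs_mult mult_left_mono)
  then show "- (1 / 4) \<le> over h x e * ?\<gamma>" using over_bounds(4) by linarith
  show "over h x e * ?\<gamma> \<le> 0"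
    using over_bounds(1) \<gamma>_nonpos[OF proj_frontier] by (simp add: mult_nonneg_nonpos)
qed

text \<open>For \<open>t = r * \<gamma>\<close> between \<open>- 1 / 4\<close> and \<open>0\<close>
  the contribution \<open>2 * t * (1 + t)\<close> of a reflection lies between
  \<open>- 1 / 2\<close> and \<open>0\<close>, and \<open>h * c x \<ge> - 1 / 2\<close>.\<close>

lemma yfac_bounds: "0 \<le> yfac h x e" "yfac h x e \<le> 1 - c0 * h"
proof -
  define t where "t = over h x e * \<gamma> (proj (trial h x e))"
  have t: "- (1 / 4) \<le> t" "t \<le> 0" using over_\<gamma> by (auto simp: t_def)
  have "\<bar>h * c x\<bar> \<le> h * A"
    using h_bounds c_le[OF x] by (simp add: abs_mult)
  then have hc: "- (1 / 2) \<le> h * c x" using h_bounds(3) by linarith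
  have "t * (1 + t) \<le> 0" using t by (intro mult_nonpos_nonneg) auto
  moreover have "- (1 / 4) \<le> t * (1 + t)"
    using t mult_left_mono_neg[of 0 "1 + t" t] mult_left_mono_neg[of "1 + t" 1 t] by linarith
  moreover have "h * c x \<le> h * - c0"
    using c_neg[OF x] h_bounds by (intro mult_left_mono) auto
  ultimately show "0 \<le> yfac h x e" "yfac h x e \<le> 1 - c0 * h"
    using hc unfolding yfac_eq t_def[symmetric] by (auto simp: algebra_simps)
qed

lemma depth2_next: "depth2 (next_pos h x e) \<le> depth2 (trial h x e) - 4 * \<delta> * over h x e"
  using depth2_reflected[of "trial h x e"] over_bounds(3)
  by (simp add: next_pos_def over_def split: if_splits)

lemma scale_le: "d \<le> 6 * A * sqrt h \<Longrightarrow> 0 \<le> d \<Longrightarrow> 0 \<le> scale d \<and> scale d \<le> rate * sqrt h"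
  using K mult_left_mono[of d "6 * A * sqrt h" "3 * real CARD('d) * K"]
  by (simp add: scale_def rate_def mult_ac)

lemma value_near:
  assumes "y \<in> closure G" "dist x y \<le> 6 * A * sqrt h"
  shows "\<bar>u y - taylor x (y - x)\<bar> \<le> rate ^ 4 * B * h\<^sup>2"
    and "\<bar>du y n - (du x n + ddu x n (y - x) + dddu x n (y - x) (y - x) / 2)\<bar>
      \<le> real CARD('d) * rate ^ 3 * B * h * norm n"
proof -
  have near: "dist x y < 1 / K" using assms(2) h_bounds(4) by linarith
  have sc: "0 \<le> scale (dist x y)" "scale (dist x y) \<le> rate * sqrt h"
    using scale_le[OF assms(2)] by auto
  have "scale (dist x y) ^ 4 \<le> (rate * sqrt h) ^ 4" using sc by (intro power_mono)
  also have "\<dots> = rate ^ 4 * (sqrt h * sqrt h)\<^sup>2"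
    by (simp only: power_mult_distrib power4_eq_xxxx power2_eq_square mult_ac)
  also have "\<dots> = rate ^ 4 * h\<^sup>2" by (simp only: h_bounds(8))
  finally have "scale (dist x y) ^ 4 * B \<le> rate ^ 4 * h\<^sup>2 * B"
    using B by (rule mult_right_mono)
  then show "\<bar>u y - taylor x (y - x)\<bar> \<le> rate ^ 4 * B * h\<^sup>2"
    using taylor_remainder(1)[OF x assms(1) near] by (simp add: mult_ac)
  have "scale (dist x y) ^ 3 \<le> (rate * sqrt h) ^ 3" using sc by (intro power_mono)
  also have "\<dots> = rate ^ 3 * ((sqrt h * sqrt h) * sqrt h)"
    by (simp add: power_mult_distrib power3_eq_cube)
  also have "\<dots> \<le> rate ^ 3 * (h * 1)"
    using h_bounds rate_nonneg by (intro mult_left_mono) auto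
  finally have "scale (dist x y) ^ 3 * B \<le> rate ^ 3 * h * B"
    using B by (simp add: mult_right_mono)
  then have "real CARD('d) * (scale (dist x y) ^ 3 * B) * norm n
      \<le> real CARD('d) * (rate ^ 3 * h * B) * norm n"
    by (rule mult_right_mono[OF mult_left_mono]) auto
  then show "\<bar>du y n - (du x n + ddu x n (y - x) + dddu x n (y - x) (y - x) / 2)\<bar>
      \<le> real CARD('d) * rate ^ 3 * B * h * norm n"
    using du_remainder[OF x assms(1) near, of n] by (simp add: mult_ac)
qed

text \<open>Outside the closure the trial point and the new position lie symmetrically about the
  projection \<open>P\<close>, and the boundary condition at \<open>P\<close> cancels all terms of lower order in the
  overshoot; the Taylor polynomial at \<open>x\<close> plays the role of an extension of \<open>u\<close>.\<close>

lemma value_error: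
  "\<bar>u (next_pos h x e) * yfac h x e + zfac h x e
      - ((1 + h * c x) * taylor x (trial h x e - x) + h * g x)\<bar>
    \<le> step_const * (h\<^sup>2 + h * over h x e)"
proof -
  define C1 where "C1 = rate ^ 4 * B"
  define C2 where "C2 = 2 * real CARD('d) * rate ^ 3 * B + 4 * A\<^sup>2 * real CARD('d) ^ 3 * B"
  define C3 where "C3 = 2 * A * (real CARD('d) * B)"
  define C4 where "C4 = 2 * A * ((3 * real CARD('d) * K)\<^sup>2 * B * (4 * A\<^sup>2))"
  define C5 where "C5 = 2 * (4 * A\<^sup>2) * A\<^sup>2 * (real CARD('d) * B)"
  have C: "0 \<le> C1" "0 \<le> C2" "0 \<le> C3" "0 \<le> C4" "0 \<le> C5"
    using B A K rate_nonneg by (auto simp: C1_def C2_def C3_def C4_def C5_def)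
  have const: "step_const = C1 + C2 + C3 + C4 + C5"
    by (simp add: step_const_def C1_def C2_def C3_def C4_def C5_def)
  have "\<bar>h * c x\<bar> \<le> h * A"
    using h_bounds c_le[OF x] by (simp add: abs_mult)
  moreover have "h * c x \<le> 0"
    using h_bounds c_neg[OF x] c0 by (simp add: mult_nonneg_nonpos)
  ultimately have hc: "\<bar>1 + h * c x\<bar> \<le> 1" using h_bounds(3) by linarith
  show ?thesis
  proof (cases "trial h x e \<in> closure G")
    case True
    then have 0: "over h x e = 0" "next_pos h x e = trial h x e"
      by (simp_all add: over_def next_pos_def)
    have "u (next_pos h x e) * yfac h x e + zfac h x e
      - ((1 + h * c x) * taylor x (trial h x e - x) + h * g x)
      = (1 + h * c x) * (u (trial h x e) - taylor x (trial h x e - x))"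
      by (simp add: yfac_def zfac_def 0 algebra_simps)
    also have "\<bar>\<dots>\<bar> \<le> 1 * (C1 * h\<^sup>2)"
      unfolding abs_mult C1_def
    proof (rule mult_mono[OF hc value_near(1)[OF True]])
      have "0 \<le> A * sqrt h" using A h_bounds(9) by simp
      then show "dist x (trial h x e) \<le> 6 * A * sqrt h" using trial_dist by linarith
    qed auto
    also have "\<dots> \<le> step_const * h\<^sup>2"
      using C by (simp add: const mult_right_mono)
    finally show ?thesis by (simp add: 0)
  next
    case False
    define P where "P = proj (trial h x e)"
    define r where "r = over h x e"
    define n where "n = \<nu> P"
    define X where "X = next_pos h x e"
    define p where "p = P - x"
    note out = outside[OF False, folded P_def r_def n_def X_def]
    have n1: "norm n = 1" unfolding n_def by (rule \<nu>) (rule out)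
    have r: "0 < r" "r \<le> 2 * A * sqrt h" "r * A \<le> 1 / 4"
      using out(3) over_bounds by (auto simp: r_def)
    \<comment> \<open>This converts every \<open>r ^ 3\<close> below into a multiple of
      \<open>h * r\<close>.\<close>
    have "r\<^sup>2 \<le> (2 * A * sqrt h)\<^sup>2" using r by (intro power_mono) auto
    then have r2: "r\<^sup>2 \<le> 4 * A\<^sup>2 * h"
      using h_bounds by (simp add: power_mult_distrib)
    have XG: "X \<in> closure G" using next_pos_closure by (simp add: X_def)
    have tP: "dist (trial h x e) P = r" and PX: "dist P X = r"
      using n1 r by (simp_all add: out(1,2) dist_norm)
    have xP: "dist x P \<le> 4 * A * sqrt h" and xX: "dist x X \<le> 6 * A * sqrt h"
      using trial_dist r tP PX dist_triangle[of x P "trial h x e"] dist_triangle[of x X P] by linarith+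
    define un where "un = du P n"
    define T where "T = taylor x (trial h x e - x)"
    define m where "m = du x n + ddu x n p + dddu x n p p / 2"
    define t where "t = dddu x n n n"
    define \<gamma>' where "\<gamma>' = \<gamma> P"
    have un_le: "\<bar>un\<bar> \<le> real CARD('d) * B"
      using du_le[OF out(5), of n] n1 by (simp add: un_def)
    have \<gamma>': "\<bar>\<gamma>'\<bar> \<le> A" "- (1 / 4) \<le> r * \<gamma>'" "r * \<gamma>' \<le> 0"
      using \<gamma>_le[OF out(4)] over_\<gamma> by (auto simp: \<gamma>'_def r_def P_def)
    have T_eq: "taylor x (p + r *\<^sub>R n) - T = 2 * r * m + r ^ 3 / 3 * t"
      using taylor_normal_difference[OF x, of p r n]
      by (simp add: T_def m_def t_def out(1) p_def algebra_simps)
    have e1: "\<bar>u X - T - 2 * r * un\<bar> \<le> C1 * h\<^sup>2 + C2 * (h * r)"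
    proof -
      \<comment> \<open>\<open>T_eq\<close> supplies the difference of the two Taylor values;
        \<open>un - m\<close> is then the Taylor remainder of the normal derivative between
        \<open>x\<close> and \<open>P\<close>.\<close>
      have "u X - T - 2 * r * un =
          (u X - taylor x (X - x)) - (2 * r) * (un - m) + r * r\<^sup>2 * (t / 3)"
        using T_eq by (simp add: out(2) p_def algebra_simps power2_eq_square power3_eq_cube)
      moreover have "\<bar>u X - taylor x (X - x)\<bar> \<le> C1 * h\<^sup>2"
        unfolding C1_def using XG xX by (rule value_near)
      moreover have "\<bar>(2 * r) * (un - m)\<bar> \<le> (2 * r) * (real CARD('d) * rate ^ 3 * B * h)"
      proof -
        have "dist x P \<le> 6 * A * sqrt h" using xP A h_bounds(9) by (auto intro: order_trans)
        from value_near(2)[OF out(5) this, of n]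
        have "\<bar>un - m\<bar> \<le> real CARD('d) * rate ^ 3 * B * h"
          by (simp add: un_def m_def p_def n1)
        then show ?thesis using r by (simp add: abs_mult)
      qed
      moreover have "\<bar>r * r\<^sup>2 * (t / 3)\<bar> \<le> r * (4 * A\<^sup>2 * h) * (real CARD('d) ^ 3 * B)"
      proof -
        have "\<bar>t\<bar> \<le> real CARD('d) ^ 3 * B"
          using dddu_le[OF x, of n n n] n1 by (simp add: t_def)
        then have "\<bar>t / 3\<bar> \<le> real CARD('d) ^ 3 * B" by simp
        then show ?thesis
          unfolding abs_mult using r r2 h_bounds(1) by (intro mult_mono) auto
      qed
      ultimately have "\<bar>u X - T - 2 * r * un\<bar> \<le> C1 * h\<^sup>2
          + (2 * r) * (real CARD('d) * rate ^ 3 * B * h) + r * (4 * A\<^sup>2 * h) * (real CARD('d) ^ 3 * B)"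
        by linarith
      also have "\<dots> = C1 * h\<^sup>2 + C2 * (h * r)" by (simp add: C2_def algebra_simps)
      finally show ?thesis .
    qed
    have e2: "\<bar>2 * r * h * c x * un\<bar> \<le> C3 * (h * r)"
    proof -
      have "\<bar>2 * r * h * c x * un\<bar> \<le> 2 * r * h * A * (real CARD('d) * B)"
        unfolding abs_mult using r h_bounds c_le[OF x] un_le A by (intro mult_mono) auto
      then show ?thesis by (simp add: C3_def mult_ac)
    qed
    have e3: "\<bar>2 * r * (\<gamma>' * (1 + r * \<gamma>')) * (u X - u P - r * un)\<bar> \<le> C4 * (h * r)"
    proof -
      have "dist P X < 1 / K" using r PX h_bounds A by (smt (verit) mult_right_mono)
      moreover have "X - P = r *\<^sub>R n" by (simp add: out(2))
      ultimately
      have "\<bar>u X - u P - r * un\<bar> \<le> scale r ^ 2 * B"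
        using taylor_remainder(3)[OF out(5) XG, unfolded PX] by (simp add: un_def lin_scaleR PX)
      also have "\<dots> = (3 * real CARD('d) * K)\<^sup>2 * r\<^sup>2 * B" by (simp add: scale_def power_mult_distrib)
      also have "\<dots> \<le> (3 * real CARD('d) * K)\<^sup>2 * (4 * A\<^sup>2 * h) * B"
        using r2 B by (intro mult_right_mono mult_left_mono) auto
      finally have rem: "\<bar>u X - u P - r * un\<bar> \<le> (3 * real CARD('d) * K)\<^sup>2 * (4 * A\<^sup>2 * h) * B" .
      have "\<bar>\<gamma>' * (1 + r * \<gamma>')\<bar> \<le> A * 1"
        unfolding abs_mult using \<gamma>' A by (intro mult_mono) auto
      then have "\<bar>2 * r * (\<gamma>' * (1 + r * \<gamma>')) * (u X - u P - r * un)\<bar>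
          \<le> 2 * r * A * ((3 * real CARD('d) * K)\<^sup>2 * (4 * A\<^sup>2 * h) * B)"
        unfolding abs_mult[of "2 * r * _"] abs_mult[of "2 * r"] using rem r A
        by (intro mult_mono) auto
      then show ?thesis by (simp add: C4_def mult_ac)
    qed
    have e4: "\<bar>2 * (r * r\<^sup>2) * \<gamma>'\<^sup>2 * un\<bar> \<le> C5 * (h * r)"
    proof -
      have "\<gamma>'\<^sup>2 \<le> A\<^sup>2" using \<gamma>'(1) by (simp add: abs_le_square_iff[symmetric])
      then have "\<bar>2 * (r * r\<^sup>2) * \<gamma>'\<^sup>2 * un\<bar> \<le> 2 * (r * (4 * A\<^sup>2 * h)) * A\<^sup>2 * (real CARD('d) * B)"
        unfolding abs_mult using r r2 un_le h_bounds(1) by (intro mult_mono) auto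
      then show ?thesis by (simp add: C5_def mult_ac)
    qed
    have \<psi>: "\<psi> P = un + \<gamma>' * u P"
      using boundary_condition[OF out(4)] by (simp add: un_def n_def \<gamma>'_def)
    \<comment> \<open>With \<open>\<psi> P\<close> replaced by \<open>un + \<gamma>' * u P\<close>,
      the terms in \<open>u P\<close> cancel and those in \<open>un\<close> combine through
      \<open>(1 + r * \<gamma>') * (r * \<gamma>' - 1) + 1 = r\<^sup>2 * \<gamma>'\<^sup>2\<close>,
      the source of the last summand.\<close>
    have "u (next_pos h x e) * yfac h x e + zfac h x e
        - ((1 + h * c x) * taylor x (trial h x e - x) + h * g x)
      = (1 + h * c x) * (u X - T - 2 * r * un) + 2 * r * h * c x * un
        + 2 * r * (\<gamma>' * (1 + r * \<gamma>')) * (u X - u P - r * un) + 2 * (r * r\<^sup>2) * \<gamma>'\<^sup>2 * un"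
      unfolding yfac_def zfac_def P_def[symmetric] r_def[symmetric] X_def[symmetric]
        T_def[symmetric] \<psi> \<gamma>'_def[symmetric]
      by (simp add: algebra_simps power2_eq_square)
    also have "\<bar>\<dots>\<bar> \<le> (C1 * h\<^sup>2 + C2 * (h * r)) + C3 * (h * r) + C4 * (h * r) + C5 * (h * r)"
    proof -
      have "\<bar>(1 + h * c x) * (u X - T - 2 * r * un)\<bar> \<le> 1 * (C1 * h\<^sup>2 + C2 * (h * r))"
        unfolding abs_mult by (intro mult_mono hc e1) auto
      moreover have "\<bar>z1 + z2 + z3 + z4\<bar> \<le> t1 + t2 + t3 + t4"
        if "\<bar>z1\<bar> \<le> 1 * t1" "\<bar>z2\<bar> \<le> t2" "\<bar>z3\<bar> \<le> t3" "\<bar>z4\<bar> \<le> t4" for z1 z2 z3 z4 t1 t2 t3 t4 :: real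
        using that by linarith
      ultimately show ?thesis using e2 e3 e4 by blast
    qed
    also have "\<dots> \<le> step_const * (h\<^sup>2 + h * r)"
    proof -
      have "0 \<le> h * r" "0 \<le> h\<^sup>2" using h_bounds r by auto
      then have "0 \<le> C1 * (h * r)" "0 \<le> (C2 + C3 + C4 + C5) * h\<^sup>2" using C by auto
      then show ?thesis by (simp add: const algebra_simps)
    qed
    finally show ?thesis by (simp add: r_def)
  qed
qed

end

end

definition drift_const :: real where
  "drift_const = A * (A * B + A) + ((real CARD('d))\<^sup>2 * B * A\<^sup>2 + real CARD('d) ^ 3 * B * A ^ 3)"

text \<open>The terms of order \<open>h\<close> add up to \<open>L + c x * u x + g x\<close>, which
  vanishes by the equation. The product of \<open>h * c x\<close> with \<open>h * L\<close> and the
  rest \<open>R\<close> are of order \<open>h\<^sup>2\<close>.\<close>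

lemma avg_taylor_error:
  assumes h: "small h" and x: "x \<in> closure G"
  shows "\<bar>(1 + h * c x) * avg (\<lambda>e. taylor x (trial h x e - x)) + h * g x - u x\<bar> \<le> drift_const * h\<^sup>2"
proof -
  note hb = h_bounds[OF h x]
  define L where "L = du x (b x) + avg (\<lambda>e. ddu x (\<sigma> x *v e) (\<sigma> x *v e)) / 2"
  define R where "R = h\<^sup>2 * ddu x (b x) (b x) / 2 + h ^ 3 * dddu x (b x) (b x) (b x) / 6
    + h * h * avg (\<lambda>e. dddu x (b x) (\<sigma> x *v e) (\<sigma> x *v e)) / 2"
  have L: "L = - (c x * u x + g x)"
    using equation[OF x] by (simp add: L_def)
  have avgT: "avg (\<lambda>e. taylor x (trial h x e - x)) = u x + h * L + R"
    using avg_taylor[OF x, of h "b x" "sqrt h" "\<sigma> x"] hb(1)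
    by (simp add: trial_def L_def R_def add.assoc distrib_left)
  have "\<bar>c x * u x\<bar> \<le> A * B"
    unfolding abs_mult using c_le[OF x] bound(1)[OF x] A by (intro mult_mono) auto
  then have "\<bar>L\<bar> \<le> A * B + A" using g_le[OF x] unfolding L by linarith
  then have "\<bar>c x\<bar> * \<bar>L\<bar> \<le> A * (A * B + A)"
    using c_le[OF x] A by (intro mult_mono) auto
  then have cL: "\<bar>h\<^sup>2 * (c x * L)\<bar> \<le> h\<^sup>2 * (A * (A * B + A))"
    by (simp add: abs_mult mult_left_mono)
  let ?d = "real CARD('d)"
  have 1: "\<bar>ddu x (b x) (b x)\<bar> \<le> ?d\<^sup>2 * B * A * A"
    using b_le[OF x] B A by (intro order_trans[OF ddu_le[OF x]] mult_mono) auto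
  have ddd: "\<bar>dddu x v w z\<bar> \<le> ?d ^ 3 * B * A * A * A"
    if "norm v \<le> A" "norm w \<le> A" "norm z \<le> A" for v w z
    using that B A by (intro order_trans[OF dddu_le[OF x]] mult_mono) auto
  have 2: "\<bar>dddu x (b x) (b x) (b x)\<bar> \<le> ?d ^ 3 * B * A * A * A"
    by (intro ddd b_le x)
  have "\<bar>avg (\<lambda>e. dddu x (b x) (\<sigma> x *v e) (\<sigma> x *v e))\<bar> \<le> avg (\<lambda>e :: real^'d. ?d ^ 3 * B * A * A * A)"
    by (intro avg_abs_le ddd b_le \<sigma>_le x)
  then have 3: "\<bar>avg (\<lambda>e. dddu x (b x) (\<sigma> x *v e) (\<sigma> x *v e))\<bar> \<le> ?d ^ 3 * B * A * A * A"
    by simp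
  have R: "\<bar>R\<bar> \<le> h\<^sup>2 * (?d\<^sup>2 * B * A\<^sup>2 + ?d ^ 3 * B * A ^ 3)"
  proof -
    have Req: "R = h\<^sup>2 * (ddu x (b x) (b x) / 2 + h * (dddu x (b x) (b x) (b x) / 6)
      + avg (\<lambda>e. dddu x (b x) (\<sigma> x *v e) (\<sigma> x *v e)) / 2)"
      by (simp add: R_def power2_eq_square power3_eq_cube algebra_simps)
    have "\<bar>h * (dddu x (b x) (b x) (b x) / 6)\<bar> \<le> 1 * (?d ^ 3 * B * A * A * A / 6)"
      unfolding abs_mult using 2 hb by (intro mult_mono) auto
    then have "\<bar>ddu x (b x) (b x) / 2 + h * (dddu x (b x) (b x) (b x) / 6)
      + avg (\<lambda>e. dddu x (b x) (\<sigma> x *v e) (\<sigma> x *v e)) / 2\<bar> \<le> ?d\<^sup>2 * B * A * A + ?d ^ 3 * B * A * A * A"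
      using 1 3 by linarith
    from mult_left_mono[OF this, of "h\<^sup>2"] show ?thesis
      unfolding Req abs_mult by (simp add: power2_eq_square power3_eq_cube mult.assoc)
  qed
  have "\<bar>h * c x\<bar> \<le> h * A"
    using hb c_le[OF x] by (simp add: abs_mult)
  moreover have "h * c x \<le> 0"
    using hb c_neg[OF x] c0 by (simp add: mult_nonneg_nonpos)
  ultimately have hc: "\<bar>1 + h * c x\<bar> \<le> 1" using hb(3) by linarith
  have "\<bar>(1 + h * c x) * R\<bar> \<le> 1 * (h\<^sup>2 * (?d\<^sup>2 * B * A\<^sup>2 + ?d ^ 3 * B * A ^ 3))"
    unfolding abs_mult by (intro mult_mono hc R) auto
  moreover have "(1 + h * c x) * avg (\<lambda>e. taylor x (trial h x e - x)) + h * g x - u x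
      = h\<^sup>2 * (c x * L) + (1 + h * c x) * R + h * (L + c x * u x + g x)"
    by (simp add: avgT algebra_simps power2_eq_square)
  ultimately have "\<bar>(1 + h * c x) * avg (\<lambda>e. taylor x (trial h x e - x)) + h * g x - u x\<bar>
      \<le> h\<^sup>2 * (A * (A * B + A)) + h\<^sup>2 * (?d\<^sup>2 * B * A\<^sup>2 + ?d ^ 3 * B * A ^ 3)"
    using cL by (simp add: L)
  then show ?thesis by (simp add: drift_const_def algebra_simps)
qed

lemma avg_value_error:
  assumes h: "small h" and x: "x \<in> closure G"
  shows "\<bar>avg (\<lambda>e. u (next_pos h x e) * yfac h x e + zfac h x e) - u x\<bar>
    \<le> (step_const + drift_const) * (h * (h + avg (over h x)))"
proof -
  let ?V = "\<lambda>e. u (next_pos h x e) * yfac h x e + zfac h x e"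
  let ?T = "\<lambda>e. (1 + h * c x) * taylor x (trial h x e - x) + h * g x"
  have "\<bar>avg (\<lambda>e. ?V e - ?T e)\<bar> \<le> avg (\<lambda>e. step_const * (h\<^sup>2 + h * over h x e))"
    by (intro avg_abs_le value_error h x)
  also have "\<dots> = step_const * (h * (h + avg (over h x)))"
    by (simp add: avg_mult_left avg_add power2_eq_square distrib_left)
  finally have "\<bar>avg ?V - avg ?T\<bar> \<le> step_const * (h * (h + avg (over h x)))"
    by (simp add: avg_diff)
  moreover have "avg ?T = (1 + h * c x) * avg (\<lambda>e. taylor x (trial h x e - x)) + h * g x"
    by (simp add: avg_add avg_mult_left)
  moreover have "drift_const * h\<^sup>2 \<le> drift_const * (h * (h + avg (over h x)))"
  proof -
    have "0 \<le> avg (over h x)"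
      using avg_mono[of "\<lambda>e. 0" "over h x"] over_bounds(1)[OF h x] by simp
    moreover have "0 \<le> drift_const" using A B by (simp add: drift_const_def)
    ultimately show ?thesis
      using h_bounds(1)[OF h x] by (intro mult_left_mono) (auto simp: power2_eq_square)
  qed
  ultimately show ?thesis
    using avg_taylor_error[OF h x] unfolding distrib_right by linarith
qed

section \<open>The barrier and its mean decrease in one step\<close>

definition barrier_const :: real where
  "barrier_const = 2 * diameter (closure G) * A + 4 * A\<^sup>2"

text \<open>Discounting the additive constant by \<open>c0 * h\<close> gains
  \<open>h * (barrier_const + 1)\<close>: the first part pays for the growth of
  \<open>depth2\<close>, and the \<open>1\<close> leaves a net decrease of \<open>h\<close>.\<close>

definition barrier :: "real^'d \<Rightarrow> real" where
  "barrier x = (barrier_const + 1) / c0 + depth2 x"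

lemma barrier_const_nonneg: "0 \<le> barrier_const"
  using A diameter_ge_0[of "closure G"] bounded_closure[OF bounded_G]
  by (simp add: barrier_const_def)

lemma barrier_nonneg: "0 \<le> barrier x"
  using barrier_const_nonneg c0 depth2_nonneg by (simp add: barrier_def)

text \<open>The barrier decreases by \<open>4 \<delta> r\<close> under a reflection with overshoot \<open>r\<close>, while the discount
  \<open>1 - c0 h\<close> of a large constant makes up for the drift of \<open>depth2\<close>.\<close>

lemma avg_barrier:
  assumes h: "small h" and x: "x \<in> closure G"
  shows "avg (\<lambda>e. yfac h x e * barrier (next_pos h x e)) \<le> barrier x - (h + 2 * \<delta> * avg (over h x))"
proof -
  note hb = h_bounds[OF h x]
  obtain p where p: "norm p \<le> 2 * diameter (closure G)"
    "\<And>v. depth2 (x + v) \<le> depth2 x + p \<bullet> v + (norm v)\<^sup>2"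
    using depth2_semiconcave[OF x] by blast
  have c0A: "c0 * h \<le> 1 / 2"
  proof -
    have "c0 \<le> A" using c_le[OF x] c_neg[OF x] by linarith
    then have "c0 * h \<le> A * h" using hb by (intro mult_right_mono) auto
    then show ?thesis using hb(3) mult.commute[of A h] by linarith
  qed
  define q where "q = 1 - c0 * h"
  have q: "1 / 2 \<le> q" "q \<le> 1" using c0A c0 hb by (auto simp: q_def)
  define v where "v e = h *\<^sub>R b x + sqrt h *\<^sub>R (\<sigma> x *v e)" for e
  have trial: "trial h x e = x + v e" for e by (simp add: trial_def v_def add.assoc)
  have "yfac h x e * barrier (next_pos h x e)
      \<le> q * (barrier x + p \<bullet> v e + 4 * A\<^sup>2 * h - 4 * \<delta> * over h x e)" if e: "e \<in> signs" for e
  proof -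
    have "norm (v e) \<le> 2 * A * sqrt h"
      using trial_dist[OF h x e] by (simp add: trial dist_norm)
    then have "(norm (v e))\<^sup>2 \<le> (2 * A * sqrt h)\<^sup>2" by (intro power_mono) auto
    then have "(norm (v e))\<^sup>2 \<le> 4 * A\<^sup>2 * h"
      using hb by (simp add: power_mult_distrib)
    then have "barrier (next_pos h x e) \<le> barrier x + p \<bullet> v e + 4 * A\<^sup>2 * h - 4 * \<delta> * over h x e"
      using depth2_next[OF h x e] p(2)[of "v e"] unfolding trial barrier_def by linarith
    moreover have "yfac h x e * barrier (next_pos h x e) \<le> q * barrier (next_pos h x e)"
      using yfac_bounds(2)[OF h x e] barrier_nonneg by (intro mult_right_mono) (simp add: q_def)
    ultimately show ?thesis
      using q by (meson mult_left_mono order_trans zero_le_divide_1_iff zero_le_numeral)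
  qed
  then have "avg (\<lambda>e. yfac h x e * barrier (next_pos h x e))
      \<le> avg (\<lambda>e. q * (barrier x + p \<bullet> v e + 4 * A\<^sup>2 * h - 4 * \<delta> * over h x e))"
    by (rule avg_mono)
  \<comment> \<open>The noise part of \<open>p \<bullet> v e\<close> is odd in \<open>e\<close>, so
    the order \<open>sqrt h\<close> cancels.\<close>
  also have "\<dots> = q * (barrier x + h * (p \<bullet> b x) + 4 * A\<^sup>2 * h - 4 * \<delta> * avg (over h x))"
  proof -
    have "avg (\<lambda>e. sqrt h * (p \<bullet> (\<sigma> x *v e))) = 0"
      by (rule avg_odd) (simp add: matrix_vector_uminus)
    then have "avg (\<lambda>e. p \<bullet> v e) = h * (p \<bullet> b x)"
      by (simp add: v_def inner_add_right avg_add)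
    then show ?thesis by (simp add: avg_mult_left avg_add avg_diff)
  qed
  also have "\<dots> \<le> q * (barrier x + h * barrier_const - 4 * \<delta> * avg (over h x))"
  proof -
    have "p \<bullet> b x \<le> norm p * norm (b x)" by (rule norm_cauchy_schwarz)
    also have "\<dots> \<le> 2 * diameter (closure G) * A"
      using p(1) b_le[OF x] order_trans[OF norm_ge_zero p(1)] by (intro mult_mono) auto
    finally have "p \<bullet> b x + 4 * A\<^sup>2 \<le> barrier_const" by (simp add: barrier_const_def)
    then have "h * (p \<bullet> b x + 4 * A\<^sup>2) \<le> h * barrier_const"
      using hb by (intro mult_left_mono) auto
    then show ?thesis using q by (intro mult_left_mono) (auto simp: algebra_simps)
  qed
  also have "\<dots> \<le> barrier x - (h + 2 * \<delta> * avg (over h x))"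
  proof -
    have o: "0 \<le> avg (over h x)"
      using avg_mono[of "\<lambda>e. 0" "over h x"] over_bounds(1)[OF h x] by simp
    have "(c0 * h) * ((barrier_const + 1) / c0) \<le> (c0 * h) * barrier x"
      using c0 hb depth2_nonneg[of x] by (intro mult_left_mono) (auto simp: barrier_def)
    then have 1: "h * (barrier_const + 1) \<le> (c0 * h) * barrier x" using c0 by simp
    have 2: "q * (h * barrier_const) \<le> 1 * (h * barrier_const)"
      using q hb barrier_const_nonneg by (intro mult_right_mono) auto
    \<comment> \<open>The discount \<open>q\<close> is at least \<open>1 / 2\<close>, which reduces
      the gain \<open>4 * \<delta>\<close> to \<open>2 * \<delta>\<close> at worst.\<close>
    have 3: "(1 / 2) * (4 * \<delta> * avg (over h x)) \<le> q * (4 * \<delta> * avg (over h x))"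
      using q o \<delta> by (intro mult_right_mono) auto
    have "q * (barrier x + h * barrier_const - 4 * \<delta> * avg (over h x)) =
      barrier x - (c0 * h) * barrier x + q * (h * barrier_const) - q * (4 * \<delta> * avg (over h x))"
      by (simp add: q_def algebra_simps)
    with 1 2 3 show ?thesis unfolding distrib_left by linarith
  qed
  finally show ?thesis .
qed

text \<open>Bounding the error by a decrease of the barrier makes the errors of successive steps
  telescope.\<close>

lemma step_inequality:
  "\<exists>C\<ge>0. \<forall>h x. small h \<longrightarrow> x \<in> closure G \<longrightarrow>
    \<bar>avg (\<lambda>e. u (next_pos h x e) * yfac h x e + zfac h x e) - u x\<bar>
      \<le> C * h * (barrier x - avg (\<lambda>e. yfac h x e * barrier (next_pos h x e)))"
proof -
  \<comment> \<open>The decrease is \<open>h + 2 * \<delta> * avg (over h x)\<close>, the error a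
    multiple of \<open>h * (h + avg (over h x))\<close>; \<open>m\<close> compares the two
    brackets.\<close>
  define m where "m = min 1 (2 * \<delta>)"
  have m: "0 < m" "m \<le> 1" "m \<le> 2 * \<delta>" using \<delta> by (auto simp: m_def)
  define C where "C = (step_const + drift_const) / m"
  have sd: "0 \<le> step_const + drift_const"
    using A B K rate_nonneg by (simp add: step_const_def drift_const_def)
  then have "0 \<le> C" using m by (simp add: C_def)
  moreover have "\<bar>avg (\<lambda>e. u (next_pos h x e) * yfac h x e + zfac h x e) - u x\<bar>
      \<le> C * h * (barrier x - avg (\<lambda>e. yfac h x e * barrier (next_pos h x e)))"
    if h: "small h" and x: "x \<in> closure G" for h x
  proof -
    note hb = h_bounds[OF h x]
    have o: "0 \<le> avg (over h x)"
      using avg_mono[of "\<lambda>e. 0" "over h x"] over_bounds(1)[OF h x] by simp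
    have "m * (h + avg (over h x)) \<le> h + 2 * \<delta> * avg (over h x)"
      using mult_right_mono[OF m(2), of h] mult_right_mono[OF m(3) o] hb(1) unfolding distrib_left by linarith
    also have "\<dots> \<le> barrier x - avg (\<lambda>e. yfac h x e * barrier (next_pos h x e))"
      using avg_barrier[OF h x] by simp
    finally have "C * h * (m * (h + avg (over h x)))
        \<le> C * h * (barrier x - avg (\<lambda>e. yfac h x e * barrier (next_pos h x e)))"
      using \<open>0 \<le> C\<close> hb by (intro mult_left_mono) auto
    moreover have "C * h * (m * (h + avg (over h x))) = (step_const + drift_const) * (h * (h + avg (over h x)))"
      using m by (simp add: C_def)
    ultimately show ?thesis using avg_value_error[OF h x] by linarith
  qed
  ultimately show ?thesis by blast
qed

end

section \<open>Expectations over finitely many increments\<close>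

definition mean_upto :: "nat \<Rightarrow> ((nat \<Rightarrow> real^'d::finite) \<Rightarrow> real) \<Rightarrow> real" where
  "mean_upto N H = (\<Sum>e\<in>PiE {1..N} (\<lambda>_. signs). H e) / real (card (signs :: (real^'d) set)) ^ N"

lemma mean_upto_0: "mean_upto 0 H = H (\<lambda>_. undefined)"
  by (simp add: mean_upto_def)

text \<open>This replaces conditioning on the first \<open>N\<close> increments: they are held fixed
  while the last one is averaged.\<close>

lemma mean_upto_Suc:
  "mean_upto (Suc N) H = mean_upto N (\<lambda>e :: nat \<Rightarrow> real^'d::finite. avg (\<lambda>s. H (e(Suc N := s))))"
proof -
  let ?S = "signs :: (real^'d) set" and ?F = "PiE {1..N} (\<lambda>_. signs :: (real^'d) set)"
  have "(\<Sum>e\<in>PiE {1..Suc N} (\<lambda>_. ?S). H e) = (\<Sum>e\<in>(\<lambda>(y, g). g(Suc N := y)) ` (?S \<times> ?F). H e)"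
    by (simp add: atLeastAtMostSuc_conv PiE_insert_eq)
  also have "\<dots> = (\<Sum>(s, e)\<in>?S \<times> ?F. H (e(Suc N := s)))"
    by (subst sum.reindex) (auto intro!: inj_combinator sum.cong)
  also have "\<dots> = (\<Sum>e\<in>?F. \<Sum>s\<in>?S. H (e(Suc N := s)))"
    by (subst sum.cartesian_product[symmetric]) (rule sum.swap)
  finally show ?thesis
    by (simp add: mean_upto_def avg_def sum_divide_distrib)
qed

lemma mean_upto_mono:
  "(\<And>e. e \<in> PiE {1..N} (\<lambda>_. signs) \<Longrightarrow> F e \<le> H e) \<Longrightarrow> mean_upto N F \<le> mean_upto N H"
  unfolding mean_upto_def by (intro divide_right_mono sum_mono) auto

lemma mean_upto_const: "mean_upto N (\<lambda>e :: nat \<Rightarrow> real^'d::finite. t) = t"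
  by (simp add: mean_upto_def card_PiE card_signs)

lemma mean_upto_add: "mean_upto N (\<lambda>e. F e + H e) = mean_upto N F + mean_upto N H"
  by (simp add: mean_upto_def sum.distrib add_divide_distrib)

lemma (in prob_space) prob_increments:
  fixes \<xi> :: "nat \<Rightarrow> 'a \<Rightarrow> real^'d::finite"
  assumes \<xi>: "rademacher_increments \<xi>" and e: "e \<in> PiE {1..N} (\<lambda>_. signs)"
  defines "E \<equiv> {\<omega>\<in>space M. \<forall>k\<in>{1..N}. \<xi> k \<omega> = e k}"
  shows "E \<in> events" "prob E = 1 / real (card (signs :: (real^'d) set)) ^ N"
proof -
  define X where "X = (\<lambda>(k, i) \<omega>. \<xi> k \<omega> $ i)"
  define J where "J = {1..N} \<times> (UNIV :: 'd set)"
  have indep: "indep_vars (\<lambda>_. borel) X ({1..} \<times> UNIV)"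
    using \<xi> by (simp add: rademacher_increments_def X_def)
  have J: "J \<subseteq> {1..} \<times> UNIV" "finite J" by (auto simp: J_def)
  have half: "prob (X j -` {e (fst j) $ snd j} \<inter> space M) = 1 / 2" if jJ: "j \<in> J" for j
  proof -
    obtain k i where j: "j = (k, i)" "k \<in> {1..N}" using jJ by (auto simp: J_def)
    have "e k $ i \<in> {1, -1}" using e j by (auto simp: signs_def dest!: PiE_mem)
    moreover have "X j -` {e (fst j) $ snd j} \<inter> space M = {\<omega>\<in>space M. \<xi> k \<omega> $ i = e k $ i}"
      by (auto simp: X_def j)
    ultimately show ?thesis using \<xi> j(2) by (auto simp: rademacher_increments_def)
  qed
  \<comment> \<open>For \<open>N = 0\<close> the index set is empty, which
    \<open>indep_varsD\<close> excludes, and the intersection over it would not be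
    \<open>space M\<close>.\<close>
  have "E \<in> events \<and> prob E = 1 / real (card (signs :: (real^'d) set)) ^ N"
  proof (cases "N = 0")
    case True
    then show ?thesis by (simp add: E_def prob_space)
  next
    case False
    then have ne: "J \<noteq> {}" by (auto simp: J_def)
    have E: "E = (\<Inter>j\<in>J. X j -` {e (fst j) $ snd j} \<inter> space M)"
      using False by (auto simp: E_def J_def X_def vec_eq_iff)
    have "X j -` {e (fst j) $ snd j} \<inter> space M \<in> events" if "j \<in> J" for j
      using indep that J(1) by (intro measurable_sets[of _ _ borel]) (auto simp: indep_vars_def)
    then have "E \<in> events" unfolding E using ne J(2) by (intro sets.finite_INT) auto
    moreover have "prob E = (\<Prod>j\<in>J. prob (X j -` {e (fst j) $ snd j} \<inter> space M))"
      unfolding E by (rule indep_varsD[OF indep ne J(2) J(1)]) simp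
    moreover have "(\<Prod>j\<in>J. prob (X j -` {e (fst j) $ snd j} \<inter> space M)) = (1 / 2) ^ card J"
      using prod.cong[OF refl half, of J] by simp
    ultimately show ?thesis
      by (simp add: J_def card_cartesian_product card_signs power_one_over power_mult[symmetric] mult.commute)
  qed
  then show "E \<in> events" "prob E = 1 / real (card (signs :: (real^'d) set)) ^ N" by auto
qed

text \<open>The increments are sign vectors at every sample point, so the functional equals
  everywhere a finite combination of indicators of the events in \<open>prob_increments\<close>; its
  measurability comes for free.\<close>

lemma (in prob_space) expectation_increments:
  fixes \<xi> :: "nat \<Rightarrow> 'a \<Rightarrow> real^'d::finite"
  assumes \<xi>: "rademacher_increments \<xi>"
    and H: "\<And>e e'. (\<And>k. k \<in> {1..N} \<Longrightarrow> e k = e' k) \<Longrightarrow> H e = H e'"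
  shows "expectation (\<lambda>\<omega>. H (\<lambda>k. \<xi> k \<omega>)) = mean_upto N H"
proof -
  let ?F = "PiE {1..N} (\<lambda>_. signs :: (real^'d) set)"
  let ?E = "\<lambda>e. {\<omega>\<in>space M. \<forall>k\<in>{1..N}. \<xi> k \<omega> = e k}"
  have fin: "finite ?F" by (intro finite_PiE finite_signs) auto
  have "H (\<lambda>k. \<xi> k \<omega>) = (\<Sum>e\<in>?F. H e * indicator (?E e) \<omega>)" if \<omega>: "\<omega> \<in> space M" for \<omega>
  proof -
    define e0 where "e0 = restrict (\<lambda>k. \<xi> k \<omega>) {1..N}"
    have e0: "e0 \<in> ?F"
      using \<xi> \<omega> by (auto simp: e0_def rademacher_increments_def signs_def)
    have "indicator (?E e) \<omega> = (if e = e0 then 1 else (0::real))" if "e \<in> ?F" for e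
    proof -
      have "e = e0 \<longleftrightarrow> (\<forall>k\<in>{1..N}. \<xi> k \<omega> = e k)"
        using that by (metis PiE_restrict e0_def restrict_apply' restrict_ext)
      then show ?thesis using \<omega> by (simp add: indicator_def)
    qed
    then have "(\<Sum>e\<in>?F. H e * indicator (?E e) \<omega>) = (\<Sum>e\<in>?F. if e = e0 then H e else 0)"
      by (intro sum.cong) auto
    also have "\<dots> = H e0" using fin e0 by simp
    also have "\<dots> = H (\<lambda>k. \<xi> k \<omega>)" by (rule H) (simp add: e0_def)
    finally show ?thesis by simp
  qed
  then have "expectation (\<lambda>\<omega>. H (\<lambda>k. \<xi> k \<omega>)) = expectation (\<lambda>\<omega>. \<Sum>e\<in>?F. H e * indicator (?E e) \<omega>)"
    by (intro Bochner_Integration.integral_cong) auto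
  also have "\<dots> = (\<Sum>e\<in>?F. H e * prob (?E e))"
    using prob_increments(1)[OF \<xi>]
    by (subst Bochner_Integration.integral_sum) (auto simp: emeasure_eq_measure)
  also have "\<dots> = mean_upto N H"
    using prob_increments(2)[OF \<xi>] by (simp add: mean_upto_def sum_divide_distrib)
  finally show ?thesis .
qed

lemma robin_walk_cong:
  "(\<And>k. k \<in> {1..N} \<Longrightarrow> e k = e' k) \<Longrightarrow>
    robin_walk G \<nu> \<sigma> b c g \<gamma> \<psi> h e x N = robin_walk G \<nu> \<sigma> b c g \<gamma> \<psi> h e' x N"
  by (induction N) auto

section \<open>Summation of the step errors along the walk\<close>

context robin_scheme
begin

abbreviation walk :: "real \<Rightarrow> real^'d \<Rightarrow> (nat \<Rightarrow> real^'d) \<Rightarrow> nat \<Rightarrow> (real^'d) \<times> real \<times> real" where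
  "walk h x e N \<equiv> robin_walk G \<nu> \<sigma> b c g \<gamma> \<psi> h e x N"

lemma walk_Suc:
  assumes "walk h x e N = (X, Y, Z)"
  shows "walk h x (e(Suc N := s)) (Suc N) = (next_pos h X s, Y * yfac h X s, Z + Y * zfac h X s)"
proof -
  have "walk h x (e(Suc N := s)) N = walk h x e N" by (rule robin_walk_cong) simp
  then show ?thesis by (simp add: assms robin_step_eq)
qed

lemma walk_invariant:
  assumes h: "small h" and x: "x \<in> closure G" and "\<And>k. k \<in> {1..N} \<Longrightarrow> e k \<in> signs"
    and "walk h x e N = (X, Y, Z)"
  shows "X \<in> closure G \<and> 0 \<le> Y \<and> Y \<le> (1 - c0 * h) ^ N"
  using assms(3,4)
proof (induction N arbitrary: X Y Z)
  case 0
  then show ?case using x by simp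
next
  case (Suc N)
  obtain X' Y' Z' where *: "walk h x e N = (X', Y', Z')" by (cases "walk h x e N")
  with Suc have IH: "X' \<in> closure G" "0 \<le> Y'" "Y' \<le> (1 - c0 * h) ^ N" by auto
  have e: "e (Suc N) \<in> signs" using Suc.prems(1) by simp
  have eq: "X = next_pos h X' (e (Suc N))" "Y = Y' * yfac h X' (e (Suc N))"
    using Suc.prems(2) by (auto simp: * robin_step_eq)
  note y = yfac_bounds[OF h IH(1) e]
  have "yfac h X' (e (Suc N)) * Y' \<le> (1 - c0 * h) * (1 - c0 * h) ^ N"
    using IH y by (intro mult_mono) auto
  then show ?case
    using next_pos_closure[OF h IH(1) e] IH y by (simp add: eq mult.commute)
qed

definition value_of :: "(real^'d) \<times> real \<times> real \<Rightarrow> real" where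
  "value_of = (\<lambda>(X, Y, Z). u X * Y + Z)"

definition weight_of :: "(real^'d) \<times> real \<times> real \<Rightarrow> real" where
  "weight_of = (\<lambda>(X, Y, Z). Y * barrier X)"

text \<open>With the barrier as a compensator, both signs give a supermartingale: the error of one step
  is paid for by the decrease of the barrier.\<close>

lemma mean_value_bounds:
  assumes C: "\<And>x. x \<in> closure G \<Longrightarrow>
      \<bar>avg (\<lambda>e. u (next_pos h x e) * yfac h x e + zfac h x e) - u x\<bar>
        \<le> C * h * (barrier x - avg (\<lambda>e. yfac h x e * barrier (next_pos h x e)))"
    and h: "small h" and x: "x \<in> closure G" and \<tau>: "\<tau> = 1 \<or> \<tau> = -1"
  shows "mean_upto N (\<lambda>e. \<tau> * value_of (walk h x e N) + C * h * weight_of (walk h x e N))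
    \<le> \<tau> * u x + C * h * barrier x"
proof (induction N)
  case 0
  then show ?case by (simp add: mean_upto_0 value_of_def weight_of_def)
next
  case (Suc N)
  let ?\<Phi> = "\<lambda>s. \<tau> * value_of s + C * h * weight_of s"
  have "avg (\<lambda>s. ?\<Phi> (walk h x (e(Suc N := s)) (Suc N))) \<le> ?\<Phi> (walk h x e N)"
    if e: "e \<in> PiE {1..N} (\<lambda>_. signs)" for e
  proof -
    obtain X Y Z where XYZ: "walk h x e N = (X, Y, Z)" by (cases "walk h x e N")
    have X: "X \<in> closure G" and Y: "0 \<le> Y"
      using walk_invariant[OF h x PiE_mem[OF e] XYZ] by auto
    let ?v = "avg (\<lambda>s. u (next_pos h X s) * yfac h X s + zfac h X s)"
    let ?w = "avg (\<lambda>s. yfac h X s * barrier (next_pos h X s))"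
    have "?\<Phi> (walk h x (e(Suc N := s)) (Suc N)) =
        (\<tau> * Y) * (u (next_pos h X s) * yfac h X s + zfac h X s)
        + (C * h * Y) * (yfac h X s * barrier (next_pos h X s)) + \<tau> * Z" for s
      unfolding walk_Suc[OF XYZ] by (simp add: value_of_def weight_of_def algebra_simps)
    then have "avg (\<lambda>s. ?\<Phi> (walk h x (e(Suc N := s)) (Suc N))) =
        (\<tau> * Y) * ?v + (C * h * Y) * ?w + \<tau> * Z"
      by (simp only: avg_add avg_mult_left avg_const)
    \<comment> \<open>The step inequality is scaled by the current weight, which is legitimate
      because \<open>Y\<close> stays nonnegative.\<close>
    moreover have "Y * (\<tau> * (?v - u X)) \<le> Y * (C * h * (barrier X - ?w))"
      using C[OF X] \<tau> Y by (intro mult_left_mono) auto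
    ultimately show ?thesis
      by (simp add: XYZ value_of_def weight_of_def algebra_simps)
  qed
  then have "mean_upto (Suc N) (\<lambda>e. ?\<Phi> (walk h x e (Suc N))) \<le> mean_upto N (\<lambda>e. ?\<Phi> (walk h x e N))"
    unfolding mean_upto_Suc by (rule mean_upto_mono)
  with Suc show ?case by linarith
qed

text \<open>\<open>Z = V - u X * Y\<close>. The mean of \<open>V\<close> is controlled by the
  supermartingales, whose nonnegative compensator is dropped at time \<open>N\<close>, and
  \<open>u X * Y\<close> is at most \<open>B\<close> times the accumulated discount.\<close>

lemma mean_walk_Z_error:
  assumes C: "0 \<le> C" "\<And>x. x \<in> closure G \<Longrightarrow>
      \<bar>avg (\<lambda>e. u (next_pos h x e) * yfac h x e + zfac h x e) - u x\<bar>
        \<le> C * h * (barrier x - avg (\<lambda>e. yfac h x e * barrier (next_pos h x e)))"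
    and h: "small h" and x: "x \<in> closure G"
  shows "\<bar>mean_upto N (\<lambda>e. walk_Z (walk h x e N)) - u x\<bar>
    \<le> C * h * barrier x + B * exp (- c0 * (real N * h))"
proof -
  have h0: "0 < h" using h by (simp add: small_def)
  \<comment> \<open>Any sign vector would do here; the all-ones vector \<open>1\<close> is
    one.\<close>
  have pos: "0 \<le> 1 - c0 * h"
    using yfac_bounds[OF h x, of 1] by (simp add: signs_def)
  have "(1 - c0 * h) ^ N \<le> exp (- c0 * h) ^ N"
    using pos exp_ge_add_one_self[of "- c0 * h"] by (intro power_mono) auto
  also have "\<dots> = exp (- c0 * (real N * h))"
    by (simp add: exp_of_nat_mult[symmetric] mult_ac)
  finally have decay: "(1 - c0 * h) ^ N \<le> exp (- c0 * (real N * h))" .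
  have point: "\<tau> * walk_Z (walk h x e N)
      \<le> (\<tau> * value_of (walk h x e N) + C * h * weight_of (walk h x e N)) + B * exp (- c0 * (real N * h))"
    if e: "e \<in> PiE {1..N} (\<lambda>_. signs)" and \<tau>: "\<tau> = 1 \<or> \<tau> = -1" for e \<tau>
  proof -
    obtain X Y Z where XYZ: "walk h x e N = (X, Y, Z)" by (cases "walk h x e N")
    have X: "X \<in> closure G" and Y: "0 \<le> Y" "Y \<le> (1 - c0 * h) ^ N"
      using walk_invariant[OF h x PiE_mem[OF e] XYZ] by auto
    have "\<bar>u X * Y\<bar> \<le> B * exp (- c0 * (real N * h))"
      unfolding abs_mult using bound(1)[OF X] Y decay B by (intro mult_mono) auto
    then have "- (\<tau> * (u X * Y)) \<le> B * exp (- c0 * (real N * h))"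
      using \<tau> by auto
    moreover have "0 \<le> C * h * (Y * barrier X)"
      using C(1) h0 Y barrier_nonneg by simp
    ultimately show ?thesis
      by (simp add: XYZ walk_Z_def value_of_def weight_of_def algebra_simps)
  qed
  have bd: "mean_upto N (\<lambda>e. \<tau> * walk_Z (walk h x e N))
      \<le> \<tau> * u x + C * h * barrier x + B * exp (- c0 * (real N * h))" if \<tau>: "\<tau> = 1 \<or> \<tau> = -1" for \<tau>
  proof -
    have "mean_upto N (\<lambda>e. \<tau> * walk_Z (walk h x e N)) \<le> mean_upto N (\<lambda>e.
        (\<tau> * value_of (walk h x e N) + C * h * weight_of (walk h x e N)) + B * exp (- c0 * (real N * h)))"
      by (intro mean_upto_mono point \<tau>)
    then show ?thesis
      using mean_value_bounds[OF C(2) h x \<tau>, of N] by (simp add: mean_upto_add mean_upto_const)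
  qed
  have "mean_upto N (\<lambda>e. (-1) * walk_Z (walk h x e N)) = - mean_upto N (\<lambda>e. walk_Z (walk h x e N))"
    by (simp add: mean_upto_def sum_negf)
  with bd[of 1] bd[of "-1"] show ?thesis by (simp add: abs_le_iff)
qed

lemma expectation_walk_Z_error:
  assumes x: "x \<in> closure G" and M: "prob_space M" and \<xi>: "prob_space.rademacher_increments M \<xi>"
  shows "\<exists>C>0. \<exists>\<kappa>>0. \<forall>\<^sub>F h in at_right (0::real). \<forall>N T. T = real N * h \<longrightarrow>
    \<bar>prob_space.expectation M (\<lambda>\<omega>. walk_Z (walk h x (\<lambda>k. \<xi> k \<omega>) N)) - u x\<bar>
      \<le> C * (h + exp (- \<kappa> * T))"
proof -
  interpret prob_space M by (rule M)
  obtain C where C: "0 \<le> C" "\<And>h x. small h \<Longrightarrow> x \<in> closure G \<Longrightarrow>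
    \<bar>avg (\<lambda>e. u (next_pos h x e) * yfac h x e + zfac h x e) - u x\<bar>
      \<le> C * h * (barrier x - avg (\<lambda>e. yfac h x e * barrier (next_pos h x e)))"
    using step_inequality by blast
  \<comment> \<open>The first summand serves the term with \<open>h\<close>, the second the
    exponential term; the \<open>1\<close> makes the constant positive.\<close>
  define C' where "C' = C * barrier x + B + 1"
  have C': "0 < C'" using C(1) B barrier_nonneg[of x] by (simp add: C'_def add_nonneg_pos)
  have "\<bar>expectation (\<lambda>\<omega>. walk_Z (walk h x (\<lambda>k. \<xi> k \<omega>) N)) - u x\<bar>
      \<le> C' * (h + exp (- c0 * (real N * h)))" if h: "small h" for h N
  proof -
    have h0: "0 \<le> h" using h by (simp add: small_def)
    have "expectation (\<lambda>\<omega>. walk_Z (walk h x (\<lambda>k. \<xi> k \<omega>) N)) = mean_upto N (\<lambda>e. walk_Z (walk h x e N))"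
      by (rule expectation_increments[OF \<xi>]) (metis robin_walk_cong)
    then have "\<bar>expectation (\<lambda>\<omega>. walk_Z (walk h x (\<lambda>k. \<xi> k \<omega>) N)) - u x\<bar>
      \<le> (C * barrier x) * h + B * exp (- c0 * (real N * h))"
      using mean_walk_Z_error[OF C(1) C(2)[OF h] h x, of N] by (simp add: mult_ac)
    also have "\<dots> \<le> C' * h + C' * exp (- c0 * (real N * h))"
      using h0 C(1) B barrier_nonneg[of x] by (intro add_mono mult_right_mono) (auto simp: C'_def)
    finally show ?thesis by (simp add: distrib_left)
  qed
  then have "\<forall>\<^sub>F h in at_right (0::real). \<forall>N T. T = real N * h \<longrightarrow>
    \<bar>expectation (\<lambda>\<omega>. walk_Z (walk h x (\<lambda>k. \<xi> k \<omega>) N)) - u x\<bar> \<le> C' * (h + exp (- c0 * T))"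
    by (intro eventually_mono[OF eventually_small]) auto
  then show ?thesis using C' c0 by blast
qed

end

section \<open>Verification of the hypotheses\<close>

lemma holder_space_bounded:
  assumes "holder_space p \<alpha> U f" "0 < \<alpha>" "bounded U"
  shows "\<exists>B. \<forall>x\<in>closure U. norm (f x) \<le> B"
proof -
  have "compact (f ` closure U)"
    using holder_space_continuous_on[OF assms(1,2)] assms(3) by (intro compact_continuous_image) auto
  then show ?thesis by (meson bounded_iff compact_imp_bounded imageI)
qed

lemma common_bound:
  fixes F :: "'i::finite \<Rightarrow> 'a \<Rightarrow> 'b::real_normed_vector"
  assumes "\<And>i. \<exists>B. \<forall>x\<in>S. norm (F i x) \<le> B"
  shows "\<exists>B. \<forall>i. \<forall>x\<in>S. norm (F i x) \<le> B"
proof -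
  obtain B where B: "\<And>i x. x \<in> S \<Longrightarrow> norm (F i x) \<le> B i" using assms by metis
  have "norm (F i x) \<le> Max (range B)" if "x \<in> S" for i x
    using B[OF that, of i] by (rule order_trans) simp
  then show ?thesis by blast
qed

text \<open>On the frontier \<open>\<Psi> x\<close> lies in the hyperplane, where
  \<open>flatten i\<close> is the identity. Hence \<open>\<phi>\<close> agrees there with the
  continuous function \<open>H\<close> composed with \<open>\<Psi>\<close>, and continuity bounds it
  near each point.\<close>

lemma holder_space_boundary_bounded:
  fixes G :: "(real^'d::finite) set"
  assumes \<phi>: "holder_space_boundary p \<alpha> G \<phi>" and "0 < \<alpha>" and "bounded G"
  shows "\<exists>K\<ge>1. \<forall>z\<in>frontier G. \<bar>\<phi> z\<bar> \<le> K"
proof (rule compact_uniform_constant)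
  show "compact (frontier G)" using \<open>bounded G\<close> by (rule compact_frontier_bounded)
next
  fix z assume z: "z \<in> frontier G"
  then obtain r i \<Psi> \<Phi> where chart: "boundary_chart p \<alpha> G z r i \<Psi> \<Phi>"
    and hol: "holder_space p \<alpha> {y. flatten i y \<in> \<Psi> ` ball z r} (\<lambda>y. \<phi> (\<Phi> (flatten i y)))"
    using \<phi> unfolding holder_space_boundary_def by blast
  define V where "V = {y. flatten i y \<in> \<Psi> ` ball z r}"
  define H where "H y = \<phi> (\<Phi> (flatten i y))" for y
  have r: "0 < r" and inv: "\<And>x. x \<in> ball z r \<Longrightarrow> \<Phi> (\<Psi> x) = x"
    and \<Psi>: "holder_space p \<alpha> (ball z r) \<Psi>"
    and fr: "\<And>x. x \<in> ball z r \<Longrightarrow> x \<in> frontier G \<longleftrightarrow> \<Psi> x $ i = 0"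
    using chart by (auto simp: boundary_chart_def)
  have flat: "flatten i (\<Psi> x) = \<Psi> x" if "x \<in> ball z r" "x \<in> frontier G" for x
    using fr[OF that(1)] that(2) by (simp add: flatten_def vec_eq_iff)
  have V: "\<Psi> x \<in> V" and H: "H (\<Psi> x) = \<phi> x" if "x \<in> ball z r" "x \<in> frontier G" for x
    using flat[OF that] inv that by (auto simp: V_def H_def)
  have zb: "z \<in> ball z r" using r by simp
  have "continuous_on V H"
    using holder_space_continuous_on[OF hol \<open>0 < \<alpha>\<close>] closure_subset
    unfolding V_def H_def by (rule continuous_on_subset)
  moreover have "continuous_on (ball z r \<inter> frontier G) \<Psi>"
    by (rule continuous_on_subset[OF holder_space_continuous_on[OF \<Psi> \<open>0 < \<alpha>\<close>]])
      (use closure_subset in blast)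
  ultimately have "continuous_on (ball z r \<inter> frontier G) (\<lambda>x. H (\<Psi> x))"
    by (rule continuous_on_compose2) (use V in blast)
  then have "continuous_on (ball z r \<inter> frontier G) \<phi>"
    by (rule continuous_on_eq) (use H in auto)
  then obtain d where d: "0 < d"
    "\<And>x. x \<in> ball z r \<inter> frontier G \<Longrightarrow> dist x z < d \<Longrightarrow> dist (\<phi> x) (\<phi> z) < 1"
    using zb z unfolding continuous_on_iff by (metis IntI zero_less_one)
  have "\<bar>\<phi> x\<bar> \<le> \<bar>\<phi> z\<bar> + 1" if "x \<in> frontier G \<inter> ball z (min r d)" for x
    using d(2)[of x] that by (auto simp: dist_commute dist_real_def)
  then show "\<exists>r>0. \<exists>K\<ge>1. \<forall>y\<in>frontier G \<inter> ball z r. \<bar>\<phi> y\<bar> \<le> K"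
    using r d(1) by (intro exI[of _ "min r d"] conjI exI[of _ "\<bar>\<phi> z\<bar> + 1"]) auto
qed auto

section \<open>The boundary condition and the equation in terms of the extended derivatives\<close>

context smooth4
begin

text \<open>The boundary condition speaks of a one-sided difference quotient, the scheme of the
  extended gradient. The first-order remainder shows that they differ by at most
  \<open>k * t\<close>.\<close>

lemma inward_derivative:
  assumes z: "z \<in> closure G" and n: "norm n = 1" and "0 < \<delta>"
    and inside: "\<And>t. 0 < t \<Longrightarrow> t \<le> \<delta> \<Longrightarrow> z + t *\<^sub>R n \<in> G"
    and D: "((\<lambda>t. u (z + t *\<^sub>R n)) has_real_derivative D) (at_right 0)"
  shows "D = du z n"
proof -
  define k where "k = (3 * real CARD('d) * K)\<^sup>2 * B"
  have "((\<lambda>t. (u (z + t *\<^sub>R n) - u z) / t) \<longlongrightarrow> D) (at_right 0)"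
    using D by (simp add: has_field_derivative_iff)
  moreover have "((\<lambda>t. (u (z + t *\<^sub>R n) - u z) / t) \<longlongrightarrow> du z n) (at_right 0)"
  proof (rule Lim_transform2)
    have "\<forall>\<^sub>F t in at_right 0. t \<in> {0<..<min \<delta> (1 / K)}"
      using \<open>0 < \<delta>\<close> K by (intro eventually_at_right_real) simp
    then have "\<forall>\<^sub>F t in at_right 0. norm (du z n - (u (z + t *\<^sub>R n) - u z) / t) \<le> k * t"
    proof eventually_elim
      case (elim t)
      have "dist z (z + t *\<^sub>R n) = t" using elim n by (simp add: dist_norm)
      with taylor_remainder(3)[OF z, of "z + t *\<^sub>R n"] inside[of t] elim closure_subset[of G]
      have "\<bar>u (z + t *\<^sub>R n) - u z - t * du z n\<bar> \<le> (scale t)\<^sup>2 * B"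
        by (auto simp: lin_scaleR)
      also have "\<dots> = k * t * t" by (simp add: k_def scale_def power_mult_distrib power2_eq_square)
      finally have "\<bar>u (z + t *\<^sub>R n) - u z - t * du z n\<bar> / t \<le> k * t"
        using elim by (simp add: pos_divide_le_eq)
      moreover have "norm (du z n - (u (z + t *\<^sub>R n) - u z) / t)
          = \<bar>u (z + t *\<^sub>R n) - u z - t * du z n\<bar> / t"
      proof -
        have "du z n - (u (z + t *\<^sub>R n) - u z) / t = - ((u (z + t *\<^sub>R n) - u z - t * du z n) / t)"
          using elim by (simp add: field_simps)
        then show ?thesis using elim by (simp add: abs_divide)
      qed
      ultimately show ?case by simp
    qed
    moreover have "((\<lambda>t. k * t) \<longlongrightarrow> 0) (at_right 0)"
      by (rule tendsto_eq_intros refl | simp)+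
    ultimately show "((\<lambda>t. du z n - (u (z + t *\<^sub>R n) - u z) / t) \<longlongrightarrow> 0) (at_right 0)"
      by (rule Lim_null_comparison)
  qed (rule tendsto_const)
  ultimately show ?thesis
    by (rule tendsto_unique[OF trivial_limit_at_right_real])
qed

lemma generator_eq:
  assumes x: "x \<in> G"
  shows "generator (diffusion_matrix \<sigma>) b u x =
    du x (b x) + avg (\<lambda>e. ddu x (\<sigma> x *v e) (\<sigma> x *v e)) / 2"
proof -
  have "(partial_deriv j u has_partials_on u2 j) G" for j
    unfolding has_partials_on_def
  proof
    fix y assume y: "y \<in> G"
    show "(partial_deriv j u has_derivative (\<lambda>v. \<Sum>i\<in>UNIV. v $ i *\<^sub>R u2 j i y)) (at y)"
      by (rule has_derivative_transform_within_open[OF has_partials_onD[OF partials(2) y] open_G y])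
        (simp add: has_partials_on_partial_deriv[OF partials(1)])
  qed
  from has_partials_on_partial_deriv[OF this x]
  \<comment> \<open>Differentiation yields \<open>u2 j i x\<close>; symmetry puts the indices in the
    order used by \<open>generator\<close>.\<close>
  have "partial_deriv i (partial_deriv j u) x = u2 i j x" for i j
    using u2_commute[of x] x closure_subset[of G] by (metis subsetD)
  then show ?thesis
    using has_partials_on_partial_deriv[OF partials(1) x]
    by (simp add: generator_def avg_quad diffusion_matrix_def lin_def)
qed

text \<open>The equation passes to the frontier by continuity. For this the average is rewritten by
  \<open>avg_quad\<close> in terms of the continuous diffusion matrix.\<close>

lemma equation_on_closure:
  assumes eq: "\<And>x. x \<in> G \<Longrightarrow> generator (diffusion_matrix \<sigma>) b u x + c x * u x + g x = 0"
    and cont_coeff: "continuous_on (closure G) (diffusion_matrix \<sigma>)" "continuous_on (closure G) b"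
      "continuous_on (closure G) c" "continuous_on (closure G) g"
    and x: "x \<in> closure G"
  shows "du x (b x) + avg (\<lambda>e. ddu x (\<sigma> x *v e) (\<sigma> x *v e)) / 2 + c x * u x + g x = 0"
proof (rule eq_on_closure[where g = "\<lambda>x. 0", OF _ _ _ x])
  have "continuous_on (closure G) (\<lambda>x. (\<Sum>i\<in>UNIV. b x $ i * u1 i x)
     + (\<Sum>i\<in>UNIV. \<Sum>j\<in>UNIV. diffusion_matrix \<sigma> x $ i $ j * u2 i j x) / 2 + c x * u x + g x)"
    by (intro continuous_intros cont cont_coeff) auto
  then show "continuous_on (closure G)
      (\<lambda>x. du x (b x) + avg (\<lambda>e. ddu x (\<sigma> x *v e) (\<sigma> x *v e)) / 2 + c x * u x + g x)"
    by (simp add: avg_quad diffusion_matrix_def lin_def)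
  show "du x (b x) + avg (\<lambda>e. ddu x (\<sigma> x *v e) (\<sigma> x *v e)) / 2 + c x * u x + g x = 0"
    if "x \<in> G" for x
    using eq[OF that] by (simp add: generator_eq[OF that])
qed (rule continuous_on_const)

end

lemma smooth4_exists:
  fixes G :: "(real^'d::finite) set" and u :: "real^'d \<Rightarrow> real"
  assumes "open G" "bounded G" and u: "holder_space 4 \<alpha> G u" and \<alpha>: "0 < \<alpha>"
    and K: "1 \<le> K" "\<And>x y. x \<in> closure G \<Longrightarrow> y \<in> closure G \<Longrightarrow> dist x y < 1 / K \<Longrightarrow> linked K G x y"
  shows "\<exists>u1 u2 u3 u4 B. smooth4 G u u1 u2 u3 u4 B K"
proof -
  have h: "holder_space (Suc 3) \<alpha> G u" using u by (simp add: eval_nat_numeral)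
  obtain u1 where u1: "\<And>i. holder_space 3 \<alpha> G (u1 i)" "(u has_partials_on u1) G"
    using holder_space_partials[OF h] by metis
  then have "\<exists>f'. (\<forall>j. holder_space 2 \<alpha> G (f' j)) \<and> (u1 i has_partials_on f') G" for i
    using holder_space_partials[of 2 \<alpha> G "u1 i"] by (metis Suc_1 numeral_3_eq_3 numeral_2_eq_2)
  then obtain u2 where u2: "\<And>i j. holder_space 2 \<alpha> G (u2 i j)" "\<And>i. (u1 i has_partials_on u2 i) G"
    by metis
  then have "\<exists>f'. (\<forall>k. holder_space 1 \<alpha> G (f' k)) \<and> (u2 i j has_partials_on f') G" for i j
    using holder_space_partials[of 1 \<alpha> G "u2 i j"] by (metis Suc_1)
  then obtain u3 where u3: "\<And>i j k. holder_space 1 \<alpha> G (u3 i j k)"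
      "\<And>i j. (u2 i j has_partials_on u3 i j) G"
    by metis
  then have "\<exists>f'. (\<forall>l. holder_space 0 \<alpha> G (f' l)) \<and> (u3 i j k has_partials_on f') G" for i j k
    using holder_space_partials[of 0 \<alpha> G "u3 i j k"] by (metis One_nat_def)
  then obtain u4 where u4: "\<And>i j k l. holder_space 0 \<alpha> G (u4 i j k l)"
      "\<And>i j k. (u3 i j k has_partials_on u4 i j k) G"
    by metis
  note bdd = holder_space_bounded[OF _ \<alpha> \<open>bounded G\<close>]
  obtain B0 where B0: "\<And>x. x \<in> closure G \<Longrightarrow> norm (u x) \<le> B0" using bdd[OF u] by blast
  obtain B1 where B1: "\<And>i x. x \<in> closure G \<Longrightarrow> norm (u1 i x) \<le> B1"
    using common_bound[of "closure G" u1, OF bdd[OF u1(1)]] by blast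
  \<comment> \<open>Tuples of indices form a finite type again, so \<open>common_bound\<close> is
    used once for each order, with the tuple as its index.\<close>
  obtain B2 where B2: "\<And>p x. x \<in> closure G \<Longrightarrow> norm (u2 (fst p) (snd p) x) \<le> B2"
    using common_bound[of "closure G" "\<lambda>p. u2 (fst p) (snd p)", OF bdd[OF u2(1)]] by blast
  obtain B3 where B3: "\<And>p x. x \<in> closure G \<Longrightarrow> norm (u3 (fst p) (fst (snd p)) (snd (snd p)) x) \<le> B3"
    using common_bound[of "closure G" "\<lambda>p. u3 (fst p) (fst (snd p)) (snd (snd p))", OF bdd[OF u3(1)]]
    by blast
  define F4 where "F4 p = u4 (fst p) (fst (snd p)) (fst (snd (snd p))) (snd (snd (snd p)))" for p
  have "\<exists>B. \<forall>x\<in>closure G. norm (F4 p x) \<le> B" for p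
    unfolding F4_def by (rule bdd[OF u4(1)])
  from common_bound[of "closure G" F4, OF this]
  obtain B4 where B4: "\<And>p x. x \<in> closure G \<Longrightarrow> norm (F4 p x) \<le> B4" by blast
  define B where "B = Max {0, B0, B1, B2, B3, B4}"
  have le: "0 \<le> B" "B0 \<le> B" "B1 \<le> B" "B2 \<le> B" "B3 \<le> B" "B4 \<le> B"
    unfolding B_def by (rule Max_ge, simp, simp)+
  have "smooth4 G u u1 u2 u3 u4 B K"
  proof
    show "\<bar>u x\<bar> \<le> B" "\<bar>u1 i x\<bar> \<le> B" "\<bar>u2 i j x\<bar> \<le> B" "\<bar>u3 i j k x\<bar> \<le> B" if "x \<in> closure G" for x i j k
      using B0[OF that] B1[OF that, of i] B2[OF that, of "(i, j)"] B3[OF that, of "(i, j, k)"] le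
      by auto
    show "\<bar>u4 i j k l x\<bar> \<le> B" if "x \<in> G" for x i j k l
      using B4[of x "(i, j, k, l)"] that closure_subset[of G] le by (auto simp: F4_def)
    note c = holder_space_continuous_on[OF _ \<alpha>]
    show "continuous_on (closure G) u" "continuous_on (closure G) (u1 i)"
      "continuous_on (closure G) (u2 i j)" "continuous_on (closure G) (u3 i j k)" for i j k
      by (rule c[OF u] c[OF u1(1)] c[OF u2(1)] c[OF u3(1)])+
  qed (fact \<open>open G\<close> u1(2) u2(2) u3(2) u4(2) le(1) K)+
  then show ?thesis by blast
qed


theorem theorem5p1:
  fixes G :: "(real^'d::finite) set"
    and \<sigma> :: "real^'d \<Rightarrow> real^'d^'d"
    and b \<nu> :: "real^'d \<Rightarrow> real^'d"
    and c g \<gamma> \<psi> u :: "real^'d \<Rightarrow> real"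
    and x :: "real^'d"
    and \<epsilon> :: real
    and M :: "'w measure"
    and \<xi> :: "nat \<Rightarrow> 'w \<Rightarrow> real^'d"
  assumes eps: "0 < \<epsilon>" "\<epsilon> < 1"
    and domain: "open G" "connected G" "bounded G" "G \<noteq> {}"
    and normal: "\<forall>z\<in>frontier G. inward_unit_normal G z (\<nu> z)"
    and sigma: "holder_space 2 \<epsilon> G \<sigma>"
    and boundary: "holder_boundary 4 \<epsilon> G"
    and elliptic: "uniformly_elliptic_on (closure G) (diffusion_matrix \<sigma>)"
    and a: "holder_space 2 \<epsilon> G (diffusion_matrix \<sigma>)"
    and b: "holder_space 2 \<epsilon> G b"
    and g: "holder_space 2 \<epsilon> G g"
    and psi: "holder_space_boundary 3 \<epsilon> G \<psi>"
    and c: "holder_space 2 \<epsilon> G c" "\<forall>y\<in>closure G. c y < 0"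
    and gamma: "holder_space_boundary 3 \<epsilon> G \<gamma>" "\<forall>z\<in>frontier G. \<gamma> z \<le> 0"
    and u: "robin_solution \<epsilon> G \<nu> (diffusion_matrix \<sigma>) b c g \<gamma> \<psi> u"
    and x: "x \<in> closure G"
    and M: "prob_space M"
    and xi: "prob_space.rademacher_increments M \<xi>"
  shows "\<exists>C>0. \<exists>\<kappa>>0. \<forall>\<^sub>F h in at_right (0::real). \<forall>N T. T = real N * h \<longrightarrow>
    \<bar>prob_space.expectation M
        (\<lambda>\<omega>. walk_Z (robin_walk G \<nu> \<sigma> b c g \<gamma> \<psi> h (\<lambda>k. \<xi> k \<omega>) x N)) - u x\<bar>
      \<le> C * (h + exp (- \<kappa> * T))"
proof -
  have bd: "holder_boundary (Suc (Suc 2)) \<epsilon> G" using boundary by (simp add: eval_nat_numeral)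
  have sol: "holder_space 4 \<epsilon> G u"
    and pde: "\<And>x. x \<in> G \<Longrightarrow> generator (diffusion_matrix \<sigma>) b u x + c x * u x + g x = 0"
    and robin: "\<And>z. z \<in> frontier G \<Longrightarrow>
      \<exists>D. ((\<lambda>t. u (z + t *\<^sub>R \<nu> z)) has_real_derivative D) (at_right 0) \<and> D + \<gamma> z * u z = \<psi> z"
    using u by (auto simp: robin_solution_def)
  obtain \<delta> where \<delta>: "0 < \<delta>" "\<And>P. P \<in> frontier G \<Longrightarrow> ball (P + \<delta> *\<^sub>R \<nu> P) \<delta> \<subseteq> G"
    using uniform_interior_ball[OF bd eps(1) domain(3) normal] by blast
  interpret interior_ball_domain G \<nu> \<delta>
    using domain \<delta> normal by unfold_locales (auto simp: inward_unit_normal_def)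
  obtain K where K: "1 \<le> K"
      "\<And>x y. x \<in> closure G \<Longrightarrow> y \<in> closure G \<Longrightarrow> dist x y < 1 / K \<Longrightarrow> linked K G x y"
    using closure_linked[OF bd eps(1) domain(3,1) normal] by blast
  obtain u1 u2 u3 u4 B where smooth: "smooth4 G u u1 u2 u3 u4 B K"
    using smooth4_exists[OF domain(1,3) sol eps(1) K] by blast
  then interpret smooth4 G u u1 u2 u3 u4 B K .
  note cont_on = holder_space_continuous_on[OF _ eps(1)]
  note bdd = holder_space_bounded[OF _ eps(1) domain(3)]
  obtain A1 where A1: "\<And>x. x \<in> closure G \<Longrightarrow> norm (b x) \<le> A1" using bdd[OF b] by blast
  obtain A2 where A2: "\<And>x. x \<in> closure G \<Longrightarrow> norm (c x) \<le> A2" using bdd[OF c(1)] by blast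
  obtain A3 where A3: "\<And>x. x \<in> closure G \<Longrightarrow> norm (g x) \<le> A3" using bdd[OF g] by blast
  obtain A4 where A4: "\<And>z. z \<in> frontier G \<Longrightarrow> \<bar>\<gamma> z\<bar> \<le> A4"
    using holder_space_boundary_bounded[OF gamma(1) eps(1) domain(3)] by blast
  \<comment> \<open>There are only finitely many sign vectors, so a bound for each fixed
    \<open>e\<close> and their maximum give a uniform one.\<close>
  have "\<exists>A. \<forall>x\<in>closure G. norm (\<sigma> x *v e) \<le> A" for e
  proof -
    have "continuous_on (closure G) (\<lambda>x. \<sigma> x *v e)"
      unfolding matrix_vector_mult_def
      by (intro continuous_on_vec_lambda continuous_intros cont_on[OF sigma])
    then have "compact ((\<lambda>x. \<sigma> x *v e) ` closure G)"
      using domain(3) by (intro compact_continuous_image) auto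
    then show ?thesis by (meson bounded_iff compact_imp_bounded imageI)
  qed
  then obtain s where s: "\<And>e x. x \<in> closure G \<Longrightarrow> norm (\<sigma> x *v e) \<le> s e" by metis
  define A5 where "A5 = Max (s ` signs)"
  have A5: "norm (\<sigma> x *v e) \<le> A5" if "x \<in> closure G" "e \<in> signs" for x e
    using s[OF that(1), of e] by (rule order_trans) (simp add: A5_def finite_signs that(2))
  define A where "A = Max {1, A1, A2, A3, A4, A5}"
  have A: "1 \<le> A" "A1 \<le> A" "A2 \<le> A" "A3 \<le> A" "A4 \<le> A" "A5 \<le> A"
    unfolding A_def by (rule Max_ge, simp, simp)+
  \<comment> \<open>By compactness the pointwise condition \<open>c y < 0\<close> becomes uniform:
    \<open>- c m\<close> is positive and is the decay rate in the conclusion.\<close>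
  have "\<exists>x\<in>closure G. \<forall>y\<in>closure G. c y \<le> c x"
    using domain cont_on[OF c(1)] by (intro continuous_attains_sup) auto
  then obtain m where m: "m \<in> closure G" "\<And>y. y \<in> closure G \<Longrightarrow> c y \<le> c m" by blast
  interpret robin_scheme G \<nu> \<delta> u u1 u2 u3 u4 B K \<sigma> b c g \<gamma> \<psi> A "- c m"
  proof
    show "0 < - c m" using c(2) m(1) by simp
    show "du z (\<nu> z) + \<gamma> z * u z = \<psi> z" if z: "z \<in> frontier G" for z
    proof -
      obtain D where D: "((\<lambda>t. u (z + t *\<^sub>R \<nu> z)) has_real_derivative D) (at_right 0)"
          "D + \<gamma> z * u z = \<psi> z"
        using robin[OF z] by blast
      have "D = du z (\<nu> z)"
        by (rule inward_derivative[OF frontier_closure[OF z] \<nu>[OF z] \<delta>(1) inward_mem[OF z] D(1)])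
      with D(2) show ?thesis by simp
    qed
    show "du x (b x) + avg (\<lambda>e. ddu x (\<sigma> x *v e) (\<sigma> x *v e)) / 2 + c x * u x + g x = 0"
      if "x \<in> closure G" for x
      by (rule equation_on_closure[OF pde cont_on[OF a] cont_on[OF b] cont_on[OF c(1)] cont_on[OF g] that])
    show "norm (b x) \<le> A" "\<bar>c x\<bar> \<le> A" "\<bar>g x\<bar> \<le> A" if "x \<in> closure G" for x
      using A1[OF that] A2[OF that] A3[OF that] A by auto
    show "norm (\<sigma> x *v e) \<le> A" if "x \<in> closure G" "e \<in> signs" for x e
      using A5[OF that] A by linarith
    show "\<bar>\<gamma> z\<bar> \<le> A" "\<gamma> z \<le> 0" if "z \<in> frontier G" for z
      using A4[OF that] A gamma(2) that by auto
  qed (use A m in auto)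
  show ?thesis by (rule expectation_walk_Z_error[OF x M xi])
qed

end
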